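(* Let $\Gamma$ be a metric graph and let $\Sigma\subseteq R(D)$ be a tropical linear series of dimension $r$ on $\Gamma$ such that $D$ is nondegenerate in $|\Sigma|$. Let $E$ be the set of connected components of $\Gamma\smallsetminus\mathrm{supp}(D)$, and for $\varphi\in\Sigma$ let $F_\varphi=\{S\in E: S\not\subseteq\varphi_{\min}\}$. Then $\{F_\varphi:\varphi\in\Sigma\}\cup\{E\}$ is the set of flats of a matroid $M_\Sigma$ of rank $r+1$ on $E$, and the image of the embedding $\mathrm{Star}(D)\subseteq\mathbb R^E/(1,\dots,1)$ is the support of the Bergman fan of $M_\Sigma$.
   Context: A metric graph is a compact connected length metric space in which every point $p$ has a neighborhood isometric, with $p$ going to the center, to a star with $n_p\ge 1$ legs (equivalently, the metric space of a finite connected graph, possibly with loops and multiple edges, with positive real edge lengths); $n_p$ is the valence of $p$. A tangent direction at $p$ is a germ of isometric embeddings $\alpha\colon[0,\epsilon]\to\Gamma$ with $\alpha(0)=p$. A divisor on $\Gamma$ is a finite formal sum $D=\sum a_ip_i$ with $a_i\in\mathbb Z$, $p_i\in\Gamma$; $\deg D=\sum a_i$; $D\ge 0$ (effective) if all $a_i\ge0$; $\mathrm{supp}(D)$ is the set of points with nonzero multiplicity. $\mathrm{PL}(\Gamma)$ is the set of continuous piecewise-linear functions $\Gamma\to\mathbb R$ with integer slopes; $s_\zeta(\varphi)$ is the outgoing slope of $\varphi$ along a tangent direction $\zeta$, and $\mathrm{div}(\varphi)=\sum_p\big(-\sum_{\zeta \text{ at } p}s_\zeta(\varphi)\big)p$.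 $R(D)=\{\varphi\in\mathrm{PL}(\Gamma): D+\mathrm{div}(\varphi)\ge0\}$. A tropical submodule of $R(D)$ is a subset closed under pointwise minimum and addition of real constants (a zero element $\infty$ is tacitly adjoined); it is finitely generated if it is the set of all finite tropical linear combinations $\min_i\{\varphi_i+a_i\}$ of a finite set of elements. For a tropical submodule $\Sigma\subseteq R(D)$: $r_{\mathrm{BN}}(\Sigma)$ is the largest integer $r$ such that for every effective divisor $D'$ of degree $r$ there is $\varphi\in\Sigma$ with $D-D'+\mathrm{div}(\varphi)\ge0$. A finite set $\{\varphi_0,\dots,\varphi_s\}$ is tropically dependent if there are reals $a_i$ such that at every point of $\Gamma$ the minimum $\min_i\{\varphi_i+a_i\}$ is achieved at least twice, and independent otherwise; $r_{\mathrm{ind}}(\Sigma)$ is the size of the largest tropically independent subset. A tropical linear series of dimension $r$ is a finitely generated $\Sigma\subseteq R(D)$ with $r_{\mathrm{BN}}(\Sigma)=r$ and $r_{\mathrm{ind}}(\Sigma)=r+1$. $|\Sigma|=\{D+\mathrm{div}(\varphi):\varphi\in\Sigma\}$ is a polyhedral subset of $\mathrm{Sym}^d(\Gamma)=\Gamma^d/S_d$, $d=\deg D$ (with the polyhedral structure of $\mathrm{Sym}^d(\Gamma)$ whose coordinates on each face are the positions on the edges of the points of a divisor of fixed combinatorial type). The valence 1 degree of a divisor is the sum of its multiplicities at the valence 1 points of $\Gamma$. A divisor $D'\in|\Sigma|$ is nondegenerate if the function $\#\mathrm{supp}$ on $|\Sigma|$ has a local maximum at $D'$ and the valence 1 degree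 has a local minimum on $|\Sigma|$ at $D'$. For $\varphi\in\Sigma$, $\varphi_{\min}=\{p\in\Gamma:\varphi(p)=\min_\Gamma\varphi\}$. $\mathrm{Star}(x)$, for $x$ in a polyhedral space $\Delta$, is the space of germs of linear maps $[0,\epsilon]\to\Delta$ taking $0$ to $x$. When $D\in|\Sigma|$ is nondegenerate, choose a point $p_S\in S$ for each $S\in E$; the evaluation map $D+\mathrm{div}(\varphi)\mapsto(\varphi(p_S))_{S\in E}$ gives local coordinates in a neighborhood of $D$ in $|\Sigma|$, is affine on the cells of a polyhedral structure near $D$, and induces (by linear extension) the embedding $\mathrm{Star}(D)\subseteq\mathbb R^E/(1,\dots,1)$ in the claim. The (support of the) Bergman fan of a loopless matroid $M$ on $E$ is the set of classes in $\mathbb R^E/(1,\dots,1)$ of vectors $u$ such that for each circuit $C$ of $M$ the minimum $\min_{i\in C}u_i$ is attained at least twice; equivalently the union of the cones generated by the indicator vectors $1_{F}$ of the flats in chains of proper nonempty flats. *)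

theory Defs
  imports "HOL-Analysis.Analysis"
begin

section \<open>Metric graphs\<close>

definition path_length :: "(real \<Rightarrow> 'a::metric_space) \<Rightarrow> ereal" where
  "path_length \<gamma> =
     (SUP ts \<in> {ts :: real list. sorted ts \<and> set ts \<subseteq> {0..1}}.
        ereal (\<Sum>i<length ts - 1. dist (\<gamma> (ts ! i)) (\<gamma> (ts ! Suc i))))"

text \<open>The union of the legs \<open>\<psi> i ` {0..\<epsilon>}\<close>, for \<open>i < n\<close>, is a neighbourhood of \<open>p\<close>
  isometric to a star with \<open>n\<close> legs of length \<open>\<epsilon>\<close> and centre \<open>p\<close>. The distance of two points of a
  star is measured along the leg if they lie on the same leg, and through the centre otherwise.\<close>

definition star_nbhd :: "'a::metric_space \<Rightarrow> nat \<Rightarrow> real \<Rightarrow> (nat \<Rightarrow> real \<Rightarrow> 'a) \<Rightarrow> bool" where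
  "star_nbhd p n \<epsilon> \<psi> \<longleftrightarrow>
     n \<ge> 1 \<and> \<epsilon> > 0 \<and> (\<forall>i<n. \<psi> i 0 = p) \<and>
     (\<forall>i<n. \<forall>j<n. \<forall>s\<in>{0..\<epsilon>}. \<forall>t\<in>{0..\<epsilon>}.
        dist (\<psi> i s) (\<psi> j t) = (if i = j then \<bar>s - t\<bar> else s + t)) \<and>
     p \<in> interior (\<Union>i<n. \<psi> i ` {0..\<epsilon>})"

text \<open>The metric graph is the whole of the type \<open>'a\<close>. The condition \<open>n \<ge> 1\<close> in
  \<open>star_nbhd\<close> excludes the one-point space.\<close>

definition metric_graph :: "'a::metric_space itself \<Rightarrow> bool" where
  "metric_graph _ \<longleftrightarrow>
     compact (UNIV :: 'a set) \<and> connected (UNIV :: 'a set) \<and>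
     (\<forall>x y :: 'a. ereal (dist x y) =
        (INF \<gamma> \<in> {\<gamma>. path \<gamma> \<and> pathstart \<gamma> = x \<and> pathfinish \<gamma> = y}. path_length \<gamma>)) \<and>
     (\<forall>p :: 'a. \<exists>n \<epsilon> \<psi>. star_nbhd p n \<epsilon> \<psi>)"

definition valence :: "'a::metric_space \<Rightarrow> nat" where
  "valence p = (THE n. \<exists>\<epsilon> \<psi>. star_nbhd p n \<epsilon> \<psi>)"

definition isometric_embedding :: "real \<Rightarrow> (real \<Rightarrow> 'a::metric_space) \<Rightarrow> bool" where
  "isometric_embedding \<epsilon> \<alpha> \<longleftrightarrow> (\<forall>s\<in>{0..\<epsilon>}. \<forall>t\<in>{0..\<epsilon>}. dist (\<alpha> s) (\<alpha> t) = \<bar>s - t\<bar>)"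

text \<open>Two maps, each defined on some \<open>[0,\<epsilon>]\<close> and extended arbitrarily to \<open>real\<close>, have the same
  germ at 0.\<close>

definition germ_rel :: "((real \<Rightarrow> 'b) \<times> (real \<Rightarrow> 'b)) set" where
  "germ_rel = {(f, g). \<exists>\<epsilon>>0. \<forall>t\<in>{0..\<epsilon>}. f t = g t}"

definition tangent_directions :: "'a::metric_space \<Rightarrow> (real \<Rightarrow> 'a) set set" where
  "tangent_directions p = {\<alpha>. \<alpha> 0 = p \<and> (\<exists>\<epsilon>>0. isometric_embedding \<epsilon> \<alpha>)} // germ_rel"

section \<open>Divisors and piecewise linear functions\<close>

type_synonym 'a divisor = "'a \<Rightarrow> int"

definition supp :: "'a divisor \<Rightarrow> 'a set" where
  "supp D = {p. D p \<noteq> 0}"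

definition is_divisor :: "'a divisor \<Rightarrow> bool" where
  "is_divisor D \<longleftrightarrow> finite (supp D)"

definition divisor_degree :: "'a divisor \<Rightarrow> int" where
  "divisor_degree D = (\<Sum>p\<in>supp D. D p)"

definition effective :: "'a divisor \<Rightarrow> bool" where
  "effective D \<longleftrightarrow> (\<forall>p. D p \<ge> 0)"

definition valence1_degree :: "('a::metric_space) divisor \<Rightarrow> int" where
  "valence1_degree D = (\<Sum>p\<in>{p \<in> supp D. valence p = 1}. D p)"

text \<open>Piecewise linear on \<open>[0,\<epsilon>]\<close> with integer slopes: on every subinterval without breakpoints
  (elements of \<open>B\<close>) in its interior, \<open>f\<close> is affine with integer slope.\<close>

definition piecewise_linear_int :: "real \<Rightarrow> (real \<Rightarrow> real) \<Rightarrow> bool" where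
  "piecewise_linear_int \<epsilon> f \<longleftrightarrow>
     (\<exists>B. finite B \<and>
        (\<forall>x y. 0 \<le> x \<and> x \<le> y \<and> y \<le> \<epsilon> \<and> {x<..<y} \<inter> B = {} \<longrightarrow>
           (\<exists>m::int. \<forall>t\<in>{x..y}. f t = f x + of_int m * (t - x))))"

definition PL :: "('a::metric_space \<Rightarrow> real) set" where
  "PL = {\<phi>. continuous_on UNIV \<phi> \<and>
           (\<forall>\<epsilon> \<alpha>. isometric_embedding \<epsilon> \<alpha> \<longrightarrow> piecewise_linear_int \<epsilon> (\<phi> \<circ> \<alpha>))}"

definition outgoing_slope :: "('a::metric_space \<Rightarrow> real) \<Rightarrow> (real \<Rightarrow> 'a) set \<Rightarrow> int" where
  "outgoing_slope \<phi> \<zeta> =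
     (THE m. \<exists>\<alpha>\<in>\<zeta>. \<exists>\<epsilon>>0. \<forall>t\<in>{0..\<epsilon>}. \<phi> (\<alpha> t) = \<phi> (\<alpha> 0) + of_int m * t)"

definition principal_divisor :: "('a::metric_space \<Rightarrow> real) \<Rightarrow> 'a divisor" where
  "principal_divisor \<phi> = (\<lambda>p. - (\<Sum>\<zeta>\<in>tangent_directions p. outgoing_slope \<phi> \<zeta>))"

definition add_div :: "'a divisor \<Rightarrow> ('a::metric_space \<Rightarrow> real) \<Rightarrow> 'a divisor" where
  "add_div D \<phi> = (\<lambda>p. D p + principal_divisor \<phi> p)"

definition rational_sections :: "('a::metric_space) divisor \<Rightarrow> ('a \<Rightarrow> real) set" where
  "rational_sections D = {\<phi> \<in> PL. effective (add_div D \<phi>)}"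

section \<open>Tropical linear series\<close>

text \<open>Tropical submodules are represented by their real-valued elements; the adjoined element
  \<open>\<infinity>\<close> is omitted.\<close>

definition tropical_submodule :: "('a \<Rightarrow> real) set \<Rightarrow> bool" where
  "tropical_submodule \<Sigma> \<longleftrightarrow>
     (\<forall>\<phi>\<in>\<Sigma>. \<forall>\<psi>\<in>\<Sigma>. (\<lambda>p. min (\<phi> p) (\<psi> p)) \<in> \<Sigma>) \<and>
     (\<forall>\<phi>\<in>\<Sigma>. \<forall>c. (\<lambda>p. \<phi> p + c) \<in> \<Sigma>)"

definition tropical_span :: "('a \<Rightarrow> real) set \<Rightarrow> ('a \<Rightarrow> real) set" where
  "tropical_span G =
     {\<lambda>p. Min ((\<lambda>\<phi>. \<phi> p + a \<phi>) ` T) | T a. T \<subseteq> G \<and> finite T \<and> T \<noteq> {}}"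

definition finitely_generated :: "('a \<Rightarrow> real) set \<Rightarrow> bool" where
  "finitely_generated \<Sigma> \<longleftrightarrow> (\<exists>G. finite G \<and> G \<subseteq> \<Sigma> \<and> \<Sigma> = tropical_span G)"

definition r_BN :: "('a::metric_space) divisor \<Rightarrow> ('a \<Rightarrow> real) set \<Rightarrow> int" where
  "r_BN D \<Sigma> =
     (GREATEST r. \<forall>D'. is_divisor D' \<and> effective D' \<and> divisor_degree D' = r \<longrightarrow>
        (\<exists>\<phi>\<in>\<Sigma>. effective (add_div (\<lambda>p. D p - D' p) \<phi>)))"

definition tropically_dependent :: "('a \<Rightarrow> real) set \<Rightarrow> bool" where
  "tropically_dependent T \<longleftrightarrow>
     (\<exists>a. \<forall>p. \<exists>f\<in>T. \<exists>g\<in>T. f \<noteq> g \<and> f p + a f = g p + a g \<and>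
        (\<forall>h\<in>T. f p + a f \<le> h p + a h))"

definition r_ind :: "('a \<Rightarrow> real) set \<Rightarrow> enat" where
  "r_ind \<Sigma> = (SUP T \<in> {T. T \<subseteq> \<Sigma> \<and> finite T \<and> \<not> tropically_dependent T}. enat (card T))"

definition tropical_linear_series ::
  "('a::metric_space) divisor \<Rightarrow> ('a \<Rightarrow> real) set \<Rightarrow> nat \<Rightarrow> bool" where
  "tropical_linear_series D \<Sigma> r \<longleftrightarrow>
     \<Sigma> \<subseteq> rational_sections D \<and> tropical_submodule \<Sigma> \<and> finitely_generated \<Sigma> \<and>
     r_BN D \<Sigma> = int r \<and> r_ind \<Sigma> = enat (r + 1)"

definition linear_system :: "('a::metric_space) divisor \<Rightarrow> ('a \<Rightarrow> real) set \<Rightarrow> 'a divisor set" where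
  "linear_system D \<Sigma> = add_div D ` \<Sigma>"

section \<open>Symmetric powers and nondegenerate divisors\<close>

definition tuple_divisor :: "nat \<Rightarrow> (nat \<Rightarrow> 'a) \<Rightarrow> 'a divisor" where
  "tuple_divisor d x = (\<lambda>p. int (card {i. i < d \<and> x i = p}))"

text \<open>The symmetric power: the effective divisors of degree \<open>d\<close>, with the quotient topology along
  \<open>(x\<^sub>0, \<dots>, x\<^sub>d\<^sub>-\<^sub>1) \<mapsto> \<Sum>i. x\<^sub>i\<close>.\<close>

definition sym_open :: "nat \<Rightarrow> ('a::topological_space) divisor set \<Rightarrow> bool" where
  "sym_open d U \<longleftrightarrow>
     U \<subseteq> {D. is_divisor D \<and> effective D \<and> divisor_degree D = int d} \<and>
     openin (product_topology (\<lambda>_. euclidean) {..<d})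
       {x \<in> topspace (product_topology (\<lambda>_. euclidean) {..<d}). tuple_divisor d x \<in> U}"

lemma istopology_sym_open: "istopology (sym_open d)"
  unfolding istopology_def
proof (intro conjI allI impI)
  let ?P = "product_topology (\<lambda>_. euclidean) {..<d} :: (nat \<Rightarrow> 'a) topology"
  fix U V :: "'a divisor set" assume UV: "sym_open d U" "sym_open d V"
  have "{x \<in> topspace ?P. tuple_divisor d x \<in> U \<inter> V} =
      {x \<in> topspace ?P. tuple_divisor d x \<in> U} \<inter> {x \<in> topspace ?P. tuple_divisor d x \<in> V}"
    by blast
  then show "sym_open d (U \<inter> V)"
    using UV unfolding sym_open_def by (metis (no_types, lifting) le_infI1 openin_Int)
next
  let ?P = "product_topology (\<lambda>_. euclidean) {..<d} :: (nat \<Rightarrow> 'a) topology"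
  fix \<U> :: "'a divisor set set" assume *: "\<forall>U\<in>\<U>. sym_open d U"
  have "{x \<in> topspace ?P. tuple_divisor d x \<in> \<Union>\<U>} =
      (\<Union>U\<in>\<U>. {x \<in> topspace ?P. tuple_divisor d x \<in> U})"
    by blast
  moreover have "openin ?P (\<Union>U\<in>\<U>. {x \<in> topspace ?P. tuple_divisor d x \<in> U})"
    using * unfolding sym_open_def by (intro openin_Union) blast
  ultimately show "sym_open d (\<Union>\<U>)"
    using * unfolding sym_open_def by (simp add: Sup_le_iff)
qed

definition sym_topology :: "nat \<Rightarrow> ('a::topological_space) divisor topology" where
  "sym_topology d = topology (sym_open d)"

definition local_max_at :: "'b topology \<Rightarrow> ('b \<Rightarrow> 'c::linorder) \<Rightarrow> 'b \<Rightarrow> bool" where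
  "local_max_at X f x \<longleftrightarrow> (\<exists>U. openin X U \<and> x \<in> U \<and> (\<forall>y\<in>U. f y \<le> f x))"

definition local_min_at :: "'b topology \<Rightarrow> ('b \<Rightarrow> 'c::linorder) \<Rightarrow> 'b \<Rightarrow> bool" where
  "local_min_at X f x \<longleftrightarrow> (\<exists>U. openin X U \<and> x \<in> U \<and> (\<forall>y\<in>U. f x \<le> f y))"

definition nondegenerate ::
  "('a::metric_space) divisor \<Rightarrow> ('a \<Rightarrow> real) set \<Rightarrow> 'a divisor \<Rightarrow> bool" where
  "nondegenerate D \<Sigma> D' \<longleftrightarrow>
     (let X = subtopology (sym_topology (nat (divisor_degree D))) (linear_system D \<Sigma>)
      in D' \<in> linear_system D \<Sigma> \<and>
         local_max_at X (\<lambda>D. card (supp D)) D' \<and> local_min_at X valence1_degree D')"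

section \<open>The star of a linear system and its evaluation map\<close>

text \<open>A linear map \<open>[0,\<epsilon>] \<rightarrow> Sym\<^sup>d\<close>: for the polyhedral structure of \<open>Sym\<^sup>d\<close>, whose coordinates are the
  positions on the edges of the points of a divisor, the linear maps are, up to shrinking
  \<open>\<epsilon>\<close>, the families of divisors whose \<open>d\<close> points move along geodesics at constant speeds
  \<open>v i \<ge> 0\<close>.\<close>

definition sym_linear :: "nat \<Rightarrow> real \<Rightarrow> (real \<Rightarrow> ('a::metric_space) divisor) \<Rightarrow> bool" where
  "sym_linear d \<epsilon> c \<longleftrightarrow>
     (\<exists>\<gamma> v. (\<forall>i<d. \<forall>s\<in>{0..\<epsilon>}. \<forall>t\<in>{0..\<epsilon>}. dist (\<gamma> i s) (\<gamma> i t) = v i * \<bar>s - t\<bar>) \<and>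
            (\<forall>t\<in>{0..\<epsilon>}. c t = tuple_divisor d (\<lambda>i. \<gamma> i t)))"

definition Star :: "nat \<Rightarrow> ('a::metric_space) divisor set \<Rightarrow> 'a divisor \<Rightarrow> (real \<Rightarrow> 'a divisor) set set" where
  "Star d \<Delta> D =
     {c. c 0 = D \<and> (\<exists>\<epsilon>>0. sym_linear d \<epsilon> c \<and> (\<forall>t\<in>{0..\<epsilon>}. c t \<in> \<Delta>))} // germ_rel"

text \<open>The class of \<open>u\<close> in \<open>\<real>\<^sup>E/(1,\<dots>,1)\<close>; vectors in \<open>\<real>\<^sup>E\<close> are extensional functions on \<open>E\<close>.\<close>

definition diag_class :: "'e set \<Rightarrow> ('e \<Rightarrow> real) \<Rightarrow> ('e \<Rightarrow> real) set" where
  "diag_class E u = {v \<in> extensional E. \<exists>c. \<forall>S\<in>E. v S = u S + c}"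

text \<open>The map \<open>Star(D) \<rightarrow> \<real>\<^sup>E/(1,\<dots>,1)\<close> obtained by linear extension from the evaluation map
  \<open>D + div(\<phi>) \<mapsto> (\<phi>(pt S))\<^sub>S\<close>: the germ of \<open>c\<close> goes to the class of \<open>u\<close> if \<open>c t\<close>
  evaluates to the class of \<open>t * u\<close> for small \<open>t\<close>. (The divisor \<open>D\<close> itself evaluates to 0.)\<close>

definition star_eval ::
  "('a::metric_space) divisor \<Rightarrow> ('a \<Rightarrow> real) set \<Rightarrow> 'a set set \<Rightarrow> ('a set \<Rightarrow> 'a) \<Rightarrow>
     (real \<Rightarrow> 'a divisor) set \<Rightarrow> ('a set \<Rightarrow> real) set" where
  "star_eval D \<Sigma> E pt \<xi> =
     (THE w. \<exists>c\<in>\<xi>. \<exists>u. w = diag_class E u \<and>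
        (\<exists>\<epsilon>>0. \<forall>t\<in>{0..\<epsilon>}. \<exists>\<phi>\<in>\<Sigma>. c t = add_div D \<phi> \<and>
           diag_class E (\<lambda>S. \<phi> (pt S)) = diag_class E (\<lambda>S. t * u S)))"

section \<open>Matroids\<close>

definition matroid :: "'e set \<Rightarrow> ('e set \<Rightarrow> bool) \<Rightarrow> bool" where
  "matroid E indep \<longleftrightarrow>
     finite E \<and>
     (\<forall>X. indep X \<longrightarrow> X \<subseteq> E) \<and>
     indep {} \<and>
     (\<forall>X Y. indep X \<and> Y \<subseteq> X \<longrightarrow> indep Y) \<and>
     (\<forall>X Y. indep X \<and> indep Y \<and> card X < card Y \<longrightarrow> (\<exists>y\<in>Y - X. indep (insert y X)))"

definition matroid_rank :: "('e set \<Rightarrow> bool) \<Rightarrow> 'e set \<Rightarrow> nat" where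
  "matroid_rank indep A = Max {card X | X. X \<subseteq> A \<and> indep X}"

definition matroid_flats :: "'e set \<Rightarrow> ('e set \<Rightarrow> bool) \<Rightarrow> 'e set set" where
  "matroid_flats E indep =
     {F. F \<subseteq> E \<and> (\<forall>x\<in>E - F. matroid_rank indep F < matroid_rank indep (insert x F))}"

definition matroid_circuits :: "'e set \<Rightarrow> ('e set \<Rightarrow> bool) \<Rightarrow> 'e set set" where
  "matroid_circuits E indep = {C. C \<subseteq> E \<and> \<not> indep C \<and> (\<forall>X. X \<subset> C \<longrightarrow> indep X)}"

definition bergman_support :: "'e set \<Rightarrow> ('e set \<Rightarrow> bool) \<Rightarrow> ('e \<Rightarrow> real) set set" where
  "bergman_support E indep =
     {diag_class E u | u. \<forall>C\<in>matroid_circuits E indep.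
        \<exists>i\<in>C. \<exists>j\<in>C. i \<noteq> j \<and> u i = u j \<and> (\<forall>k\<in>C. u i \<le> u k)}"

definition argmin_set :: "('a \<Rightarrow> real) \<Rightarrow> 'a set" where
  "argmin_set \<phi> = {p. \<forall>q. \<phi> p \<le> \<phi> q}"

definition flat_of :: "'a set set \<Rightarrow> ('a \<Rightarrow> real) \<Rightarrow> 'a set set" where
  "flat_of E \<phi> = {S \<in> E. \<not> S \<subseteq> argmin_set \<phi>}"

end

theory Submission
  imports Defs
begin

text \<open>A function of small range in \<open>\<Sigma>\<close> is constant on the components of the complement of \<open>supp D\<close>,
  except close to \<open>supp D\<close>. Nondegeneracy forces all chips of a point \<open>p\<close> of \<open>supp D\<close> to move together,
  along at most one leg, so the function is determined by its values on \<open>E\<close>. The vectors of values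
  that occur are exactly the small vectors all of whose strict superlevel sets are of the form
  \<open>flat_of E \<phi>\<close> or \<open>E\<close>; this is the flag description of a Bergman fan. The sets \<open>flat_of E \<phi>\<close> are closed under
  intersection. As \<open>r_BN D \<Sigma> = r\<close>, any \<open>r\<close> components lie in one of them, and as \<open>r_ind \<Sigma> = r + 1\<close>, a
  chain of them has at most \<open>r + 1\<close> elements. Together this says that the closure of \<open>F \<union> {x}\<close> covers
  every flat \<open>F\<close> not containing \<open>x\<close>, which is the exchange property of a matroid of rank \<open>r + 1\<close>.\<close>

section \<open>Matroids from lattices of flats\<close>

text \<open>Counting produces the covering property. Points chosen one after another outside the
  closure of their predecessors exhaust \<open>E\<close> after exactly \<open>r + 1\<close> steps,
  and a flat strictly between \<open>F\<close> and the closure of \<open>insert x F\<close> would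
  lengthen the resulting chain beyond its bound. The passage from flats to the local shape of
  \<open>\<Sigma>\<close> rests on truncation: the minimum of a function of \<open>\<Sigma>\<close>
  and a constant just above its minimal value is again in \<open>\<Sigma>\<close>, has the same flat
  and a divisor close to \<open>D\<close>. Finite generation makes one bound on the range work for
  all functions. The obstacle is the star, whose elements are motions of chips and carry no
  functions. That a divisor close to \<open>D\<close> comes from a function of small range needs an
  argument; connectedness of the graph supplies it. No polyhedral structure on the linear system is
  constructed: scaling a vector of values moves the chips at constant speed along fixed legs, and
  this is what linearity of a germ asks for.\<close>

locale flat_lattice =
  fixes E :: "'e set" and L :: "'e set set" and r :: nat
  assumes finite_E: "finite E"
    and L_sub: "F \<in> L \<Longrightarrow> F \<subseteq> E"
    and E_in: "E \<in> L"
    and Int_in: "F \<in> L \<Longrightarrow> G \<in> L \<Longrightarrow> F \<inter> G \<in> L"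
    and proper: "A \<subseteq> E \<Longrightarrow> card A \<le> r \<Longrightarrow> \<exists>F\<in>L. A \<subseteq> F \<and> F \<noteq> E"
    and chains: "C \<subseteq> L - {E} \<Longrightarrow> (\<And>F G. F \<in> C \<Longrightarrow> G \<in> C \<Longrightarrow> F \<subseteq> G \<or> G \<subseteq> F) \<Longrightarrow> card C \<le> Suc r"
begin

section \<open>Closure operator and chains of flats\<close>

definition cl :: "'e set \<Rightarrow> 'e set" where
  "cl A = \<Inter>{F \<in> L. A \<subseteq> F}"

definition ind :: "'e set \<Rightarrow> bool" where
  "ind A \<longleftrightarrow> A \<subseteq> E \<and> (\<forall>x\<in>A. x \<notin> cl (A - {x}))"

lemma finite_L: "finite L"
  using finite_E L_sub by (meson PowI finite_Pow_iff finite_subset subsetI)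

lemma Inter_in: "finite \<C> \<Longrightarrow> \<C> \<noteq> {} \<Longrightarrow> \<C> \<subseteq> L \<Longrightarrow> \<Inter>\<C> \<in> L"
  by (induction \<C> rule: finite_ne_induct) (auto intro: Int_in)

lemma cl_in: "A \<subseteq> E \<Longrightarrow> cl A \<in> L"
  unfolding cl_def using finite_L E_in by (intro Inter_in) auto

lemma cl_upper: "A \<subseteq> cl A"
  unfolding cl_def by auto

lemma cl_least: "F \<in> L \<Longrightarrow> A \<subseteq> F \<Longrightarrow> cl A \<subseteq> F"
  unfolding cl_def by auto

lemma cl_mono: "A \<subseteq> B \<Longrightarrow> cl A \<subseteq> cl B"
  unfolding cl_def by auto

lemma cl_sub: "A \<subseteq> E \<Longrightarrow> cl A \<subseteq> E"
  using cl_in L_sub by blast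

lemma cl_flat: "F \<in> L \<Longrightarrow> cl F = F"
  using cl_upper cl_least by blast

lemma cl_absorb: "A \<subseteq> E \<Longrightarrow> B \<subseteq> cl A \<Longrightarrow> cl (A \<union> B) = cl A"
  by (intro equalityI cl_least cl_in cl_mono) (use cl_upper in auto)

lemma ind_D: "ind A \<Longrightarrow> A \<subseteq> E" "ind A \<Longrightarrow> x \<in> A \<Longrightarrow> x \<notin> cl (A - {x})"
  unfolding ind_def by auto

lemma ind_finite: "ind A \<Longrightarrow> finite A"
  using ind_D(1) finite_E finite_subset by blast

lemma ind_subset: "ind A \<Longrightarrow> B \<subseteq> A \<Longrightarrow> ind B"
  unfolding ind_def using cl_mono[of "B - {x}" "A - {x}" for x] by blast

text \<open>The sets in \<open>\<C>\<close> are the closures of the proper initial segments of an enumeration of \<open>A\<close>.\<close>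

inductive greedy :: "nat \<Rightarrow> 'e set \<Rightarrow> 'e set set \<Rightarrow> bool" where
  greedy_0: "greedy 0 {} {}"
| greedy_Suc: "greedy k A \<C> \<Longrightarrow> x \<in> E - cl A \<Longrightarrow> greedy (Suc k) (insert x A) (insert (cl A) \<C>)"

text \<open>The new closure contains \<open>x\<close> and the old one does not, so the closures
  increase strictly: \<open>\<C>\<close> stays a chain and gains one member per step.\<close>

lemma greedy_props:
  assumes "greedy k A \<C>"
  shows "A \<subseteq> E" "finite A" "card A = k" "\<C> \<subseteq> L - {E}" "finite \<C>" "card \<C> = k"
    "\<And>F. F \<in> \<C> \<Longrightarrow> F \<subset> cl A" "\<And>F G. F \<in> \<C> \<Longrightarrow> G \<in> \<C> \<Longrightarrow> F \<subseteq> G \<or> G \<subseteq> F"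
proof -
  have "A \<subseteq> E \<and> finite A \<and> card A = k \<and> \<C> \<subseteq> L - {E} \<and> finite \<C> \<and> card \<C> = k \<and>
    (\<forall>F\<in>\<C>. F \<subset> cl A) \<and> (\<forall>F\<in>\<C>. \<forall>G\<in>\<C>. F \<subseteq> G \<or> G \<subseteq> F)"
    using assms
  proof induction
    case (greedy_Suc k A \<C> x)
    then have IH: "A \<subseteq> E" "finite A" "card A = k" "\<C> \<subseteq> L - {E}" "finite \<C>" "card \<C> = k"
      "\<forall>F\<in>\<C>. F \<subset> cl A" "\<forall>F\<in>\<C>. \<forall>G\<in>\<C>. F \<subseteq> G \<or> G \<subseteq> F"
      by auto
    have x: "x \<notin> A" "x \<in> E" "x \<notin> cl A"
      using greedy_Suc cl_upper by auto
    have "cl A \<subset> cl (insert x A)"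
      using x cl_mono[of A "insert x A"] cl_upper[of "insert x A"] by blast
    moreover have "cl A \<notin> \<C>"
      using IH by auto
    moreover have "cl A \<in> L" "cl A \<noteq> E"
      using cl_in IH x by auto
    moreover have "\<forall>F\<in>insert (cl A) \<C>. \<forall>G\<in>insert (cl A) \<C>. F \<subseteq> G \<or> G \<subseteq> F"
      using IH(7,8) by (metis insert_iff order_refl psubset_imp_subset)
    moreover have "\<forall>F\<in>insert (cl A) \<C>. F \<subset> cl (insert x A)"
      using IH(7) \<open>cl A \<subset> cl (insert x A)\<close> by (metis insert_iff psubset_trans)
    ultimately show ?case
      using IH(1-6) x by simp
  qed simp
  then show "A \<subseteq> E" "finite A" "card A = k" "\<C> \<subseteq> L - {E}" "finite \<C>" "card \<C> = k"
    "\<And>F. F \<in> \<C> \<Longrightarrow> F \<subset> cl A" "\<And>F G. F \<in> \<C> \<Longrightarrow> G \<in> \<C> \<Longrightarrow> F \<subseteq> G \<or> G \<subseteq> F"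
    by auto
qed

lemma greedy_le:
  assumes "greedy k A \<C>"
  shows "k \<le> Suc r"
  using chains[of \<C>] greedy_props(4,6,8)[OF assms] by auto

text \<open>Adding points of the flat \<open>F\<close> never leads out of \<open>F\<close>, the
  bound on \<open>k\<close> ends the process, and it can only end with closure \<open>F\<close>. The
  last clause says that the continuation keeps the old chain and puts all new members above
  \<open>cl A\<close>; it is what allows a further flat to be compared with the whole chain
  later.\<close>

lemma greedy_in:
  assumes "greedy k A \<C>" "A \<subseteq> F" "F \<in> L"
  shows "\<exists>k' A' \<C>'. greedy k' A' \<C>' \<and> cl A' = F \<and> (\<forall>H\<in>\<C>'. H \<in> \<C> \<or> cl A \<subseteq> H)"
  using assms
proof (induction "Suc r - k" arbitrary: k A \<C> rule: less_induct)
  case less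
  show ?case
  proof (cases "cl A = F")
    case False
    then obtain x where x: "x \<in> F" "x \<notin> cl A"
      using less.prems cl_least by blast
    then have g: "greedy (Suc k) (insert x A) (insert (cl A) \<C>)"
      using less.prems L_sub greedy_Suc by blast
    then have "Suc k \<le> Suc r" by (rule greedy_le)
    then have "Suc r - Suc k < Suc r - k" by simp
    moreover have "insert x A \<subseteq> F" using x less.prems by auto
    ultimately obtain k' A' \<C>'
      where *: "greedy k' A' \<C>'" "cl A' = F"
        "\<forall>H\<in>\<C>'. H \<in> insert (cl A) \<C> \<or> cl (insert x A) \<subseteq> H"
      using less.hyps[OF _ g _ less.prems(3)] by metis
    have "\<forall>H\<in>\<C>'. H \<in> \<C> \<or> cl A \<subseteq> H"
      using *(3) cl_mono[of A "insert x A"] by blast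
    with * show ?thesis by blast
  next
    case True
    then show ?thesis using less.prems(1) by metis
  qed
qed

text \<open>At most \<open>r\<close> points lie in a proper flat, so they cannot have closure
  \<open>E\<close>. Together with \<open>greedy_le\<close> this makes all enumerations that exhaust
  \<open>E\<close> equally long.\<close>

lemma greedy_top:
  assumes "greedy k A \<C>" "cl A = E"
  shows "k = Suc r"
proof (rule ccontr)
  assume "k \<noteq> Suc r"
  then have "card A \<le> r"
    using greedy_le[OF assms(1)] greedy_props(3)[OF assms(1)] by simp
  then obtain F where "F \<in> L" "A \<subseteq> F" "F \<noteq> E"
    using proper greedy_props(1)[OF assms(1)] by blast
  then show False
    using cl_least assms(2) L_sub by blast
qed

text \<open>An enumeration with closure \<open>F\<close> is continued by \<open>x\<close> and then
  up to \<open>E\<close>, which gives a chain of \<open>r + 1\<close> proper flats. Each of them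
  lies inside \<open>F\<close> or above \<open>cl (insert x F)\<close>, so a flat \<open>G\<close>
  strictly between the two would be comparable with all of them and extend the chain to
  \<open>r + 2\<close> members.\<close>

lemma closure_covers:
  assumes F: "F \<in> L" and x: "x \<in> E - F" and G: "G \<in> L" "F \<subset> G" "G \<subseteq> cl (insert x F)"
  shows "G = cl (insert x F)"
proof (rule ccontr)
  assume ne: "G \<noteq> cl (insert x F)"
  obtain k A \<C> where A: "greedy k A \<C>" "cl A = F"
    using greedy_in[OF greedy_0 _ F] by (metis empty_subsetI)
  have AF: "A \<subseteq> F" "F \<subseteq> E"
    using A cl_upper F L_sub by auto
  have eq: "cl (insert x A) = cl (insert x F)"
  proof
    show "cl (insert x A) \<subseteq> cl (insert x F)"
      using AF by (intro cl_mono) auto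
    show "cl (insert x F) \<subseteq> cl (insert x A)"
      using AF x A(2) cl_mono[of A "insert x A"] cl_upper[of "insert x A"]
      by (intro cl_least cl_in) auto
  qed
  have g: "greedy (Suc k) (insert x A) (insert F \<C>)"
    using greedy_Suc[OF A(1), of x] x A(2) by simp
  obtain k' A' \<C>' where A': "greedy k' A' \<C>'" "cl A' = E"
      "\<forall>H\<in>\<C>'. H \<in> insert F \<C> \<or> cl (insert x A) \<subseteq> H"
    using greedy_in[OF g greedy_props(1)[OF g] E_in] by metis
  have "k' = Suc r" using greedy_top A' by blast
  have GE: "G \<noteq> E" using ne G cl_sub[of "insert x F"] AF x by auto
  have step: "H \<subseteq> F \<or> cl (insert x F) \<subseteq> H" if "H \<in> \<C>'" for H
    using A'(3) that greedy_props(7)[OF A(1)] A(2) eq by blast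
  have "G \<notin> \<C>'"
    using step[of G] G ne by blast
  have "card (insert G \<C>') \<le> Suc r"
  proof (rule chains)
    show "insert G \<C>' \<subseteq> L - {E}" using G GE greedy_props(4)[OF A'(1)] by auto
    fix H K assume "H \<in> insert G \<C>'" "K \<in> insert G \<C>'"
    then show "H \<subseteq> K \<or> K \<subseteq> H"
      using greedy_props(8)[OF A'(1)] step G by blast
  qed
  moreover have "card (insert G \<C>') = Suc (Suc r)"
    using \<open>G \<notin> \<C>'\<close> greedy_props(5,6)[OF A'(1)] \<open>k' = Suc r\<close> by simp
  ultimately show False by simp
qed

text \<open>The flat \<open>cl (insert y A)\<close> lies above \<open>cl A\<close>, properly, and
  below \<open>cl (insert x A)\<close>. As the latter covers \<open>cl A\<close>, the two closures
  coincide.\<close>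

lemma exchange:
  assumes "A \<subseteq> E" "x \<in> E" "y \<in> E" "y \<in> cl (insert x A)" "y \<notin> cl A"
  shows "x \<in> cl (insert y A)"
proof -
  let ?F = "cl A"
  have F: "?F \<in> L" "A \<subseteq> ?F" "?F \<subseteq> E"
    using cl_in cl_upper cl_sub assms by auto
  have eq: "cl (insert z ?F) = cl (insert z A)" if "z \<in> E" for z
  proof
    show "cl (insert z ?F) \<subseteq> cl (insert z A)"
      using that assms(1) cl_mono[of A "insert z A"] cl_upper[of "insert z A"]
      by (intro cl_least cl_in) auto
    show "cl (insert z A) \<subseteq> cl (insert z ?F)"
      using F by (intro cl_mono) auto
  qed
  have x: "x \<in> E - ?F"
    using assms cl_flat[OF F(1)] eq[of x] by (metis DiffI insert_absorb)
  have "cl (insert y ?F) = cl (insert x ?F)"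
  proof (rule closure_covers[OF F(1) x])
    show "cl (insert y ?F) \<in> L" using F assms by (intro cl_in) auto
    show "?F \<subset> cl (insert y ?F)"
      using cl_upper[of "insert y ?F"] assms(5) by blast
    show "cl (insert y ?F) \<subseteq> cl (insert x ?F)"
      using F assms eq cl_upper[of "insert x ?F"] by (intro cl_least cl_in) auto
  qed
  then show ?thesis
    using eq assms cl_upper[of "insert x A"] by auto
qed

section \<open>Independent sets and rank\<close>

lemma ind_insert:
  assumes "ind A" "y \<in> E" "y \<notin> cl A"
  shows "ind (insert y A)"
  unfolding ind_def
proof (intro conjI ballI)
  show "insert y A \<subseteq> E" using assms ind_D by auto
  fix x assume x: "x \<in> insert y A"
  have yA: "y \<notin> A" using assms cl_upper by auto
  show "x \<notin> cl (insert y A - {x})"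
  proof (cases "x = y")
    case True
    then show ?thesis using assms yA by simp
  next
    case False
    then have xA: "x \<in> A" using x by auto
    show ?thesis
    proof
      assume "x \<in> cl (insert y A - {x})"
      then have "x \<in> cl (insert y (A - {x}))"
        using False by (simp add: insert_Diff_if)
      then have "y \<in> cl (insert x (A - {x}))"
        using ind_D[OF assms(1)] xA assms(2) exchange[of "A - {x}" y x] by blast
      then show False using assms xA by (simp add: insert_absorb)
    qed
  qed
qed

text \<open>Elements of \<open>Y\<close> outside \<open>X\<close> are traded one by one for elements
  of \<open>X\<close>: the size of \<open>Y\<close> stays the same and \<open>Y - X\<close> shrinks.
  A partner \<open>x\<close> for \<open>y\<close> exists, since otherwise
  \<open>cl (Y - {y})\<close> would contain \<open>X\<close>, hence \<open>cl X\<close>, hence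
  \<open>y\<close>.\<close>

lemma steinitz:
  assumes "ind X" "ind Y" "Y \<subseteq> cl X"
  shows "card Y \<le> card X"
  using assms
proof (induction "card (Y - X)" arbitrary: Y rule: less_induct)
  case less
  note fin = ind_finite[OF less.prems(1)] ind_finite[OF less.prems(2)]
  show ?case
  proof (cases "Y \<subseteq> X")
    case True
    then show ?thesis using fin by (simp add: card_mono)
  next
    case False
    then obtain y where y: "y \<in> Y" "y \<notin> X" by blast
    have sub: "X \<subseteq> E" "Y \<subseteq> E" using less.prems ind_D by auto
    have "\<not> X \<subseteq> cl (Y - {y})"
    proof
      assume X: "X \<subseteq> cl (Y - {y})"
      then have "cl X \<subseteq> cl (Y - {y})"
        using cl_least[OF cl_in X] sub by blast
      then show False
        using less.prems y ind_D(2) by blast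
    qed
    then obtain x where x: "x \<in> X" "x \<notin> cl (Y - {y})" by blast
    let ?Y = "insert x (Y - {y})"
    have xY: "x \<notin> Y" using x y cl_upper[of "Y - {y}"] by auto
    have i: "ind ?Y"
      using ind_insert[OF ind_subset[OF less.prems(2)]] x sub by blast
    have Y: "?Y \<subseteq> cl X" using x less.prems(3) cl_upper by auto
    have "?Y - X = (Y - X) - {y}" using x by auto
    then have "card (?Y - X) < card (Y - X)"
      using y fin by (metis DiffI card_Diff1_less finite_Diff)
    from less.hyps[OF this less.prems(1) i Y] show ?thesis
      using y fin xY by (simp add: card_insert_if card_Diff_singleton)
  qed
qed

lemma matroid_ind: "matroid E ind"
  unfolding matroid_def
proof (intro conjI allI impI)
  show "ind {}" by (simp add: ind_def)
  fix X Y assume XY: "ind X \<and> ind Y \<and> card X < card Y"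
  then have "\<not> Y \<subseteq> cl X"
    using steinitz by (metis not_less)
  then obtain y where "y \<in> Y" "y \<notin> cl X" by blast
  then show "\<exists>y\<in>Y - X. ind (insert y X)"
    using XY ind_insert[of X y] ind_D(1)[of Y] cl_upper[of X] by blast
qed (use finite_E ind_D ind_subset in auto)

lemma ex_basis:
  assumes "A \<subseteq> E"
  obtains B where "B \<subseteq> A" "ind B" "cl B = cl A"
proof -
  let ?I = "{B. B \<subseteq> A \<and> ind B}"
  have fin: "finite ?I"
    using assms finite_E by (metis (no_types, lifting) Collect_subset finite_Pow_iff finite_subset
        mem_Collect_eq Pow_iff subsetI)
  moreover have "{} \<in> ?I" by (simp add: ind_def)
  ultimately obtain B where B: "B \<in> ?I" "\<forall>B'\<in>?I. B \<subseteq> B' \<longrightarrow> B = B'"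
    using finite_has_maximal[of ?I] by blast
  have "A \<subseteq> cl B"
  proof
    fix y assume y: "y \<in> A"
    show "y \<in> cl B"
    proof (rule ccontr)
      assume "y \<notin> cl B"
      then have "insert y B \<in> ?I"
        using B y assms ind_insert by blast
      then show False
        using B \<open>y \<notin> cl B\<close> cl_upper by blast
    qed
  qed
  then have "cl A \<subseteq> cl B"
    using B assms by (intro cl_least cl_in) auto
  then show ?thesis
    using that[of B] B cl_mono[of B A] by blast
qed

lemma rank_eq:
  assumes "A \<subseteq> E" "B \<subseteq> A" "ind B" "cl B = cl A"
  shows "matroid_rank ind A = card B"
  unfolding matroid_rank_def
proof (rule Max_eqI)
  have "finite A" using assms finite_E finite_subset by blast
  then have "{card X |X. X \<subseteq> A \<and> ind X} \<subseteq> {..card A}"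
    by (auto intro: card_mono)
  then show "finite {card X |X. X \<subseteq> A \<and> ind X}"
    using finite_subset by blast
  show "card B \<in> {card X |X. X \<subseteq> A \<and> ind X}" using assms by blast
  fix k assume "k \<in> {card X |X. X \<subseteq> A \<and> ind X}"
  then show "k \<le> card B"
    using steinitz[OF assms(3)] assms(4) cl_upper[of A] by auto
qed

lemma rank_less_iff:
  assumes "A \<subseteq> E" "x \<in> E"
  shows "matroid_rank ind A < matroid_rank ind (insert x A) \<longleftrightarrow> x \<notin> cl A"
proof -
  obtain B where B: "B \<subseteq> A" "ind B" "cl B = cl A"
    using ex_basis assms by blast
  have r: "matroid_rank ind A = card B"
    using rank_eq assms B by blast
  show ?thesis
  proof (cases "x \<in> cl A")
    case True
    then have "cl (insert x A) = cl B"
      using cl_absorb[of A "{x}"] assms B by simp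
    then have "matroid_rank ind (insert x A) = card B"
      using B assms by (intro rank_eq) auto
    then show ?thesis using r True by simp
  next
    case False
    have "insert x A \<subseteq> cl (insert x B)"
      using B(3) cl_mono[of B "insert x B"] cl_upper[of A] cl_upper[of "insert x B"] by blast
    then have "cl (insert x A) \<subseteq> cl (insert x B)"
      using B(1) assms by (intro cl_least cl_in) auto
    moreover have "cl (insert x B) \<subseteq> cl (insert x A)"
      using B by (intro cl_mono) auto
    ultimately have "matroid_rank ind (insert x A) = card (insert x B)"
      using B assms False ind_insert[of B x] by (intro rank_eq) auto
    moreover have "x \<notin> B" "finite B"
      using B False cl_upper[of B] ind_finite by auto
    ultimately show ?thesis using r False by simp
  qed
qed

lemma flats_eq: "matroid_flats E ind = L"
proof (intro equalityI subsetI)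
  fix F assume "F \<in> matroid_flats E ind"
  then have F: "F \<subseteq> E" "\<And>x. x \<in> E - F \<Longrightarrow> x \<notin> cl F"
    using rank_less_iff[of F] by (auto simp: matroid_flats_def)
  then have "cl F = F"
    using cl_upper[of F] cl_sub[of F] by blast
  then show "F \<in> L" using cl_in[OF F(1)] by simp
next
  fix F assume "F \<in> L"
  then show "F \<in> matroid_flats E ind"
    using rank_less_iff[of F] L_sub[of F] cl_flat[of F] by (auto simp: matroid_flats_def)
qed

text \<open>A greedy enumeration that exhausts \<open>E\<close> is independent, by
  \<open>ind_insert\<close> at each step, and has \<open>r + 1\<close> elements by
  \<open>greedy_top\<close>.\<close>

lemma rank_E:
  assumes "{} \<in> L"
  shows "matroid_rank ind E = Suc r"
proof -
  have "\<exists>k A \<C>. greedy k A \<C> \<and> cl A = E"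
    using greedy_in[OF greedy_0 _ E_in] by (metis empty_subsetI)
  then obtain k A \<C> where A: "greedy k A \<C>" "cl A = E" by blast
  have "ind A" using A(1)
  proof induction
    case greedy_0 then show ?case by (simp add: ind_def)
  next
    case (greedy_Suc k A \<C> x)
    then show ?case using ind_insert by blast
  qed
  then have "matroid_rank ind E = card A"
    using greedy_props(1)[OF A(1)] A(2) cl_flat[OF E_in] by (intro rank_eq) auto
  then show ?thesis
    using greedy_props(3)[OF A(1)] greedy_top[OF A] by simp
qed

text \<open>For a minimal subset \<open>B\<close> of \<open>A\<close> with \<open>x\<close> in its
  closure, \<open>insert x B\<close> is a circuit: minimality makes \<open>B\<close> independent and
  keeps \<open>x\<close> out of the closures of the proper subsets of \<open>B\<close>.\<close>

lemma circuit_through: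
  assumes "A \<subseteq> E" "x \<in> cl A" "x \<notin> A"
  obtains C where "C \<in> matroid_circuits E ind" "x \<in> C" "C \<subseteq> insert x A"
proof -
  let ?I = "{B. B \<subseteq> A \<and> x \<in> cl B}"
  have fin: "finite ?I"
    using assms finite_E by (metis (no_types, lifting) finite_Pow_iff finite_subset
        mem_Collect_eq Pow_iff subsetI)
  have "A \<in> ?I" using assms by simp
  then have "?I \<noteq> {}" by blast
  from finite_has_minimal[OF fin this]
  obtain B where "B \<in> ?I" "\<forall>B'\<in>?I. B' \<subseteq> B \<longrightarrow> B = B'" ..
  then have B: "B \<subseteq> A" "x \<in> cl B" "\<And>B'. B' \<subseteq> A \<Longrightarrow> x \<in> cl B' \<Longrightarrow> B' \<subseteq> B \<Longrightarrow> B = B'"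
    by simp_all
  have xE: "x \<in> E" "x \<notin> B" "B \<subseteq> E" using assms cl_sub B by auto
  have indB: "ind B"
    unfolding ind_def
  proof (intro conjI ballI notI)
    fix y assume y: "y \<in> B" "y \<in> cl (B - {y})"
    have "cl B = cl (B - {y})"
      using cl_absorb[of "B - {y}" "{y}"] y xE by (simp add: insert_absorb) blast
    then show False using B(3)[of "B - {y}"] B(1,2) y by blast
  qed (use xE in auto)
  have "insert x B \<in> matroid_circuits E ind"
    unfolding matroid_circuits_def
  proof (intro CollectI conjI allI impI)
    show "\<not> ind (insert x B)"
      using ind_D(2)[of "insert x B" x] B(2) xE by auto
    fix X assume X: "X \<subset> insert x B"
    show "ind X"
    proof (cases "x \<in> X")
      case True
      then have *: "X - {x} \<subset> B" using X xE by blast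
      then have "x \<notin> cl (X - {x})" using B(3)[of "X - {x}"] B(1) by blast
      then have "ind (insert x (X - {x}))"
        using ind_insert[OF ind_subset[OF indB] xE(1), of "X - {x}"] * by blast
      then show ?thesis using True by (simp add: insert_absorb)
    next
      case False
      then show ?thesis using X ind_subset[OF indB] by blast
    qed
  qed (use xE in auto)
  then show ?thesis using that B by blast
qed

lemma circuit_cl:
  assumes "C \<in> matroid_circuits E ind" "x \<in> C"
  shows "x \<in> cl (C - {x})"
proof (rule ccontr)
  assume "x \<notin> cl (C - {x})"
  moreover have "ind (C - {x})" "x \<in> E"
    using assms by (auto simp: matroid_circuits_def)
  ultimately have "ind (insert x (C - {x}))" using ind_insert by blast
  then show False using assms by (simp add: matroid_circuits_def insert_absorb)
qed

lemma circuit_ne: "C \<in> matroid_circuits E ind \<Longrightarrow> C \<noteq> {} \<and> finite C"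
  using finite_E finite_subset by (auto simp: matroid_circuits_def ind_def)

text \<open>This is the passage from circuits to flags of flats. If \<open>x\<close> lies in the
  closure of a superlevel set but not in the set, a circuit through \<open>x\<close> has all its
  other elements strictly higher, so its minimum is attained only once. Conversely, if a circuit
  \<open>C\<close> attains its minimum only at \<open>i\<close>, then \<open>C - {i}\<close> lies in
  the flat of elements above \<open>u i\<close>, which would then contain \<open>i\<close>.\<close>

lemma bergman_iff:
  fixes u :: "'e \<Rightarrow> real"
  shows "(\<forall>C\<in>matroid_circuits E ind. \<exists>i\<in>C. \<exists>j\<in>C. i \<noteq> j \<and> u i = u j \<and> (\<forall>k\<in>C. u i \<le> u k)) \<longleftrightarrow>
    (\<forall>c. {S\<in>E. c < u S} \<in> L)" (is "?l \<longleftrightarrow> ?r")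
proof
  assume l: ?l
  show ?r
  proof (intro allI)
    fix c
    let ?F = "{S\<in>E. c < u S}"
    have "cl ?F \<subseteq> ?F"
    proof
      fix x assume x: "x \<in> cl ?F"
      show "x \<in> ?F"
      proof (rule ccontr)
        assume nx: "x \<notin> ?F"
        moreover have "?F \<subseteq> E" by auto
        ultimately obtain C where C: "C \<in> matroid_circuits E ind" "x \<in> C" "C \<subseteq> insert x ?F"
          using circuit_through x by metis
        have "x \<in> E" using C by (auto simp: matroid_circuits_def)
        then have "u x \<le> c" using nx by auto
        obtain i j where ij: "i \<in> C" "j \<in> C" "i \<noteq> j" "u i = u j" "\<forall>k\<in>C. u i \<le> u k"
          using l C(1) by blast
        have "u i \<le> c" "u j \<le> c" using ij(4,5) C(2) \<open>u x \<le> c\<close> by auto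
        then have "i = x" "j = x" using ij(1,2) C(3) by auto
        then show False using ij(3) by simp
      qed
    qed
    then have "cl ?F = ?F" using cl_upper[of ?F] by blast
    then show "?F \<in> L" using cl_in[of ?F] by auto
  qed
next
  assume r: ?r
  show ?l
  proof
    fix C assume C: "C \<in> matroid_circuits E ind"
    then have "finite (u ` C)" "u ` C \<noteq> {}" using circuit_ne by auto
    then obtain i where i: "i \<in> C" "\<And>k. k \<in> C \<Longrightarrow> u i \<le> u k"
      using Min_in[of "u ` C"] Min_le[of "u ` C"] by fastforce
    show "\<exists>i\<in>C. \<exists>j\<in>C. i \<noteq> j \<and> u i = u j \<and> (\<forall>k\<in>C. u i \<le> u k)"
    proof (rule ccontr)
      assume neg: "\<not> ?thesis"
      have "C - {i} \<subseteq> {S\<in>E. u i < u S}"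
      proof
        fix k assume k: "k \<in> C - {i}"
        then have "u i \<noteq> u k" using neg i by (metis DiffE singletonI)
        moreover have "k \<in> E" using k C by (auto simp: matroid_circuits_def)
        ultimately show "k \<in> {S\<in>E. u i < u S}" using i(2)[of k] k by auto
      qed
      then have "cl (C - {i}) \<subseteq> {S\<in>E. u i < u S}"
        using r cl_least by blast
      then show False using circuit_cl[OF C i(1)] by auto
    qed
  qed
qed

end

section \<open>Metric graphs\<close>

text \<open>Unlike in \<open>star_nbhd\<close>, the legs fill a whole closed ball, so that a star can be shrunk.\<close>

definition star :: "'a::metric_space \<Rightarrow> nat \<Rightarrow> real \<Rightarrow> (nat \<Rightarrow> real \<Rightarrow> 'a) \<Rightarrow> bool" where
  "star p n \<rho> \<psi> \<longleftrightarrow>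
     n \<ge> 1 \<and> \<rho> > 0 \<and> (\<forall>i<n. \<psi> i 0 = p) \<and>
     (\<forall>i<n. \<forall>j<n. \<forall>s\<in>{0..\<rho>}. \<forall>t\<in>{0..\<rho>}.
        dist (\<psi> i s) (\<psi> j t) = (if i = j then \<bar>s - t\<bar> else s + t)) \<and>
     (\<forall>x. dist p x \<le> \<rho> \<longrightarrow> (\<exists>i<n. x = \<psi> i (dist p x)))"

lemma starD:
  assumes "star p n \<rho> \<psi>"
  shows "n \<ge> 1" "\<rho> > 0" "i < n \<Longrightarrow> \<psi> i 0 = p"
    "i < n \<Longrightarrow> 0 \<le> s \<Longrightarrow> s \<le> \<rho> \<Longrightarrow> 0 \<le> t \<Longrightarrow> t \<le> \<rho> \<Longrightarrow> dist (\<psi> i s) (\<psi> i t) = \<bar>s - t\<bar>"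
    "i < n \<Longrightarrow> j < n \<Longrightarrow> i \<noteq> j \<Longrightarrow> 0 \<le> s \<Longrightarrow> s \<le> \<rho> \<Longrightarrow> 0 \<le> t \<Longrightarrow> t \<le> \<rho> \<Longrightarrow>
       dist (\<psi> i s) (\<psi> j t) = s + t"
  using assms unfolding star_def by auto

lemma star_cover:
  assumes "star p n \<rho> \<psi>" "dist p x \<le> \<rho>"
  obtains i where "i < n" "x = \<psi> i (dist p x)"
  using assms unfolding star_def by blast

lemma star_dist:
  assumes "star p n \<rho> \<psi>" "i < n" "0 \<le> s" "s \<le> \<rho>"
  shows "dist p (\<psi> i s) = s"
  using starD(4)[OF assms(1,2), of 0 s] starD(2,3)[OF assms(1)] assms by simp

lemma star_inj:
  assumes "star p n \<rho> \<psi>" "i < n" "j < n" "0 < s" "s \<le> \<rho>" "0 \<le> t" "t \<le> \<rho>" "\<psi> i s = \<psi> j t"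
  shows "i = j" "s = t"
  using starD(4)[OF assms(1), of j s t] starD(5)[OF assms(1), of i j s t] assms
  by (cases "i = j"; force)+

lemma star_mono: "star p n \<rho> \<psi> \<Longrightarrow> 0 < \<rho>' \<Longrightarrow> \<rho>' \<le> \<rho> \<Longrightarrow> star p n \<rho>' \<psi>"
  unfolding star_def by (auto; meson order_trans)

text \<open>The given legs may reach beyond the ball that they cover, and the ball beyond the legs;
  the radius \<open>min e \<epsilon>\<close> serves both.\<close>

lemma star_of_star_nbhd:
  assumes "star_nbhd p n \<epsilon> \<psi>"
  obtains \<rho> where "star p n \<rho> \<psi>"
proof -
  obtain e where e: "e > 0" "cball p e \<subseteq> (\<Union>i<n. \<psi> i ` {0..\<epsilon>})"
    using assms unfolding star_nbhd_def mem_interior_cball by auto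
  have s: "n \<ge> 1" "\<epsilon> > 0" "\<And>i. i < n \<Longrightarrow> \<psi> i 0 = p"
    "\<And>i j s t. i < n \<Longrightarrow> j < n \<Longrightarrow> s \<in> {0..\<epsilon>} \<Longrightarrow> t \<in> {0..\<epsilon>} \<Longrightarrow>
        dist (\<psi> i s) (\<psi> j t) = (if i = j then \<bar>s - t\<bar> else s + t)"
    using assms unfolding star_nbhd_def by blast+
  have "\<exists>i<n. x = \<psi> i (dist p x)" if "dist p x \<le> e" for x
  proof -
    have "x \<in> (\<Union>i<n. \<psi> i ` {0..\<epsilon>})" using that e(2) by (metis mem_cball subsetD)
    then obtain i t where it: "i < n" "t \<in> {0..\<epsilon>}" "x = \<psi> i t" by blast
    then have "dist p x = t"
      using s(4)[of i i 0 t] s(2,3) by auto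
    then show ?thesis using it by auto
  qed
  then have "star p n (min e \<epsilon>) \<psi>"
    unfolding star_def using s e(1) by auto
  then show ?thesis by (rule that)
qed

lemma star_nbhd_of_star:
  assumes "star p n \<rho> \<psi>"
  shows "star_nbhd p n \<rho> \<psi>"
proof -
  have "cball p \<rho> \<subseteq> (\<Union>i<n. \<psi> i ` {0..\<rho>})"
  proof
    fix x assume "x \<in> cball p \<rho>"
    then have "dist p x \<le> \<rho>" by simp
    then obtain i where "i < n" "x = \<psi> i (dist p x)" by (rule star_cover[OF assms])
    then show "x \<in> (\<Union>i<n. \<psi> i ` {0..\<rho>})"
      using \<open>dist p x \<le> \<rho>\<close> by (metis UN_I atLeastAtMost_iff imageI lessThan_iff zero_le_dist)
  qed
  then have "p \<in> interior (\<Union>i<n. \<psi> i ` {0..\<rho>})"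
    unfolding mem_interior_cball using starD(2)[OF assms] by blast
  then show ?thesis
    using assms unfolding star_nbhd_def star_def by blast
qed

text \<open>Inner points of a leg have valence 2. Here \<open>s + \<delta> \<le> \<rho>\<close>
  keeps the ball inside the big star, and \<open>\<delta> < s\<close> keeps it away from the centre,
  so no other leg enters it.\<close>

lemma star_leg_point:
  assumes "star p n \<rho> \<psi>" "i < n" "0 < \<delta>" "\<delta> < s" "s + \<delta> \<le> \<rho>"
  shows "star (\<psi> i s) 2 \<delta> (\<lambda>j t. if j = 0 then \<psi> i (s + t) else \<psi> i (s - t))"
  unfolding star_def
proof (intro conjI allI impI ballI)
  fix j k a b assume "j < (2::nat)" "k < (2::nat)" "a \<in> {0..\<delta>}" "b \<in> {0..\<delta>}"
  then show "dist (if j = 0 then \<psi> i (s + a) else \<psi> i (s - a)) (if k = 0 then \<psi> i (s + b) else \<psi> i (s - b)) =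
      (if j = k then \<bar>a - b\<bar> else a + b)"
    using assms by (auto simp: starD(4)[OF assms(1,2)])
next
  fix x assume x: "dist (\<psi> i s) x \<le> \<delta>"
  have "dist p x \<le> dist p (\<psi> i s) + dist (\<psi> i s) x" by (rule dist_triangle)
  then have px: "dist p x \<le> \<rho>"
    using x assms star_dist[OF assms(1,2), of s] by simp
  then obtain k where k: "k < n" "x = \<psi> k (dist p x)"
    by (rule star_cover[OF assms(1)])
  have "k = i"
  proof (rule ccontr)
    assume "k \<noteq> i"
    then have "dist (\<psi> i s) x = s + dist p x"
      using starD(5)[OF assms(1), of i k s "dist p x"] k px assms by auto
    then show False using x assms zero_le_dist[of p x] by linarith
  qed
  then have d: "x = \<psi> i (dist p x)" "dist (\<psi> i s) x = \<bar>s - dist p x\<bar>"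
    using k starD(4)[OF assms(1,2), of s "dist p x"] px assms by auto
  show "\<exists>j<2::nat. x = (if j = 0 then \<psi> i (s + dist (\<psi> i s) x) else \<psi> i (s - dist (\<psi> i s) x))"
  proof (cases "dist p x \<ge> s")
    case True
    then show ?thesis using d by (intro exI[of _ 0]) auto
  next
    case False
    then show ?thesis using d by (intro exI[of _ 1]) auto
  qed
qed (use assms in auto)

lemma isometric_embedding_leg: "star p n \<rho> \<psi> \<Longrightarrow> i < n \<Longrightarrow> isometric_embedding \<rho> (\<psi> i)"
  unfolding isometric_embedding_def using starD(4) by auto

lemma germ_rel_equiv: "equiv UNIV (germ_rel :: ((real \<Rightarrow> 'b) \<times> (real \<Rightarrow> 'b)) set)"
proof (rule equivI)
  show "refl germ_rel" by (auto simp: refl_on_def germ_rel_def intro: exI[of _ 1])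
  show "sym germ_rel" by (auto simp: sym_def germ_rel_def)
  show "trans (germ_rel :: ((real \<Rightarrow> 'b) \<times> (real \<Rightarrow> 'b)) set)"
  proof (rule transI)
    fix f g h :: "real \<Rightarrow> 'b" assume "(f, g) \<in> germ_rel" "(g, h) \<in> germ_rel"
    then obtain a b where "a > 0" "\<forall>t\<in>{0..a}. f t = g t" "b > 0" "\<forall>t\<in>{0..b}. g t = h t"
      by (auto simp: germ_rel_def)
    then have "min a b > 0 \<and> (\<forall>t\<in>{0..min a b}. f t = h t)" by auto
    then show "(f, h) \<in> germ_rel" unfolding germ_rel_def by blast
  qed
qed simp

text \<open>The leg is read off at the final time. A point of another leg at an earlier positive
  time would have the sum of the two radii as its distance from the end point, and not their
  difference. The speed \<open>v\<close> is general because the lemma also serves for moving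
  chips.\<close>

lemma geodesic_in_star:
  assumes st: "star p n \<rho> \<psi>" and v: "v > 0" and \<tau>: "\<tau> > 0" "v * \<tau> \<le> \<rho>" and p: "\<alpha> 0 = p"
    and d: "\<And>s t. s \<in> {0..\<tau>} \<Longrightarrow> t \<in> {0..\<tau>} \<Longrightarrow> dist (\<alpha> s) (\<alpha> t) = v * \<bar>s - t\<bar>"
  obtains i where "i < n" "\<And>t. t \<in> {0..\<tau>} \<Longrightarrow> \<alpha> t = \<psi> i (v * t)"
proof -
  have d0: "dist p (\<alpha> t) = v * t" if "t \<in> {0..\<tau>}" for t
    using d[of 0 t] that p \<tau> by simp
  have le: "v * t \<le> \<rho>" if "t \<in> {0..\<tau>}" for t
    using that v \<tau>(2) by (meson atLeastAtMost_iff mult_left_mono order_trans less_imp_le)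
  obtain i where i: "i < n" "\<alpha> \<tau> = \<psi> i (v * \<tau>)"
    using star_cover[OF st, of "\<alpha> \<tau>"] d0[of \<tau>] \<tau> by auto
  have "\<alpha> t = \<psi> i (v * t)" if t: "t \<in> {0..\<tau>}" for t
  proof -
    obtain j where j: "j < n" "\<alpha> t = \<psi> j (v * t)"
      using star_cover[OF st, of "\<alpha> t"] d0[OF t] le[OF t] by auto
    show ?thesis
    proof (cases "j = i \<or> t = 0")
      case True
      then show ?thesis using j i starD(3)[OF st] by auto
    next
      case False
      have "v * t + v * \<tau> = v * \<bar>t - \<tau>\<bar>"
        using starD(5)[OF st j(1) i(1), of "v * t" "v * \<tau>"] False t le v \<tau> d[of t \<tau>] i j by auto
      then have "t + \<tau> = \<bar>t - \<tau>\<bar>" using v by (simp flip: distrib_left)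
      then show ?thesis using False t \<tau> by auto
    qed
  qed
  with i(1) show ?thesis by (rule that)
qed

text \<open>Indexing tangent directions by legs turns \<open>principal_divisor\<close> into a sum
  over \<open>{..<n}\<close>, and it shows that \<open>valence\<close> does not depend on the chosen
  star.\<close>

lemma tangent_directions_star:
  assumes st: "star p n \<rho> \<psi>"
  shows "bij_betw (\<lambda>i. germ_rel `` {\<psi> i}) {..<n} (tangent_directions p)"
  unfolding bij_betw_def
proof (intro conjI inj_onI equalityI subsetI)
  fix i j assume ij: "i \<in> {..<n}" "j \<in> {..<n}" "germ_rel `` {\<psi> i} = germ_rel `` {\<psi> j}"
  then have "(\<psi> i, \<psi> j) \<in> germ_rel"
    using eq_equiv_class[OF _ germ_rel_equiv] by blast
  then obtain \<epsilon> where e: "\<epsilon> > 0" "\<forall>t\<in>{0..\<epsilon>}. \<psi> i t = \<psi> j t" by (auto simp: germ_rel_def)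
  let ?t = "min \<epsilon> \<rho>"
  have "?t > 0" using e starD(2)[OF st] by auto
  then show "i = j"
    using star_inj(1)[OF st, of i j ?t ?t] ij e by auto
next
  fix \<zeta> assume "\<zeta> \<in> (\<lambda>i. germ_rel `` {\<psi> i}) ` {..<n}"
  then show "\<zeta> \<in> tangent_directions p"
    unfolding tangent_directions_def
    using isometric_embedding_leg[OF st] starD(2,3)[OF st] by (auto intro!: quotientI)
next
  fix \<zeta> assume "\<zeta> \<in> tangent_directions p"
  then obtain \<alpha> \<epsilon> where a: "\<alpha> 0 = p" "\<epsilon> > 0" "isometric_embedding \<epsilon> \<alpha>" "\<zeta> = germ_rel `` {\<alpha>}"
    by (auto simp: tangent_directions_def elim!: quotientE)
  let ?t = "min \<epsilon> \<rho>"
  have t: "?t > 0" using a starD(2)[OF st] by auto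
  obtain i where i: "i < n" "\<And>t. t \<in> {0..?t} \<Longrightarrow> \<alpha> t = \<psi> i (1 * t)"
    using geodesic_in_star[of p n \<rho> \<psi> 1 ?t \<alpha>] st t a(1,3)
    unfolding isometric_embedding_def by auto
  then have "\<exists>\<epsilon>>0. \<forall>t\<in>{0..\<epsilon>}. \<alpha> t = \<psi> i t" using t by (metis mult_1)
  then have "(\<alpha>, \<psi> i) \<in> germ_rel" by (simp add: germ_rel_def)
  then have "\<zeta> = germ_rel `` {\<psi> i}"
    using a(4) equiv_class_eq[OF germ_rel_equiv] by auto
  then show "\<zeta> \<in> (\<lambda>i. germ_rel `` {\<psi> i}) ` {..<n}" using i(1) by auto
qed

lemma valence_star:
  assumes "star p n \<rho> \<psi>"
  shows "valence p = n"
  unfolding valence_def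
proof (rule the_equality)
  show "\<exists>\<epsilon> \<psi>. star_nbhd p n \<epsilon> \<psi>" using star_nbhd_of_star[OF assms] by blast
  fix m assume "\<exists>\<epsilon> \<psi>. star_nbhd p m \<epsilon> \<psi>"
  then obtain \<epsilon>' \<psi>' where "star p m \<epsilon>' \<psi>'" using star_of_star_nbhd by metis
  then show "m = n"
    using tangent_directions_star[OF assms] tangent_directions_star[of p m]
    by (metis bij_betw_same_card card_lessThan)
qed

lemma outgoing_slope_eq:
  assumes "\<sigma> > 0" "\<And>t. t \<in> {0..\<sigma>} \<Longrightarrow> \<phi> (\<alpha> t) = \<phi> (\<alpha> 0) + of_int m * t"
  shows "outgoing_slope \<phi> (germ_rel `` {\<alpha>}) = m"
  unfolding outgoing_slope_def
proof (rule the_equality)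
  show "\<exists>\<beta>\<in>germ_rel `` {\<alpha>}. \<exists>\<epsilon>>0. \<forall>t\<in>{0..\<epsilon>}. \<phi> (\<beta> t) = \<phi> (\<beta> 0) + of_int m * t"
    using assms equiv_class_self[OF germ_rel_equiv] by blast
  fix k assume "\<exists>\<beta>\<in>germ_rel `` {\<alpha>}. \<exists>\<epsilon>>0. \<forall>t\<in>{0..\<epsilon>}. \<phi> (\<beta> t) = \<phi> (\<beta> 0) + of_int k * t"
  then obtain \<beta> \<epsilon> \<eta> where b: "\<epsilon> > 0" "\<forall>t\<in>{0..\<epsilon>}. \<phi> (\<beta> t) = \<phi> (\<beta> 0) + of_int k * t"
    "\<eta> > 0" "\<forall>t\<in>{0..\<eta>}. \<alpha> t = \<beta> t"
    by (auto simp: germ_rel_def)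
  let ?t = "min \<sigma> (min \<epsilon> \<eta>)"
  have "?t > 0" using assms(1) b by simp
  moreover have "of_int k * ?t = of_int m * ?t"
    using assms(2)[of ?t] b(2)[rule_format, of ?t] b(4)[rule_format, of ?t]
      b(4)[rule_format, of 0] b(1,3) assms(1) by simp
  ultimately show "k = m" by (metis less_irrefl mult_cancel_right of_int_eq_iff)
qed

section \<open>Principal divisors in star coordinates\<close>

lemma principal_divisor_star:
  assumes st: "star p n \<rho> \<psi>"
    and "\<And>i. i < n \<Longrightarrow> \<exists>\<sigma>>0. \<forall>t\<in>{0..\<sigma>}. \<phi> (\<psi> i t) = \<phi> p + of_int (m i) * t"
  shows "principal_divisor \<phi> p = - (\<Sum>i<n. m i)"
proof -
  have "(\<Sum>\<zeta>\<in>tangent_directions p. outgoing_slope \<phi> \<zeta>) = (\<Sum>i<n. outgoing_slope \<phi> (germ_rel `` {\<psi> i}))"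
    using sum.reindex_bij_betw[OF tangent_directions_star[OF st]] by metis
  also have "\<dots> = (\<Sum>i<n. m i)"
  proof (rule sum.cong[OF refl])
    fix i assume i: "i \<in> {..<n}"
    then obtain \<sigma> where "\<sigma> > 0" "\<forall>t\<in>{0..\<sigma>}. \<phi> (\<psi> i t) = \<phi> p + of_int (m i) * t"
      using assms(2) by blast
    then show "outgoing_slope \<phi> (germ_rel `` {\<psi> i}) = m i"
      using starD(3)[OF st] i by (intro outgoing_slope_eq[of \<sigma>]) auto
  qed
  finally show ?thesis by (simp add: principal_divisor_def)
qed

lemma PL_germ:
  assumes "\<phi> \<in> PL" "isometric_embedding \<rho> \<alpha>" "\<rho> > 0"
  obtains m :: int and \<sigma> where "0 < \<sigma>" "\<And>t. t \<in> {0..\<sigma>} \<Longrightarrow> \<phi> (\<alpha> t) = \<phi> (\<alpha> 0) + of_int m * t"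
proof -
  have "piecewise_linear_int \<rho> (\<phi> \<circ> \<alpha>)"
    using assms by (simp add: PL_def)
  then obtain B where B: "finite B" "\<forall>x y. 0 \<le> x \<and> x \<le> y \<and> y \<le> \<rho> \<and> {x<..<y} \<inter> B = {} \<longrightarrow>
      (\<exists>m::int. \<forall>t\<in>{x..y}. (\<phi> \<circ> \<alpha>) t = (\<phi> \<circ> \<alpha>) x + of_int m * (t - x))"
    unfolding piecewise_linear_int_def by blast
  \<comment> \<open>The first positive breakpoint, capped by \<open>\<rho>\<close>: no breakpoint
    lies strictly between 0 and \<open>\<sigma>\<close>.\<close>
  define \<sigma> where "\<sigma> = Min (insert \<rho> {b\<in>B. b > 0})"
  have s: "\<sigma> > 0" "\<sigma> \<le> \<rho>" unfolding \<sigma>_def using B(1) assms(3) by auto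
  have "{0<..<\<sigma>} \<inter> B = {}"
    unfolding \<sigma>_def using B(1) by auto
  with B(2)[rule_format, of 0 \<sigma>] s obtain m :: int where "\<forall>t\<in>{0..\<sigma>}. \<phi> (\<alpha> t) = \<phi> (\<alpha> 0) + of_int m * t"
    by auto
  then show ?thesis using that[OF s(1)] by blast
qed

lemma PL_star:
  assumes "\<phi> \<in> PL" "star p n \<rho> \<psi>"
  obtains \<sigma> and m :: "nat \<Rightarrow> int" where "0 < \<sigma>" "\<sigma> \<le> \<rho>"
    "\<And>i t. i < n \<Longrightarrow> t \<in> {0..\<sigma>} \<Longrightarrow> \<phi> (\<psi> i t) = \<phi> p + of_int (m i) * t"
proof -
  have "\<exists>m \<sigma>. 0 < \<sigma> \<and> (\<forall>t\<in>{0..\<sigma>}. \<phi> (\<psi> i t) = \<phi> p + of_int m * t)" if "i < n" for i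
    using PL_germ[OF assms(1) isometric_embedding_leg[OF assms(2) that] starD(2)[OF assms(2)]]
      starD(3)[OF assms(2) that] by metis
  then obtain m :: "nat \<Rightarrow> int" and s where ms: "\<And>i. i < n \<Longrightarrow> 0 < s i"
    "\<And>i t. i < n \<Longrightarrow> t \<in> {0..s i} \<Longrightarrow> \<phi> (\<psi> i t) = \<phi> p + of_int (m i) * t"
    by metis
  define \<sigma> where "\<sigma> = Min (insert \<rho> (s ` {..<n}))"
  have "0 < \<sigma>" "\<sigma> \<le> \<rho>" "\<And>i. i < n \<Longrightarrow> \<sigma> \<le> s i"
    unfolding \<sigma>_def using ms(1) starD(2)[OF assms(2)] by auto
  moreover then have "\<phi> (\<psi> i t) = \<phi> p + of_int (m i) * t" if "i < n" "t \<in> {0..\<sigma>}" for i t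
    using ms(2)[OF that(1), of t] that by force
  ultimately show ?thesis using that by blast
qed

lemma principal_divisor_cong:
  assumes st: "star p n \<rho> \<psi>" and "\<phi>' \<in> PL" "\<eta> > 0" and eq: "\<And>q. dist p q < \<eta> \<Longrightarrow> \<phi> q = \<phi>' q + k"
  shows "principal_divisor \<phi> p = principal_divisor \<phi>' p"
proof -
  obtain \<sigma> and m :: "nat \<Rightarrow> int" where m: "0 < \<sigma>" "\<sigma> \<le> \<rho>"
    "\<And>i t. i < n \<Longrightarrow> t \<in> {0..\<sigma>} \<Longrightarrow> \<phi>' (\<psi> i t) = \<phi>' p + of_int (m i) * t"
    using PL_star[OF assms(2) st] by blast
  have "principal_divisor \<phi>' p = - (\<Sum>i<n. m i)"
    using m by (intro principal_divisor_star[OF st]) blast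
  moreover have "principal_divisor \<phi> p = - (\<Sum>i<n. m i)"
  proof (rule principal_divisor_star[OF st], intro exI conjI ballI)
    show "min \<sigma> (\<eta> / 2) > 0" using m assms(3) by simp
    fix i t assume i: "i < n" and "t \<in> {0..min \<sigma> (\<eta> / 2)}"
    then have t: "t \<in> {0..\<sigma>}" "t < \<eta>" "0 \<le> t" "t \<le> \<rho>" using m(2) assms(3) by auto
    then have "dist p (\<psi> i t) < \<eta>" using star_dist[OF st i, of t] by simp
    then show "\<phi> (\<psi> i t) = \<phi> p + of_int (m i) * t"
      using m(3)[OF i t(1)] assms(3) eq[of "\<psi> i t"] eq[of p] by simp
  qed
  ultimately show ?thesis by simp
qed

lemma principal_divisor_locally_const:
  assumes st: "star p n \<rho> \<psi>" and "\<eta> > 0" and "\<And>q. dist p q < \<eta> \<Longrightarrow> \<phi> q = \<phi> p"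
  shows "principal_divisor \<phi> p = 0"
proof -
  have "principal_divisor \<phi> p = - (\<Sum>i<n. 0)"
  proof (rule principal_divisor_star[OF st], intro exI conjI ballI)
    show "min \<rho> (\<eta> / 2) > 0" using starD(2)[OF st] assms(2) by simp
    fix i t assume i: "i < n" and "t \<in> {0..min \<rho> (\<eta> / 2)}"
    then have "dist p (\<psi> i t) < \<eta>" using star_dist[OF st i, of t] assms(2) by auto
    then show "\<phi> (\<psi> i t) = \<phi> p + of_int 0 * t" using assms(3) by simp
  qed
  then show ?thesis by simp
qed

lemma slope_nonneg_at_min:
  assumes "0 < \<sigma>" "\<And>t. t \<in> {0..\<sigma>} \<Longrightarrow> h (\<alpha> t) = h p + of_int m * t" "\<And>q. h p \<le> (h q :: real)"
  shows "0 \<le> m"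
proof -
  have "h p \<le> h p + of_int m * \<sigma>"
    using assms(1) assms(2)[of \<sigma>] assms(3)[of "\<alpha> \<sigma>"] by simp
  then show ?thesis using assms(1) by (simp add: zero_le_mult_iff)
qed

lemma connected_clopen_UNIV:
  assumes "connected (UNIV :: 'a::topological_space set)" "open (A :: 'a set)" "open (- A)" "A \<noteq> {}"
  shows "A = UNIV"
  using connectedD[OF assms(1-3)] assms(4) by auto

text \<open>A minimum principle for the difference \<open>h\<close>: where \<open>h\<close> is
  minimal, its outgoing slopes are nonnegative, and they sum to 0 because the divisors agree. So
  \<open>h\<close> is constant nearby, and the set of its minima is open and closed.\<close>

lemma principal_divisor_inj:
  fixes \<phi> \<phi>' :: "'a::metric_space \<Rightarrow> real"
  assumes cpt: "compact (UNIV :: 'a set)" and con: "connected (UNIV :: 'a set)"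
    and st: "\<And>p :: 'a. \<exists>n \<rho> \<psi>. star p n \<rho> \<psi>"
    and PL: "\<phi> \<in> PL" "\<phi>' \<in> PL" and eq: "principal_divisor \<phi> = principal_divisor \<phi>'"
  obtains c where "\<And>p. \<phi> p = \<phi>' p + c"
proof -
  define h where "h p = \<phi> p - \<phi>' p" for p
  have cont: "continuous_on UNIV h"
    unfolding h_def using PL by (auto simp: PL_def intro!: continuous_intros)
  obtain z where z: "\<And>q. h z \<le> h q"
    using continuous_attains_inf[OF cpt _ cont] by auto
  let ?A = "{q. h q = h z}"
  have "closed ?A"
    using cont by (intro closed_Collect_eq) (auto intro: continuous_intros)
  moreover have "open ?A"
    unfolding open_contains_ball
  proof
    fix p assume "p \<in> ?A"
    then have p: "h p = h z" "\<And>q. h p \<le> h q" using z by auto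
    obtain n \<rho> \<psi> where s: "star p n \<rho> \<psi>" using st by blast
    obtain \<sigma>1 m1 where m1: "0 < \<sigma>1" "\<sigma>1 \<le> \<rho>"
      "\<And>i t. i < n \<Longrightarrow> t \<in> {0..\<sigma>1} \<Longrightarrow> \<phi> (\<psi> i t) = \<phi> p + of_int (m1 i) * t"
      using PL_star[OF PL(1) s] by blast
    obtain \<sigma>2 m2 where m2: "0 < \<sigma>2" "\<sigma>2 \<le> \<rho>"
      "\<And>i t. i < n \<Longrightarrow> t \<in> {0..\<sigma>2} \<Longrightarrow> \<phi>' (\<psi> i t) = \<phi>' p + of_int (m2 i) * t"
      using PL_star[OF PL(2) s] by blast
    define \<sigma> where "\<sigma> = min \<sigma>1 \<sigma>2"
    have s0: "0 < \<sigma>" "\<sigma> \<le> \<rho>" using m1 m2 by (auto simp: \<sigma>_def)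
    have h: "h (\<psi> i t) = h p + of_int (m1 i - m2 i) * t" if "i < n" "t \<in> {0..\<sigma>}" for i t
      using m1(3)[of i t] m2(3)[of i t] that by (simp add: h_def \<sigma>_def algebra_simps)
    have nn: "m1 i - m2 i \<ge> 0" if "i < n" for i
      by (rule slope_nonneg_at_min[OF s0(1) h[OF that] p(2)])
    have "(\<Sum>i<n. m1 i) = (\<Sum>i<n. m2 i)"
      using principal_divisor_star[OF s, of \<phi> m1] principal_divisor_star[OF s, of \<phi>' m2] m1 m2 eq
      by (metis neg_equal_iff_equal)
    then have "(\<Sum>i<n. m1 i - m2 i) = 0" by (simp add: sum_subtractf)
    then have "\<forall>i\<in>{..<n}. m1 i - m2 i = 0"
      using nn by (subst (asm) sum_nonneg_eq_0_iff) auto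
    then have 0: "h (\<psi> i t) = h p" if "i < n" "t \<in> {0..\<sigma>}" for i t
      using h[OF that] that by simp
    have "ball p \<sigma> \<subseteq> ?A"
    proof
      fix q assume "q \<in> ball p \<sigma>"
      then have d: "dist p q < \<sigma>" by simp
      then obtain i where "i < n" "q = \<psi> i (dist p q)"
        using star_cover[OF s, of q] s0 by auto
      then have "h q = h p" using 0[of i "dist p q"] d by auto
      then show "q \<in> ?A" using p by simp
    qed
    then show "\<exists>e>0. ball p e \<subseteq> ?A" using s0 by blast
  qed
  ultimately have "?A = UNIV"
    using con by (intro connected_clopen_UNIV) (auto simp: closed_def)
  then have "h p = h z" for p by blast
  then show ?thesis using that[of "h z"] by (metis h_def add.commute diff_add_cancel)
qed

lemma const_PL: "(\<lambda>_. c) \<in> PL"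
  by (auto simp: PL_def piecewise_linear_int_def intro!: exI[of _ "{}"] exI[of _ "0::int"])

section \<open>Divisors and symmetric powers\<close>

lemma tuple_divisor_sum: "tuple_divisor d x p = (\<Sum>k<d. of_bool (x k = p))"
  by (auto simp: tuple_divisor_def sum.If_cases of_bool_def Int_def intro!: arg_cong[where f = card])

lemma supp_tuple_divisor: "supp (tuple_divisor d x) = x ` {..<d}"
proof -
  have "supp (tuple_divisor d x) = {p. {i. i < d \<and> x i = p} \<noteq> {}}"
    by (auto simp: supp_def tuple_divisor_def)
  then show ?thesis by auto
qed

lemma is_divisor_tuple_divisor: "is_divisor (tuple_divisor d x)"
  by (simp add: is_divisor_def supp_tuple_divisor)

lemma effective_tuple_divisor: "effective (tuple_divisor d x)"
  by (simp add: effective_def tuple_divisor_def)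

lemma divisor_degree_superset:
  assumes "finite A" "supp D \<subseteq> A"
  shows "divisor_degree D = (\<Sum>p\<in>A. D p)"
  unfolding divisor_degree_def using assms by (intro sum.mono_neutral_left) (auto simp: supp_def)

lemma divisor_degree_tuple_divisor: "divisor_degree (tuple_divisor d x) = int d"
proof -
  have "divisor_degree (tuple_divisor d x) = (\<Sum>p\<in>x ` {..<d}. \<Sum>k<d. of_bool (x k = p))"
    by (simp add: divisor_degree_def supp_tuple_divisor tuple_divisor_sum)
  also have "\<dots> = (\<Sum>k<d. \<Sum>p\<in>x ` {..<d}. of_bool (x k = p))" by (rule sum.swap)
  also have "\<dots> = (\<Sum>k<d. 1)"
    by (intro sum.cong refl) (simp add: of_bool_def)
  finally show ?thesis by simp
qed

lemma tuple_divisor_cong: "(\<And>k. k < d \<Longrightarrow> x k = y k) \<Longrightarrow> tuple_divisor d x = tuple_divisor d y"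
  by (auto simp: tuple_divisor_sum fun_eq_iff)

lemma effective_imp_tuple_divisor:
  assumes "is_divisor D" "effective D" "divisor_degree D = int d"
  shows "\<exists>x. D = tuple_divisor d x"
  using assms
proof (induction d arbitrary: D)
  case 0
  then have "\<forall>p\<in>supp D. D p = 0"
    using sum_nonneg_eq_0_iff[of "supp D" D]
    by (auto simp: divisor_degree_def is_divisor_def effective_def)
  then have "D = (\<lambda>p. 0)" by (auto simp: supp_def)
  then show ?case by (auto simp: tuple_divisor_def)
next
  case (Suc d)
  then have "divisor_degree D \<noteq> 0" by simp
  then obtain p where p: "p \<in> supp D"
    unfolding divisor_degree_def by (metis sum.not_neutral_contains_not_neutral)
  let ?D = "D(p := D p - 1)"
  have fin: "finite (supp D)" using Suc by (simp add: is_divisor_def)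
  have sub: "supp ?D \<subseteq> supp D" using p by (auto simp: supp_def)
  have "D p > 0" using p Suc.prems(2) by (metis (mono_tags, lifting) effective_def mem_Collect_eq order_le_neq_trans supp_def)
  then have "is_divisor ?D" "effective ?D"
    using fin sub Suc.prems(2) finite_subset by (auto simp: is_divisor_def effective_def)
  moreover have "divisor_degree ?D = int d"
  proof -
    have "divisor_degree ?D = (\<Sum>q\<in>supp D. ?D q)"
      by (rule divisor_degree_superset[OF fin sub])
    also have "\<dots> = D p - 1 + (\<Sum>q\<in>supp D - {p}. D q)"
      using fin p by (simp add: sum.remove)
    also have "\<dots> = divisor_degree D - 1"
      using fin p by (simp add: divisor_degree_def sum.remove)
    finally show ?thesis using Suc.prems(3) by simp
  qed
  ultimately obtain x where x: "?D = tuple_divisor d x" using Suc.IH by blast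
  have "tuple_divisor (Suc d) (x(d := p)) q = D q" for q
  proof -
    have "tuple_divisor (Suc d) (x(d := p)) q = tuple_divisor d x q + of_bool (p = q)"
      by (simp add: tuple_divisor_sum)
    also have "\<dots> = D q" by (simp flip: x)
    finally show ?thesis .
  qed
  then show ?case by (metis ext)
qed

text \<open>Distributes indices among the legs. Values of \<open>l\<close> from \<open>n\<close> on
  mark indices not assigned to any leg; the induction takes the fibre over \<open>n\<close> from
  these and sends the rest to \<open>Suc n\<close>, where they remain available.\<close>

lemma ex_fibre_cards:
  fixes m :: "nat \<Rightarrow> nat"
  assumes "finite I" "(\<Sum>i<n. m i) \<le> card I"
  obtains l :: "'k \<Rightarrow> nat" where "\<And>i. i < n \<Longrightarrow> card {k\<in>I. l k = i} = m i"
proof -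
  have "\<exists>l :: 'k \<Rightarrow> nat. \<forall>i<n. card {k\<in>I. l k = i} = m i"
    using assms(2)
  proof (induction n)
    case (Suc n)
    then obtain l :: "'k \<Rightarrow> nat" where l: "\<forall>i<n. card {k\<in>I. l k = i} = m i" by auto
    let ?I = "{k\<in>I. n \<le> l k}"
    have "card I = card (?I \<union> (\<Union>i<n. {k\<in>I. l k = i}))"
      by (intro arg_cong[where f = card]) (auto simp: not_le)
    also have "\<dots> = card ?I + card (\<Union>i<n. {k\<in>I. l k = i})"
      using assms(1) by (intro card_Un_disjoint) auto
    also have "card (\<Union>i<n. {k\<in>I. l k = i}) = (\<Sum>i<n. m i)"
      using assms(1) l by (subst card_UN_disjoint) auto
    finally have "m n \<le> card ?I" using Suc.prems by simp
    then obtain J where J: "J \<subseteq> ?I" "card J = m n" by (meson obtain_subset_with_card_n)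
    define l' where "l' k = (if k \<in> ?I then (if k \<in> J then n else Suc n) else l k)" for k
    have "card {k\<in>I. l' k = i} = m i" if "i < Suc n" for i
    proof (cases "i = n")
      case True
      then have "{k\<in>I. l' k = i} = J" using J(1) by (auto simp: l'_def)
      then show ?thesis using J True by simp
    next
      case False
      then have "{k\<in>I. l' k = i} = {k\<in>I. l k = i}"
        using that J(1) by (auto simp: l'_def)
      then show ?thesis using l that False by simp
    qed
    then show ?case by blast
  qed simp
  with that show ?thesis by blast
qed

text \<open>The divisor that arises when \<open>m p i\<close> chips go from \<open>p\<close> to
  \<open>z p i\<close> is realized by changing entries of a given tuple. Closeness in the symmetric
  power is closeness of tuples, so the equation of divisors alone would not show that the new
  divisor is near \<open>D\<close>.\<close>

lemma move_chips:
  fixes D :: "'a divisor" and m :: "'a \<Rightarrow> nat \<Rightarrow> nat" and val :: "'a \<Rightarrow> nat"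
  assumes D: "D = tuple_divisor d x"
    and m: "\<And>p. p \<in> supp D \<Longrightarrow> int (\<Sum>i<val p. m p i) \<le> D p"
  obtains y where
    "\<And>k. k < d \<Longrightarrow> y k = x k \<or> (\<exists>i<val (x k). m (x k) i > 0 \<and> y k = z (x k) i)"
    "\<And>q. tuple_divisor d y q = D q + (\<Sum>p\<in>supp D. \<Sum>i<val p. int (m p i) * (of_bool (z p i = q) - of_bool (p = q)))"
proof -
  define I where "I p = {k. k < d \<and> x k = p}" for p
  have cI: "int (card (I p)) = D p" for p by (simp add: D tuple_divisor_def I_def)
  have finI: "finite (I p)" for p by (simp add: I_def)
  have "\<exists>l. \<forall>i<val p. card {k\<in>I p. l k = i} = m p i" if "p \<in> supp D" for p
  proof -
    have "(\<Sum>i<val p. m p i) \<le> card (I p)" using m[OF that] cI[of p] by linarith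
    then show ?thesis using ex_fibre_cards[OF finI, where m = "m p" and n = "val p"] by metis
  qed
  then obtain l :: "'a \<Rightarrow> nat \<Rightarrow> nat"
    where l: "\<And>p i. p \<in> supp D \<Longrightarrow> i < val p \<Longrightarrow> card {k\<in>I p. l p k = i} = m p i" by metis
  define y where "y k = (if l (x k) k < val (x k) then z (x k) (l (x k) k) else x k)" for k
  have "y k = x k \<or> (\<exists>i<val (x k). m (x k) i > 0 \<and> y k = z (x k) i)" if k: "k < d" for k
  proof (cases "l (x k) k < val (x k)")
    case True
    have "x k \<in> supp D" using k by (simp add: D supp_tuple_divisor)
    moreover have "k \<in> {j\<in>I (x k). l (x k) j = l (x k) k}" using k by (simp add: I_def)
    ultimately have "m (x k) (l (x k) k) > 0"
      using l[of "x k" "l (x k) k"] True finI[of "x k"] by (metis (no_types, lifting) card_gt_0_iff empty_iff finite_subset mem_Collect_eq subsetI)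
    then show ?thesis using True by (auto simp: y_def)
  qed (simp add: y_def)
  moreover have "tuple_divisor d y q = D q + (\<Sum>p\<in>supp D. \<Sum>i<val p. int (m p i) * (of_bool (z p i = q) - of_bool (p = q)))" for q
  proof -
    have fin: "finite (supp D)" by (simp add: D supp_tuple_divisor)
    have U: "{..<d} = (\<Union>p\<in>supp D. I p)" by (auto simp: I_def D supp_tuple_divisor)
    have "tuple_divisor d y q = (\<Sum>p\<in>supp D. \<Sum>k\<in>I p. of_bool (y k = q))"
      unfolding tuple_divisor_sum U by (rule sum.UNION_disjoint) (use fin finI in \<open>auto simp: I_def\<close>)
    also have "\<dots> = (\<Sum>p\<in>supp D. D p * of_bool (p = q) +
        (\<Sum>i<val p. int (m p i) * (of_bool (z p i = q) - of_bool (p = q))))"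
    proof (rule sum.cong[OF refl])
      fix p assume p: "p \<in> supp D"
      have "(\<Sum>k\<in>I p. of_bool (y k = q)) =
        (\<Sum>k\<in>I p. of_bool (p = q) + (\<Sum>i<val p. of_bool (l p k = i) * (of_bool (z p i = q) - of_bool (p = q))) :: int)"
      proof (rule sum.cong[OF refl])
        fix k assume "k \<in> I p"
        then have "x k = p" by (simp add: I_def)
        have *: "(\<Sum>i<val p. of_bool (l p k = i) * (of_bool (z p i = q) - of_bool (p = q))) =
          (if l p k < val p then of_bool (z p (l p k) = q) - of_bool (p = q) else (0::int))"
          by (subst sum.cong[OF refl, of _ _ "\<lambda>i. if i = l p k then of_bool (z p i = q) - of_bool (p = q) else 0"]) auto
        show "of_bool (y k = q) = of_bool (p = q) + (\<Sum>i<val p. of_bool (l p k = i) * (of_bool (z p i = q) - of_bool (p = q) :: int))"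
          unfolding * using \<open>x k = p\<close> by (simp add: y_def)
      qed
      also have "\<dots> = D p * of_bool (p = q) + (\<Sum>k\<in>I p. \<Sum>i<val p. of_bool (l p k = i) * (of_bool (z p i = q) - of_bool (p = q)))"
        by (simp only: sum.distrib sum_constant flip: cI)
      also have "(\<Sum>k\<in>I p. \<Sum>i<val p. of_bool (l p k = i) * (of_bool (z p i = q) - of_bool (p = q) :: int)) =
         (\<Sum>i<val p. \<Sum>k\<in>I p. of_bool (l p k = i) * (of_bool (z p i = q) - of_bool (p = q)))"
        by (rule sum.swap)
      also have "\<dots> = (\<Sum>i<val p. int (m p i) * (of_bool (z p i = q) - of_bool (p = q)))"
      proof (rule sum.cong[OF refl])
        fix i assume "i \<in> {..<val p}"
        then have "(\<Sum>k\<in>I p. of_bool (l p k = i)) = int (m p i)"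
          using l[OF p, of i] finI[of p] by (simp add: of_bool_def sum.If_cases Int_def)
        then show "(\<Sum>k\<in>I p. of_bool (l p k = i) * (of_bool (z p i = q) - of_bool (p = q))) =
          int (m p i) * (of_bool (z p i = q) - of_bool (p = q))"
          by (simp flip: sum_distrib_right)
      qed
      finally show "(\<Sum>k\<in>I p. of_bool (y k = q)) = D p * of_bool (p = q) +
        (\<Sum>i<val p. int (m p i) * (of_bool (z p i = q) - of_bool (p = q)))" .
    qed
    also have "\<dots> = (\<Sum>p\<in>supp D. D p * of_bool (p = q)) +
        (\<Sum>p\<in>supp D. \<Sum>i<val p. int (m p i) * (of_bool (z p i = q) - of_bool (p = q)))"
      by (rule sum.distrib)
    also have "(\<Sum>p\<in>supp D. D p * of_bool (p = q)) = D q"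
    proof -
      have "(\<Sum>p\<in>supp D. D p * of_bool (p = q)) = (\<Sum>p\<in>supp D. if p = q then D q else 0)"
        by (intro sum.cong) auto
      then show ?thesis using fin by (auto simp: supp_def)
    qed
    finally show ?thesis .
  qed
  ultimately show ?thesis using that by blast
qed

lemma openin_sym_topology: "openin (sym_topology d) = sym_open d"
  unfolding sym_topology_def by (rule topology_inverse'[OF istopology_sym_open])

text \<open>Unfolds the quotient topology at one representing tuple. The product topology lives on
  extensional functions, hence the detour through \<open>restrict\<close>, which does not change the
  divisor.\<close>

lemma sym_topology_nearby:
  fixes x :: "nat \<Rightarrow> 'a::metric_space"
  assumes "openin (subtopology (sym_topology d) \<Delta>) U" "tuple_divisor d x \<in> U"
  obtains \<delta> where "\<delta> > 0"
    "\<And>y. (\<And>k. k < d \<Longrightarrow> dist (x k) (y k) < \<delta>) \<Longrightarrow> tuple_divisor d y \<in> \<Delta> \<Longrightarrow> tuple_divisor d y \<in> U"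
proof -
  let ?P = "product_topology (\<lambda>_. euclidean) {..<d} :: (nat \<Rightarrow> 'a) topology"
  obtain W where W: "sym_open d W" "U = W \<inter> \<Delta>"
    using assms(1) by (auto simp: openin_subtopology openin_sym_topology)
  let ?V = "{x \<in> topspace ?P. tuple_divisor d x \<in> W}"
  have V: "openin ?P ?V" using W(1) by (simp add: sym_open_def)
  have rd: "tuple_divisor d (restrict y {..<d}) = tuple_divisor d y" for y :: "nat \<Rightarrow> 'a"
    by (rule tuple_divisor_cong) simp
  have "restrict x {..<d} \<in> ?V" using assms(2) W(2) rd by simp
  then obtain X where X: "\<And>k. k < d \<Longrightarrow> open (X k)" "restrict x {..<d} \<in> PiE {..<d} X" "PiE {..<d} X \<subseteq> ?V"
    using V unfolding openin_product_topology_alt by (metis (no_types, lifting) lessThan_iff open_openin)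
  have "\<exists>e>0. ball (x k) e \<subseteq> X k" if "k < d" for k
    using X(1)[OF that] X(2) that open_contains_ball by (auto simp: PiE_iff)
  then obtain e where e: "\<And>k. k < d \<Longrightarrow> e k > 0" "\<And>k. k < d \<Longrightarrow> ball (x k) (e k) \<subseteq> X k"
    by metis
  define \<delta> where "\<delta> = Min (insert 1 (e ` {..<d}))"
  have d: "\<delta> > 0" "\<And>k. k < d \<Longrightarrow> \<delta> \<le> e k" using e(1) by (auto simp: \<delta>_def)
  have "tuple_divisor d y \<in> U" if y: "\<And>k. k < d \<Longrightarrow> dist (x k) (y k) < \<delta>" "tuple_divisor d y \<in> \<Delta>" for y
  proof -
    have "restrict y {..<d} \<in> PiE {..<d} X"
    proof (rule PiE_I)
      fix k assume "k \<in> {..<d}"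
      then have "y k \<in> ball (x k) (e k)" using y(1)[of k] d(2)[of k] by auto
      then show "restrict y {..<d} k \<in> X k" using e(2)[of k] \<open>k \<in> {..<d}\<close> by (auto simp del: mem_ball)
    qed simp
    then have "restrict y {..<d} \<in> ?V" by (rule subsetD[OF X(3)])
    then have "tuple_divisor d y \<in> W" by (simp add: rd)
    then show ?thesis using y(2) W(2) by blast
  qed
  with d(1) show ?thesis by (rule that)
qed

section \<open>Neighbourhoods of the support of a divisor\<close>

text \<open>Functions are shaped within distance \<open>\<rho>\<close> of a chip, but legs have
  length \<open>2 * \<rho>\<close>, so that points at distance \<open>\<rho>\<close> are still inner
  points of a leg. The separation by more than \<open>4 * \<rho>\<close> makes these stars
  disjoint.\<close>

locale chip_stars =
  fixes D :: "'a::metric_space divisor" and val :: "'a \<Rightarrow> nat"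
    and leg :: "'a \<Rightarrow> nat \<Rightarrow> real \<Rightarrow> 'a" and \<rho> :: real
  assumes cpt: "compact (UNIV :: 'a set)" and con: "connected (UNIV :: 'a set)"
    and stars: "\<exists>n \<sigma> \<psi>. star (p :: 'a) n \<sigma> \<psi>"
    and fin: "finite (supp D)" and pos: "p \<in> supp D \<Longrightarrow> D p > 0"
    and rho: "\<rho> > 0"
    and leg: "p \<in> supp D \<Longrightarrow> star p (val p) (2 * \<rho>) (leg p)"
    and sep: "p \<in> supp D \<Longrightarrow> q \<in> supp D \<Longrightarrow> p \<noteq> q \<Longrightarrow> dist p q > 4 * \<rho>"
begin

abbreviation P :: "'a set" where "P \<equiv> supp D"
abbreviation E :: "'a set set" where "E \<equiv> components (- supp D)"

definition cmp :: "'a \<Rightarrow> 'a set" where "cmp q = connected_component_set (- P) q"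
text \<open>The parameter \<open>\<rho>\<close> is a mere choice: by \<open>cmp_leg\<close>, every
  positive parameter on the leg gives the same component.\<close>

definition out :: "'a \<Rightarrow> nat \<Rightarrow> 'a set" where "out p i = cmp (leg p i \<rho>)"

lemma val_pos: "p \<in> P \<Longrightarrow> 0 < val p"
  using starD(1)[OF leg] by force

lemma dist_leg: "p \<in> P \<Longrightarrow> i < val p \<Longrightarrow> 0 \<le> s \<Longrightarrow> s \<le> 2 * \<rho> \<Longrightarrow> dist p (leg p i s) = s"
  using star_dist[OF leg] by blast

lemma leg_0: "p \<in> P \<Longrightarrow> i < val p \<Longrightarrow> leg p i 0 = p"
  using starD(3)[OF leg] by blast

lemma leg_far:
  assumes "p \<in> P" "i < val p" "0 \<le> s" "s \<le> 2 * \<rho>" "q \<in> P" "q \<noteq> p"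
  shows "dist q (leg p i s) > 2 * \<rho>"
  using dist_leg[OF assms(1-4)] sep[OF assms(1,5)] assms dist_triangle[of p q "leg p i s"]
  by (simp add: dist_commute)

lemma leg_notin:
  assumes "p \<in> P" "i < val p" "0 < s" "s \<le> 2 * \<rho>"
  shows "leg p i s \<notin> P"
  using dist_leg[OF assms(1,2), of s] leg_far[OF assms(1,2), of s "leg p i s"] assms rho by force

lemma leg_inj:
  assumes "p \<in> P" "i < val p" "0 < s" "s \<le> 2 * \<rho>" "q \<in> P" "j < val q" "0 \<le> t" "t \<le> 2 * \<rho>"
    "leg p i s = leg q j t"
  shows "p = q" "i = j" "s = t"
proof -
  show pq: "p = q"
    using dist_leg[OF assms(1-2), of s] leg_far[of q j t p] assms by force
  show "i = j" "s = t"
    using star_inj[OF leg, of p i j s t] assms pq by auto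
qed

lemma leg_cases:
  obtains "q \<in> P" | p i s where "p \<in> P" "i < val p" "0 < s" "s \<le> \<rho>" "q = leg p i s" "q \<notin> P"
  | "q \<notin> P" "\<And>p. p \<in> P \<Longrightarrow> dist p q > \<rho>"
proof (cases "q \<in> P \<or> (\<forall>p\<in>P. dist p q > \<rho>)")
  case False
  then obtain p where p: "p \<in> P" "dist p q \<le> \<rho>" "q \<notin> P" by force
  then have "dist p q \<le> 2 * \<rho>" using rho by simp
  then obtain i where "i < val p" "q = leg p i (dist p q)"
    using star_cover[OF leg[OF p(1)]] by blast
  moreover have "dist p q > 0" using p by auto
  ultimately show ?thesis using p that(2) by blast
qed (use that in blast)

lemma cmp_mem: "q \<notin> P \<Longrightarrow> q \<in> cmp q" "q \<notin> P \<Longrightarrow> cmp q \<in> E"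
  by (auto simp: cmp_def components_def connected_component_refl_eq)

lemma cmp_eq:
  assumes "S \<in> E" "q \<in> S"
  shows "q \<notin> P" "cmp q = S"
proof -
  show "q \<notin> P" using in_components_subset assms by fastforce
  obtain z where "S = connected_component_set (- P) z" using assms by (auto simp: components_def)
  then show "cmp q = S" using connected_component_eq assms(2) by (fastforce simp: cmp_def)
qed

lemma cmp_connected:
  assumes "connected T" "T \<subseteq> - P" "a \<in> T" "b \<in> T"
  shows "cmp a = cmp b"
proof -
  have "connected_component (- P) a b"
    using assms unfolding connected_component_def by blast
  then show ?thesis
    using connected_component_eq[of b "- P" a] by (simp add: cmp_def)
qed

lemma star_leg_connected:
  assumes "star p n \<sigma> \<psi>" "i < n" "T \<subseteq> {0..\<sigma>}" "connected T"
  shows "connected (\<psi> i ` T)"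
proof (rule connected_continuous_image[OF _ assms(4)])
  show "continuous_on T (\<psi> i)"
  proof (rule continuous_onI)
    fix s and e :: real assume s: "s \<in> T" "0 < e"
    show "\<exists>d>0. \<forall>t\<in>T. dist t s < d \<longrightarrow> dist (\<psi> i t) (\<psi> i s) \<le> e"
    proof (intro exI conjI ballI impI)
      fix t assume "t \<in> T" "dist t s < e"
      then show "dist (\<psi> i t) (\<psi> i s) \<le> e"
        using starD(4)[OF assms(1,2), of t s] assms(3) s by (force simp: dist_real_def)
    qed (use s in auto)
  qed
qed

lemma cmp_leg:
  assumes "p \<in> P" "i < val p" "0 < s" "s \<le> 2 * \<rho>"
  shows "cmp (leg p i s) = out p i"
  unfolding out_def
proof (rule cmp_connected)
  show "connected (leg p i ` {0<..2 * \<rho>})"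
    by (rule star_leg_connected[OF leg]) (use assms in auto)
  show "leg p i ` {0<..2 * \<rho>} \<subseteq> - P"
    using leg_notin[OF assms(1,2)] by auto
qed (use assms rho in auto)

lemma leg_in_out: "p \<in> P \<Longrightarrow> i < val p \<Longrightarrow> 0 < s \<Longrightarrow> s \<le> 2 * \<rho> \<Longrightarrow> leg p i s \<in> out p i"
  using cmp_leg cmp_mem(1) leg_notin by metis

lemma out_in_E: "p \<in> P \<Longrightarrow> i < val p \<Longrightarrow> out p i \<in> E"
  unfolding out_def using leg_notin[of p i \<rho>] rho by (intro cmp_mem(2)) auto

lemma cmp_nearby:
  assumes "q \<notin> P"
  obtains \<eta> where "\<eta> > 0" "\<And>q'. dist q q' < \<eta> \<Longrightarrow> q' \<notin> P \<and> cmp q' = cmp q"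
proof -
  have "open (- P)" using fin by (simp add: finite_imp_closed open_Compl)
  then obtain e where e: "e > 0" "ball q e \<subseteq> - P"
    using assms open_contains_ball by (metis ComplI)
  obtain n \<sigma> \<psi> where st: "star q n \<sigma> \<psi>" using stars by blast
  show ?thesis
  proof (rule that)
    show "min e \<sigma> > 0" using e starD(2)[OF st] by simp
    fix q' assume d: "dist q q' < min e \<sigma>"
    then obtain i where i: "i < n" "q' = \<psi> i (dist q q')"
      using star_cover[OF st, of q'] by auto
    have sub: "\<psi> i ` {0..dist q q'} \<subseteq> - P"
    proof
      fix z assume "z \<in> \<psi> i ` {0..dist q q'}"
      then obtain t where "0 \<le> t" "t \<le> dist q q'" "z = \<psi> i t" by auto
      then have "dist q z < e" using star_dist[OF st i(1), of t] d by simp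
      then show "z \<in> - P" using e by auto
    qed
    have "cmp q' = cmp q"
    proof (rule cmp_connected[OF _ sub])
      show "connected (\<psi> i ` {0..dist q q'})"
        by (rule star_leg_connected[OF st i(1)]) (use d in auto)
      show "q' \<in> \<psi> i ` {0..dist q q'}" using i by (metis atLeastAtMost_iff imageI order_refl zero_le_dist)
      show "q \<in> \<psi> i ` {0..dist q q'}"
        using starD(3)[OF st i(1)] by (metis atLeastAtMost_iff imageI order_refl zero_le_dist)
    qed
    then show "q' \<notin> P \<and> cmp q' = cmp q" using d e by auto
  qed
qed

text \<open>A small ball around a chip consists of the chip and pieces of the components that its
  legs enter; a small ball elsewhere stays in one component.\<close>

lemma open_saturated:
  assumes "\<And>q. q \<in> U \<Longrightarrow> q \<notin> P \<Longrightarrow> cmp q \<subseteq> U" "\<And>q i. q \<in> U \<Longrightarrow> q \<in> P \<Longrightarrow> i < val q \<Longrightarrow> out q i \<subseteq> U"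
  shows "open U"
  unfolding open_contains_ball
proof
  fix q assume q: "q \<in> U"
  show "\<exists>e>0. ball q e \<subseteq> U"
  proof (cases "q \<in> P")
    case True
    have "ball q \<rho> \<subseteq> U"
    proof
      fix z assume "z \<in> ball q \<rho>"
      then have d: "dist q z < \<rho>" by simp
      show "z \<in> U"
      proof (cases "z = q")
        case False
        obtain i where "i < val q" "z = leg q i (dist q z)"
          using star_cover[OF leg[OF True], of z] d rho by auto
        then show ?thesis
          using leg_in_out[OF True, of i "dist q z"] False d rho assms(2)[OF q True] by force
      qed (use q in simp)
    qed
    then show ?thesis using rho by blast
  next
    case False
    then obtain \<eta> where h: "\<eta> > 0" "\<And>q'. dist q q' < \<eta> \<Longrightarrow> q' \<notin> P \<and> cmp q' = cmp q"
      using cmp_nearby by blast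
    then have "ball q \<eta> \<subseteq> U" using assms(1)[OF q False] cmp_mem(1) by (metis mem_ball subset_iff)
    then show ?thesis using h(1) by blast
  qed
qed

text \<open>Every point has a neighbourhood that meets only finitely many components: those entered
  by the legs at a chip, a single one elsewhere. Compactness does the rest.\<close>

lemma finite_E: "finite E"
proof -
  have "\<exists>\<eta> \<F>. \<eta> > 0 \<and> finite \<F> \<and> (\<forall>z. dist q z < \<eta> \<longrightarrow> z \<notin> P \<longrightarrow> cmp z \<in> \<F>)" for q
  proof (cases "q \<in> P")
    case True
    have "cmp z \<in> out q ` {..<val q}" if d: "dist q z < \<rho>" "z \<notin> P" for z
    proof -
      obtain i where "i < val q" "z = leg q i (dist q z)"
        using star_cover[OF leg[OF True], of z] d rho by auto
      moreover have "dist q z > 0" using True d by auto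
      ultimately have "cmp z = out q i"
        using cmp_leg[OF True, of i "dist q z"] d rho by auto
      then show ?thesis using \<open>i < val q\<close> by auto
    qed
    then show ?thesis using rho by (intro exI[of _ \<rho>] exI[of _ "out q ` {..<val q}"]) auto
  next
    case False
    then obtain \<eta> where "\<eta> > 0" "\<And>q'. dist q q' < \<eta> \<Longrightarrow> q' \<notin> P \<and> cmp q' = cmp q"
      using cmp_nearby by blast
    then have "\<eta> > 0 \<and> finite {cmp q} \<and> (\<forall>z. dist q z < \<eta> \<longrightarrow> z \<notin> P \<longrightarrow> cmp z \<in> {cmp q})" by blast
    then show ?thesis by blast
  qed
  then obtain \<eta> \<F> where h: "\<And>q. \<eta> q > 0" "\<And>q. finite (\<F> q)"
    "\<And>q z. dist q z < \<eta> q \<Longrightarrow> z \<notin> P \<Longrightarrow> cmp z \<in> \<F> q" by metis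
  have "UNIV \<subseteq> (\<Union>q\<in>UNIV. ball q (\<eta> q))"
    using h(1) by (auto intro: exI[where P = "\<lambda>q. _ \<in> ball q (\<eta> q)"] simp del: mem_ball simp: centre_in_ball)
  then obtain Q where Q: "finite Q" "UNIV \<subseteq> (\<Union>q\<in>Q. ball q (\<eta> q))"
    by (rule compactE_image[OF cpt open_ball])
  have "E \<subseteq> (\<Union>q\<in>Q. \<F> q)"
  proof
    fix S assume S: "S \<in> E"
    then obtain z where z: "z \<in> S" using in_components_nonempty by blast
    obtain q where "q \<in> Q" "z \<in> ball q (\<eta> q)" using Q(2) by blast
    then show "S \<in> (\<Union>q\<in>Q. \<F> q)" using cmp_eq[OF S z] h(3)[of q z] by auto
  qed
  then show ?thesis using Q(1) h(2) by (meson finite_UN_I finite_subset)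
qed

lemma E_nonempty:
  obtains S where "S \<in> E"
proof -
  obtain q where "q \<notin> P"
  proof (cases "P = {}")
    case False
    then obtain p where p: "p \<in> P" by blast
    show ?thesis using that leg_notin[OF p val_pos[OF p], of \<rho>] rho by auto
  qed auto
  then show ?thesis using that cmp_mem(2) by blast
qed

text \<open>If at each chip all legs agreed about \<open>A\<close>, the components in
  \<open>A\<close> together with the chips that they surround would form an open and closed set. Leg
  0 then speaks for all legs, and the same construction with \<open>- A\<close> gives the
  complement.\<close>

lemma mixed_vertex:
  assumes "A \<subseteq> E" "A \<noteq> {}" "A \<noteq> E"
  shows "\<exists>p i j. p \<in> P \<and> i < val p \<and> j < val p \<and> out p i \<in> A \<and> out p j \<notin> A"
proof (rule ccontr)
  assume neg: "\<not> ?thesis"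
  then have all: "out p i \<in> A \<longleftrightarrow> out p j \<in> A" if "p \<in> P" "i < val p" "j < val p" for p i j
    using that by blast
  let ?U = "\<lambda>B. {q. if q \<in> P then out q 0 \<in> B else cmp q \<in> B}"
  have op: "open (?U B)" if "B = A \<or> B = - A" for B
  proof (rule open_saturated)
    fix q assume q: "q \<in> ?U B" "q \<notin> P"
    show "cmp q \<subseteq> ?U B"
    proof
      fix z assume "z \<in> cmp q"
      then show "z \<in> ?U B" using cmp_eq[OF cmp_mem(2)[OF q(2)]] q by auto
    qed
  next
    fix q i assume q: "q \<in> ?U B" "q \<in> P" "i < val q"
    then have B: "out q i \<in> B" using all[OF q(2) val_pos[OF q(2)] q(3)] that by auto
    show "out q i \<subseteq> ?U B"
    proof
      fix z assume "z \<in> out q i"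
      then show "z \<in> ?U B" using cmp_eq[OF out_in_E[OF q(2,3)]] B by auto
    qed
  qed
  have "open (- ?U A)"
  proof -
    have "- ?U A = ?U (- A)" by auto
    then show ?thesis using op[of "- A"] by simp
  qed
  moreover obtain S T where ST: "S \<in> A" "T \<in> E" "T \<notin> A" using assms by blast
  moreover obtain s t where st: "s \<in> S" "t \<in> T" using ST assms in_components_nonempty by blast
  ultimately have "?U A = UNIV"
    using op[of A] con cmp_eq[of S s] assms(1) by (intro connected_clopen_UNIV) auto
  moreover have "t \<notin> ?U A" using cmp_eq[OF ST(2) st(2)] ST by auto
  ultimately show False by blast
qed

text \<open>\<open>h\<close> has the value \<open>x S\<close> on the component \<open>S\<close> away from the support; on a leg at \<open>p\<close> it starts with
  the value \<open>b p\<close> and rises with slope \<open>m p i\<close> until it reaches that value. On legs of slope 0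
  \<open>height\<close> is a division by zero; it only occurs multiplied by \<open>m p i\<close>.\<close>

definition std :: "('a \<Rightarrow> real) \<Rightarrow> ('a set \<Rightarrow> real) \<Rightarrow> ('a \<Rightarrow> real) \<Rightarrow> ('a \<Rightarrow> nat \<Rightarrow> nat) \<Rightarrow> bool" where
  "std h x b m \<longleftrightarrow>
     (\<forall>q. q \<notin> P \<longrightarrow> (\<forall>p\<in>P. \<rho> \<le> dist p q) \<longrightarrow> h q = x (cmp q)) \<and>
     (\<forall>p\<in>P. \<forall>i<val p. \<forall>s. 0 \<le> s \<longrightarrow> s < \<rho> \<longrightarrow> h (leg p i s) = min (x (out p i)) (b p + real (m p i) * s)) \<and>
     (\<forall>p\<in>P. \<forall>i<val p. b p \<le> x (out p i) \<and> (m p i = 0 \<longrightarrow> x (out p i) = b p) \<and>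
        (m p i > 0 \<longrightarrow> b p < x (out p i) \<and> x (out p i) < b p + real (m p i) * \<rho>))"

definition height :: "('a set \<Rightarrow> real) \<Rightarrow> ('a \<Rightarrow> real) \<Rightarrow> ('a \<Rightarrow> nat \<Rightarrow> nat) \<Rightarrow> 'a \<Rightarrow> nat \<Rightarrow> real" where
  "height x b m p i = (x (out p i) - b p) / real (m p i)"

lemma
  assumes "std h x b m"
  shows std_far: "q \<notin> P \<Longrightarrow> (\<And>p. p \<in> P \<Longrightarrow> \<rho> \<le> dist p q) \<Longrightarrow> h q = x (cmp q)"
    and std_zero: "p \<in> P \<Longrightarrow> i < val p \<Longrightarrow> m p i = 0 \<Longrightarrow> x (out p i) = b p"
    and std_hgt: "p \<in> P \<Longrightarrow> i < val p \<Longrightarrow> m p i > 0 \<Longrightarrow> 0 < height x b m p i \<and> height x b m p i < \<rho> \<and>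
        x (out p i) = b p + real (m p i) * height x b m p i"
  using assms unfolding std_def height_def by (auto simp: field_simps)

text \<open>Extends the formula from parameters below \<open>\<rho>\<close> to the whole leg: the
  climb ends before \<open>\<rho>\<close>, so from there on the linear part stays above the value of
  the component.\<close>

lemma std_leg:
  assumes h: "std h x b m" and p: "p \<in> P" "i < val p" "0 \<le> s" "s \<le> 2 * \<rho>"
  shows "h (leg p i s) = min (x (out p i)) (b p + real (m p i) * s)"
proof (cases "s < \<rho>")
  case True
  then show ?thesis using h p by (auto simp: std_def)
next
  case False
  then have s: "0 < s" using rho by simp
  have "\<rho> \<le> dist q (leg p i s)" if "q \<in> P" for q
    using leg_far[OF p that] dist_leg[OF p] False rho by (cases "q = p") auto
  then have "h (leg p i s) = x (out p i)"
    using std_far[OF h leg_notin[OF p(1,2) s p(4)]] cmp_leg[OF p(1,2) s p(4)] by auto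
  moreover have "x (out p i) \<le> b p + real (m p i) * s"
  proof (cases "m p i = 0")
    case True
    then show ?thesis using std_zero[OF h p(1,2)] by simp
  next
    case F: False
    then have *: "height x b m p i < \<rho>" "x (out p i) = b p + real (m p i) * height x b m p i"
      using std_hgt[OF h p(1,2)] by auto
    then have "real (m p i) * height x b m p i \<le> real (m p i) * s"
      using False by (intro mult_left_mono) auto
    then show ?thesis using * by simp
  qed
  ultimately show ?thesis by simp
qed

section \<open>Divisors of functions in standard form\<close>

lemma principal_divisor_std_supp:
  assumes h: "std h x b m" and 1: "q \<in> P"
  shows "principal_divisor h q = - (\<Sum>i<val q. int (m q i))"
proof -
  have h0: "h q = b q"
  proof -
    have "h (leg q 0 0) = min (x (out q 0)) (b q)"
      using std_leg[OF h 1 val_pos[OF 1], of 0] rho by simp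
    moreover have "b q \<le> x (out q 0)" using h 1 val_pos[OF 1] by (simp add: std_def)
    ultimately show ?thesis using leg_0[OF 1 val_pos[OF 1]] by simp
  qed
  show ?thesis
  proof (rule principal_divisor_star[OF leg[OF 1]])
    fix i assume i: "i < val q"
    show "\<exists>\<sigma>>0. \<forall>t\<in>{0..\<sigma>}. h (leg q i t) = h q + of_int (int (m q i)) * t"
    proof (cases "m q i = 0")
      case True
      then show ?thesis
        using std_leg[OF h 1 i] std_zero[OF h 1 i] rho h0 by (intro exI[of _ \<rho>]) auto
    next
      case False
      let ?h = "height x b m q i"
      have *: "0 < ?h" "?h < \<rho>" "x (out q i) = b q + real (m q i) * ?h"
        using std_hgt[OF h 1 i] False by auto
      show ?thesis
      proof (intro exI conjI ballI)
        fix t assume t: "t \<in> {0..?h}"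
        then have "real (m q i) * t \<le> real (m q i) * ?h" by (intro mult_left_mono) auto
        then show "h (leg q i t) = h q + of_int (int (m q i)) * t"
          using std_leg[OF h 1 i, of t] h0 t * by simp
      qed (use * in simp)
    qed
  qed
qed

text \<open>Along the leg the function climbs with slope \<open>m p0 i0\<close> up to the parameter
  \<open>height\<close> and is constant afterwards. The only kink is there, and the drop of the
  slope is the number of chips.\<close>

lemma principal_divisor_std_leg:
  assumes h: "std h x b m" and 2: "p0 \<in> P" "i0 < val p0" "0 < s" "s \<le> \<rho>"
  shows "principal_divisor h (leg p0 i0 s) = (if height x b m p0 i0 = s then int (m p0 i0) else 0)"
proof -
  let ?h = "height x b m p0 i0" and ?m = "m p0 i0"
  define \<delta> where "\<delta> = s / 2"
  have d: "0 < \<delta>" "\<delta> < s" "s + \<delta> \<le> 2 * \<rho>" using 2 by (auto simp: \<delta>_def)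
  \<comment> \<open>The slopes at the point, away from \<open>p0\<close> for \<open>j = 0\<close>
    and back towards \<open>p0\<close> for \<open>j = 1\<close>. The comparison with
    \<open>?h\<close> is strict in the first and weak in the second, so the two cancel everywhere
    but at the kink.\<close>
  define k where "k j = (if j = (0::nat) then (if ?m > 0 \<and> s < ?h then int ?m else 0)
      else (if ?m > 0 \<and> s \<le> ?h then - int ?m else 0))" for j
  note L = std_leg[OF h 2(1,2)]
  have W: "h (leg p0 i0 t) = b p0 + real ?m * min t ?h" if "?m > 0" "0 \<le> t" "t \<le> 2 * \<rho>" for t
  proof -
    have *: "x (out p0 i0) = b p0 + real ?m * ?h"
      using std_hgt[OF h 2(1,2)] that by auto
    show ?thesis
      using L[OF that(2,3)] * that(1) by (auto simp: min_def mult_le_cancel_left)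
  qed
  have "principal_divisor h (leg p0 i0 s) = - (\<Sum>j<2. k j)"
  proof (rule principal_divisor_star[OF star_leg_point[OF leg[OF 2(1)] 2(2) d]])
    fix j assume "j < (2::nat)"
    then consider "?m = 0" | "?m > 0" "j = 0" | "?m > 0" "j = 1" by force
    then show "\<exists>\<sigma>>0. \<forall>t\<in>{0..\<sigma>}. h (if j = 0 then leg p0 i0 (s + t) else leg p0 i0 (s - t)) =
        h (leg p0 i0 s) + of_int (k j) * t"
    proof cases
      case 1
      then show ?thesis
        using std_zero[OF h 2(1,2)] L d 2(3) by (intro exI[of _ \<delta>]) (auto simp: k_def)
    next
      case 2
      note W = W[OF 2(1)]
      show ?thesis
      proof (cases "s < ?h")
        case True
        have "h (leg p0 i0 (s + t)) = h (leg p0 i0 s) + of_int (k j) * t" if "t \<in> {0..min \<delta> (?h - s)}" for t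
          using that W[of "s + t"] W[of s] d True 2 by (simp add: k_def algebra_simps)
        then show ?thesis using True d 2 by (intro exI[of _ "min \<delta> (?h - s)"]) auto
      next
        case False
        have "h (leg p0 i0 (s + t)) = h (leg p0 i0 s) + of_int (k j) * t" if "t \<in> {0..\<delta>}" for t
          using that W[of "s + t"] W[of s] d False 2 by (auto simp add: k_def)
        then show ?thesis using False d 2 by (intro exI[of _ \<delta>]) auto
      qed
    next
      case 3
      note W = W[OF 3(1)]
      show ?thesis
      proof (cases "s \<le> ?h")
        case True
        have "h (leg p0 i0 (s - t)) = h (leg p0 i0 s) + of_int (k j) * t" if "t \<in> {0..\<delta>}" for t
          using that W[of "s - t"] W[of s] d True 3 by (simp add: k_def algebra_simps)
        then show ?thesis using True d 3 by (intro exI[of _ \<delta>]) auto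
      next
        case False
        have "h (leg p0 i0 (s - t)) = h (leg p0 i0 s) + of_int (k j) * t" if "t \<in> {0..min \<delta> (s - ?h)}" for t
          using that W[of "s - t"] W[of s] d False 3 by (auto simp add: k_def)
        then show ?thesis using False d 3 by (intro exI[of _ "min \<delta> (s - ?h)"]) auto
      qed
    qed
  qed
  also have "(\<Sum>j<2. k j) = k 0 + k 1" by (simp add: numeral_2_eq_2)
  also have "- (k 0 + k 1) = (if ?h = s then int ?m else 0)" by (auto simp: k_def)
  finally show ?thesis .
qed

lemma principal_divisor_std_far:
  assumes h: "std h x b m" and 3: "q \<notin> P" "\<And>p. p \<in> P \<Longrightarrow> dist p q > \<rho>"
  shows "principal_divisor h q = 0"
proof -
  obtain \<eta> where e: "\<eta> > 0" "\<And>q'. dist q q' < \<eta> \<Longrightarrow> q' \<notin> P \<and> cmp q' = cmp q"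
    using cmp_nearby[OF 3(1)] by blast
  define \<delta> where "\<delta> = Min (insert \<eta> ((\<lambda>p. dist p q - \<rho>) ` P))"
  have d: "0 < \<delta>" "\<delta> \<le> \<eta>" "\<And>p. p \<in> P \<Longrightarrow> \<delta> \<le> dist p q - \<rho>"
    using fin e(1) 3(2) by (auto simp: \<delta>_def)
  have near: "h z = x (cmp q)" if "dist q z < \<delta>" for z
  proof -
    have z: "z \<notin> P" "cmp z = cmp q" using e(2)[of z] that d(2) by auto
    have "\<rho> \<le> dist p z" if p: "p \<in> P" for p
      using d(3)[OF p] \<open>dist q z < \<delta>\<close> dist_triangle2[of p q z] by (simp add: dist_commute)
    then show ?thesis using std_far[OF h z(1)] z(2) by simp
  qed
  obtain n \<sigma> \<psi> where "star q n \<sigma> \<psi>" using stars by blast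
  then show ?thesis
    using near d(1) by (intro principal_divisor_locally_const[of q n \<sigma> \<psi> \<delta>]) auto
qed

text \<open>In terms of chips: \<open>m p i\<close> of them move from \<open>p\<close> to the kink
  on leg \<open>i\<close>. The form of the sum is the one of \<open>move_chips\<close>.\<close>

lemma principal_divisor_std:
  assumes h: "std h x b m"
  shows "principal_divisor h q =
    (\<Sum>p\<in>P. \<Sum>i<val p. int (m p i) * (of_bool (leg p i (height x b m p i) = q) - of_bool (p = q)))"
    (is "_ = (\<Sum>p\<in>P. \<Sum>i<val p. ?T p i)")
proof (cases rule: leg_cases[of q])
  case 1
  have "principal_divisor h q = - (\<Sum>i<val q. int (m q i))"
    by (rule principal_divisor_std_supp[OF h 1])
  also have "\<dots> = (\<Sum>p\<in>P. if p = q then - (\<Sum>i<val q. int (m q i)) else 0)"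
    using fin 1 by simp
  also have "\<dots> = (\<Sum>p\<in>P. \<Sum>i<val p. ?T p i)"
  proof (rule sum.cong[OF refl])
    fix p assume p: "p \<in> P"
    have "?T p i = (if p = q then - int (m p i) else 0)" if i: "i < val p" for i
    proof (cases "m p i = 0")
      case False
      then have "leg p i (height x b m p i) \<noteq> q"
        using std_hgt[OF h p i] leg_notin[OF p i, of "height x b m p i"] 1 rho by force
      then show ?thesis by simp
    qed auto
    then have "(\<Sum>i<val p. ?T p i) = (\<Sum>i<val p. if p = q then - int (m p i) else 0)"
      by (intro sum.cong refl) auto
    then show "(if p = q then - (\<Sum>i<val q. int (m q i)) else 0) = (\<Sum>i<val p. ?T p i)"
      by (simp add: sum_negf)
  qed
  finally show ?thesis .
next
  case (2 p0 i0 s)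
  let ?h = "height x b m p0 i0" and ?m = "m p0 i0"
  have "principal_divisor h q = (if ?h = s then int ?m else 0)"
    using principal_divisor_std_leg[OF h 2(1-4)] 2(5) by simp
  also have "\<dots> = (\<Sum>p\<in>P. if p = p0 then (\<Sum>i<val p. if i = i0 then (if ?h = s then int ?m else 0) else 0) else 0)"
    using fin 2(1,2) by (subst sum.delta) auto
  also have "\<dots> = (\<Sum>p\<in>P. \<Sum>i<val p. ?T p i)"
  proof (rule sum.cong[OF refl])
    fix p assume p: "p \<in> P"
    have "?T p i = (if p = p0 then (if i = i0 then (if ?h = s then int ?m else 0) else 0) else 0)"
      if i: "i < val p" for i
    proof (cases "m p i = 0")
      case False
      have "p \<noteq> q" using p 2 by auto
      have "leg p i (height x b m p i) = q \<Longrightarrow> p = p0 \<and> i = i0 \<and> height x b m p i = s"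
        using leg_inj[OF p i, of "height x b m p i" p0 i0 s] std_hgt[OF h p i] False 2 rho by auto
      then show ?thesis using \<open>p \<noteq> q\<close> 2 by auto
    qed auto
    then have "(\<Sum>i<val p. ?T p i) = (\<Sum>i<val p. if p = p0 then (if i = i0 then (if ?h = s then int ?m else 0) else 0) else 0)"
      by (intro sum.cong refl) auto
    then show "(if p = p0 then (\<Sum>i<val p. if i = i0 then (if ?h = s then int ?m else 0) else 0) else 0) = (\<Sum>i<val p. ?T p i)"
      by simp
  qed
  finally show ?thesis .
next
  case 3
  have "principal_divisor h q = 0" by (rule principal_divisor_std_far[OF h 3])
  moreover have T0: "?T p i = 0" if p: "p \<in> P" "i < val p" for p i
  proof (cases "m p i = 0")
    case False
    then have "leg p i (height x b m p i) \<noteq> q" "p \<noteq> q"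
      using std_hgt[OF h p] dist_leg[OF p, of "height x b m p i"] 3(1) 3(2)[OF p(1)] p rho by auto
    then show ?thesis by simp
  qed simp
  then have "(\<Sum>p\<in>P. \<Sum>i<val p. ?T p i) = 0"
    by (intro sum.neutral ballI) (simp only: T0 lessThan_iff)
  ultimately show ?thesis by simp
qed

lemma std_hgt_notin:
  assumes "std h x b m" "p \<in> P" "i < val p" "m p i > 0"
  shows "leg p i (height x b m p i) \<notin> P"
  using std_hgt[OF assms] leg_notin[OF assms(2,3)] rho by auto

lemma add_div_std_leg:
  assumes "std h x b m" "p \<in> P" "i < val p" "m p i > 0"
  shows "add_div D h (leg p i (height x b m p i)) = int (m p i)"
  using principal_divisor_std_leg[OF assms(1-3), of "height x b m p i"] std_hgt[OF assms] std_hgt_notin[OF assms]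
  by (simp add: add_div_def supp_def)

lemma add_div_std_nonzero:
  assumes h: "std h x b m" and q: "q \<notin> P" "add_div D h q \<noteq> 0"
  obtains p i where "p \<in> P" "i < val p" "m p i > 0" "q = leg p i (height x b m p i)"
proof (cases rule: leg_cases[of q])
  case 1
  then show ?thesis using q(1) by blast
next
  case (2 p i s)
  have "principal_divisor h (leg p i s) \<noteq> 0" using q 2 by (auto simp: add_div_def supp_def)
  then show ?thesis
    using principal_divisor_std_leg[OF h 2(1-4)] 2 that[of p i] by (auto split: if_splits)
next
  case 3
  then show ?thesis using q principal_divisor_std_far[OF h 3] by (auto simp: add_div_def supp_def)
qed

text \<open>The chips of \<open>p\<close> end up in \<open>A p\<close>, which contains
  \<open>p\<close> itself if some of them stay, and the kinks on the legs at \<open>p\<close>. These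
  sets are nonempty, disjoint and contained in the new support. As the support has not grown, each
  is a single point; so if one chip of \<open>p\<close> moves, all of them move to the same
  kink.\<close>

lemma std_single_leg:
  assumes h: "std h x b m" and le: "\<And>p. p \<in> P \<Longrightarrow> int (\<Sum>i<val p. m p i) \<le> D p"
    and card: "card (supp (add_div D h)) \<le> card P" and fs: "finite (supp (add_div D h))"
    and p: "p \<in> P" "i < val p" "m p i > 0"
  shows "int (m p i) = D p \<and> (\<forall>j<val p. j \<noteq> i \<longrightarrow> m p j = 0)"
proof -
  let ?z = "\<lambda>p i. leg p i (height x b m p i)"
  define A where "A p = {q. (q = p \<and> int (\<Sum>i<val p. m p i) < D p) \<or> (\<exists>i<val p. m p i > 0 \<and> q = ?z p i)}" for p
  have A_supp: "A p \<subseteq> supp (add_div D h)" if p: "p \<in> P" for p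
    using add_div_std_leg[OF h p] principal_divisor_std_supp[OF h p]
    by (auto simp: A_def supp_def add_div_def)
  have A_ball: "dist p q < \<rho>" if "p \<in> P" "q \<in> A p" for p q
    using that std_hgt[OF h that(1)] dist_leg[OF that(1)] rho by (fastforce simp: A_def)
  have finA: "finite (A p)" if "p \<in> P" for p
    using A_supp[OF that] fs finite_subset by blast
  have ne: "card (A p) \<ge> 1" if p: "p \<in> P" for p
  proof -
    have "A p \<noteq> {}"
    proof (cases "\<exists>i<val p. m p i > 0")
      case True
      then show ?thesis by (auto simp: A_def)
    next
      case False
      then have "(\<Sum>i<val p. m p i) = 0" by simp
      then show ?thesis using pos[OF p] by (auto simp: A_def)
    qed
    then show ?thesis using finA[OF p] by (simp add: card_gt_0_iff Suc_le_eq)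
  qed
  have disj: "A p \<inter> A q = {}" if "p \<in> P" "q \<in> P" "p \<noteq> q" for p q
  proof (rule ccontr)
    assume "A p \<inter> A q \<noteq> {}"
    then obtain z where "z \<in> A p" "z \<in> A q" by blast
    then show False
      using A_ball[OF that(1)] A_ball[OF that(2)] sep[OF that] dist_triangle2[of p q z] rho by fastforce
  qed
  have "(\<Sum>p\<in>P. card (A p)) = card (\<Union>p\<in>P. A p)"
    using fin finA disj by (subst card_UN_disjoint) auto
  also have "\<dots> \<le> card (supp (add_div D h))"
    using A_supp fs by (intro card_mono) auto
  also have "\<dots> \<le> (\<Sum>p\<in>P. 1)" using card by simp
  finally have sum: "(\<Sum>p\<in>P. card (A p)) \<le> (\<Sum>p\<in>P. 1)" .
  have "card (A p) \<le> 1"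
  proof (rule ccontr)
    assume "\<not> card (A p) \<le> 1"
    then have "\<exists>p\<in>P. 1 < card (A p)" using p(1) by (intro bexI[of _ p]) auto
    then have "(\<Sum>p\<in>P. 1) < (\<Sum>p\<in>P. card (A p))"
      using ne by (intro sum_strict_mono_ex1 fin) auto
    then show False using sum by simp
  qed
  moreover have z: "?z p i \<in> A p" using p by (auto simp: A_def)
  ultimately have single: "q = ?z p i" if "q \<in> A p" for q
    using that finA[OF p(1)] card_le_Suc0_iff_eq[of "A p"] by auto
  have others: "m p j = 0" if j: "j < val p" "j \<noteq> i" for j
  proof (rule ccontr)
    assume m: "m p j \<noteq> 0"
    then have "?z p j = ?z p i" using single j by (auto simp: A_def)
    then show False
      using leg_inj(2)[OF p(1) j(1), of "height x b m p j" p i "height x b m p i"] p j m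
        std_hgt[OF h p] std_hgt[OF h p(1) j(1)] rho by auto
  qed
  have "p \<notin> A p"
    using single[of p] std_hgt_notin[OF h p] p(1) by auto
  then have "D p \<le> int (\<Sum>i<val p. m p i)" by (auto simp: A_def)
  moreover have "(\<Sum>j<val p. m p j) = (\<Sum>j<val p. if j = i then m p i else 0)"
    using others by (intro sum.cong) auto
  ultimately show ?thesis using le[OF p(1)] others p(2) by simp
qed

lemma valence_leg: "p \<in> P \<Longrightarrow> i < val p \<Longrightarrow> 0 < s \<Longrightarrow> s \<le> \<rho> \<Longrightarrow> valence (leg p i s) = 2"
  using valence_star[OF star_leg_point[OF leg, of p i "s / 2" s]] by auto

text \<open>Chips that move land inside a leg, at a point of valence 2. Hence the valence 1 degree
  gains nothing, and it would lose the chips that leave a point \<open>p\<close> of valence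
  1.\<close>

lemma std_val_ge2:
  assumes h: "std h x b m" and le: "valence1_degree D \<le> valence1_degree (add_div D h)"
    and p: "p \<in> P" "i < val p" "m p i > 0"
  shows "val p \<ge> 2"
proof (rule ccontr)
  assume "\<not> val p \<ge> 2"
  then have v1: "val p = 1" using val_pos[OF p(1)] by simp
  let ?V = "{q \<in> P. valence q = 1}"
  have "{q \<in> supp (add_div D h). valence q = 1} \<subseteq> ?V"
  proof
    fix q assume q: "q \<in> {q \<in> supp (add_div D h). valence q = 1}"
    show "q \<in> ?V"
    proof (rule ccontr)
      assume "q \<notin> ?V"
      then have "q \<notin> P" "add_div D h q \<noteq> 0" using q by (auto simp: supp_def)
      then obtain p i where *: "p \<in> P" "i < val p" "m p i > 0" "q = leg p i (height x b m p i)"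
        by (rule add_div_std_nonzero[OF h])
      then have "valence q = 2" using valence_leg[OF *(1,2)] std_hgt[OF h *(1-3)] by auto
      then show False using q by simp
    qed
  qed
  then have "valence1_degree (add_div D h) = (\<Sum>q\<in>?V. add_div D h q)"
    unfolding valence1_degree_def using fin by (intro sum.mono_neutral_left) (auto simp: supp_def)
  also have "\<dots> = (\<Sum>q\<in>?V. D q - (\<Sum>i<val q. int (m q i)))"
    by (intro sum.cong refl) (simp add: add_div_def principal_divisor_std_supp[OF h])
  also have "\<dots> < (\<Sum>q\<in>?V. D q)"
  proof (rule sum_strict_mono_ex1)
    have "valence p = 1" using valence_star[OF leg[OF p(1)]] v1 by simp
    moreover have "(\<Sum>i<val p. int (m p i)) > 0" using p v1 by simp
    ultimately show "\<exists>q\<in>?V. D q - (\<Sum>i<val q. int (m q i)) < D q" using p(1) by auto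
    show "\<forall>q\<in>?V. D q - (\<Sum>i<val q. int (m q i)) \<le> D q" by (simp add: sum_nonneg)
  qed (use fin in simp)
  finally show False using le by (simp add: valence1_degree_def)
qed

text \<open>Provides the representing tuple that \<open>sym_topology_nearby\<close> asks for: each
  chip moves by the height of its kink, which is less than \<open>\<delta>\<close>.\<close>

lemma std_tuple:
  assumes h: "std h x b m" and le: "\<And>p. p \<in> P \<Longrightarrow> int (\<Sum>i<val p. m p i) \<le> D p"
    and D: "D = tuple_divisor d c" and \<delta>: "\<delta> > 0" "\<And>p i. p \<in> P \<Longrightarrow> i < val p \<Longrightarrow> m p i > 0 \<Longrightarrow> height x b m p i < \<delta>"
  obtains y where "add_div D h = tuple_divisor d y" "\<And>k. k < d \<Longrightarrow> dist (c k) (y k) < \<delta>"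
proof -
  obtain y where y: "\<And>k. k < d \<Longrightarrow> y k = c k \<or> (\<exists>i<val (c k). m (c k) i > 0 \<and> y k = leg (c k) i (height x b m (c k) i))"
    "\<And>q. tuple_divisor d y q = D q + (\<Sum>p\<in>P. \<Sum>i<val p. int (m p i) * (of_bool (leg p i (height x b m p i) = q) - of_bool (p = q)))"
    using move_chips[OF D le, where z = "\<lambda>p i. leg p i (height x b m p i)"] by blast
  have "add_div D h = tuple_divisor d y"
    by (rule ext) (simp add: add_div_def y(2) principal_divisor_std[OF h])
  moreover have "dist (c k) (y k) < \<delta>" if k: "k < d" for k
  proof (cases "y k = c k")
    case False
    then obtain i where i: "i < val (c k)" "m (c k) i > 0" "y k = leg (c k) i (height x b m (c k) i)"
      using y(1)[OF k] by blast
    have c: "c k \<in> P" using k D supp_tuple_divisor by (metis imageI lessThan_iff)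
    show ?thesis
      using dist_leg[OF c i(1), of "height x b m (c k) i"] std_hgt[OF h c i(1,2)] \<delta>(2)[OF c i(1,2)] rho i(3) by simp
  qed (use \<delta> in simp)
  ultimately show ?thesis by (rule that)
qed

text \<open>The germ of function determined by its values on the components: in the situation of
  the theorem at most one leg at \<open>p\<close> has a value above \<open>base x p\<close>.\<close>

definition base :: "('a set \<Rightarrow> real) \<Rightarrow> 'a \<Rightarrow> real" where
  "base x p = Min ((\<lambda>i. x (out p i)) ` {..<val p})"

definition near :: "'a \<Rightarrow> 'a" where
  "near q = (SOME p. p \<in> P \<and> dist p q < \<rho>)"

text \<open>From a chip \<open>p\<close> the function climbs with slope \<open>D p\<close>, the only
  positive slope that nondegeneracy permits, so no slopes enter as data. It is defined for every
  vector \<open>x\<close>, admissible or not, which lets it commute with minima and shifts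
  unconditionally.\<close>

definition Phi :: "('a set \<Rightarrow> real) \<Rightarrow> 'a \<Rightarrow> real" where
  "Phi x q = (if q \<in> P then base x q
     else if \<exists>p\<in>P. dist p q < \<rho> then min (x (cmp q)) (base x (near q) + of_int (D (near q)) * dist (near q) q)
     else x (cmp q))"

section \<open>Tropical linearity of the chart map\<close>

lemma base_le: "p \<in> P \<Longrightarrow> i < val p \<Longrightarrow> base x p \<le> x (out p i)"
  by (simp add: base_def)

lemma base_attained:
  assumes "p \<in> P"
  obtains i where "i < val p" "base x p = x (out p i)"
proof -
  have "base x p \<in> (\<lambda>i. x (out p i)) ` {..<val p}"
    unfolding base_def using val_pos[OF assms] by (intro Min_in) auto
  then show ?thesis using that by auto
qed

lemma base_eqI:
  assumes "p \<in> P" "\<And>i. i < val p \<Longrightarrow> c \<le> x (out p i)" "j < val p" "x (out p j) = c"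
  shows "base x p = c"
proof (rule antisym)
  show "base x p \<le> c" using base_le[OF assms(1,3), of x] assms(4) by simp
  obtain i where "i < val p" "base x p = x (out p i)" by (rule base_attained[OF assms(1)])
  then show "c \<le> base x p" using assms(2) by simp
qed

lemma base_min: "p \<in> P \<Longrightarrow> base (\<lambda>S. min (x S) (y S)) p = min (base x p) (base y p)"
proof (rule antisym)
  assume p: "p \<in> P"
  obtain i where i: "i < val p" "base x p = x (out p i)" using base_attained[OF p] by blast
  obtain j where j: "j < val p" "base y p = y (out p j)" using base_attained[OF p] by blast
  show "base (\<lambda>S. min (x S) (y S)) p \<le> min (base x p) (base y p)"
    using base_le[OF p i(1), of "\<lambda>S. min (x S) (y S)"] base_le[OF p j(1), of "\<lambda>S. min (x S) (y S)"] i j by simp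
  obtain k where k: "k < val p" "base (\<lambda>S. min (x S) (y S)) p = min (x (out p k)) (y (out p k))"
    using base_attained[OF p] by blast
  show "min (base x p) (base y p) \<le> base (\<lambda>S. min (x S) (y S)) p"
    unfolding k(2) using base_le[OF p k(1)] by (intro min.mono) auto
qed

lemma base_add: "p \<in> P \<Longrightarrow> base (\<lambda>S. x S + c) p = base x p + c"
proof -
  assume p: "p \<in> P"
  obtain i where "i < val p" "base x p = x (out p i)" by (rule base_attained[OF p])
  then show ?thesis using base_le[OF p, of _ x] by (intro base_eqI[OF p, of _ _ i]) auto
qed

lemma near_eq:
  assumes "p \<in> P" "dist p q < \<rho>"
  shows "near q = p"
proof -
  have n: "near q \<in> P \<and> dist (near q) q < \<rho>"
    unfolding near_def using someI[of "\<lambda>p. p \<in> P \<and> dist p q < \<rho>"] assms by blast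
  show ?thesis
  proof (rule ccontr)
    assume "near q \<noteq> p"
    then have "dist (near q) p > 4 * \<rho>" using sep n assms(1) by blast
    then show False using n assms dist_triangle2[of "near q" p q] rho by simp
  qed
qed

lemma Phi_supp: "p \<in> P \<Longrightarrow> Phi x p = base x p"
  by (simp add: Phi_def)

lemma Phi_leg:
  assumes "p \<in> P" "i < val p" "0 \<le> s" "s < \<rho>"
  shows "Phi x (leg p i s) = min (x (out p i)) (base x p + of_int (D p) * s)"
proof (cases "s = 0")
  case True
  then show ?thesis using assms leg_0 base_le Phi_supp by simp
next
  case False
  then have s: "0 < s" "s \<le> 2 * \<rho>" using assms by auto
  have d: "dist p (leg p i s) = s" using dist_leg assms s by simp
  have "near (leg p i s) = p" using near_eq[OF assms(1)] d assms(4) by simp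
  moreover have "\<exists>p'\<in>P. dist p' (leg p i s) < \<rho>" using d assms by (intro bexI[of _ p]) auto
  ultimately show ?thesis
    using d leg_notin[OF assms(1,2) s] cmp_leg[OF assms(1,2) s] by (simp add: Phi_def)
qed

lemma Phi_far: "q \<notin> P \<Longrightarrow> (\<And>p. p \<in> P \<Longrightarrow> \<rho> \<le> dist p q) \<Longrightarrow> Phi x q = x (cmp q)"
  by (force simp: Phi_def)

lemma Phi_eqI:
  assumes far: "\<And>q. q \<notin> P \<Longrightarrow> (\<And>p. p \<in> P \<Longrightarrow> \<rho> \<le> dist p q) \<Longrightarrow> h q = x (cmp q)"
    and leg': "\<And>p i s. p \<in> P \<Longrightarrow> i < val p \<Longrightarrow> 0 \<le> s \<Longrightarrow> s < \<rho> \<Longrightarrow>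
      h (leg p i s) = min (x (out p i)) (base x p + of_int (D p) * s)"
  shows "h = Phi x"
proof
  fix q
  show "h q = Phi x q"
  proof (cases "\<exists>p\<in>P. dist p q < \<rho>")
    case True
    then obtain p where p: "p \<in> P" "dist p q < \<rho>" by blast
    then obtain i where "i < val p" "q = leg p i (dist p q)"
      using star_cover[OF leg[OF p(1)], of q] rho by auto
    then show ?thesis using leg'[OF p(1), of i "dist p q"] Phi_leg[OF p(1), of i "dist p q" x] p(2) by simp
  next
    case False
    then have "q \<notin> P" using rho by force
    then show ?thesis using far[of q] Phi_far[of q x] False by (simp add: not_less)
  qed
qed

lemma Phi_min: "Phi (\<lambda>S. min (x S) (y S)) = (\<lambda>q. min (Phi x q) (Phi y q))"
proof (rule Phi_eqI[symmetric])
  fix p i s assume p: "p \<in> P" "i < val p" "0 \<le> (s::real)" "s < \<rho>"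
  show "min (Phi x (leg p i s)) (Phi y (leg p i s)) =
    min (min (x (out p i)) (y (out p i))) (base (\<lambda>S. min (x S) (y S)) p + of_int (D p) * s)"
    unfolding Phi_leg[OF p] base_min[OF p(1)] min_add_distrib_left by (simp add: ac_simps)
qed (simp add: Phi_far)

lemma Phi_add: "Phi (\<lambda>S. x S + c) = (\<lambda>q. Phi x q + c)"
proof (rule Phi_eqI[symmetric])
  fix p i s assume p: "p \<in> P" "i < val p" "0 \<le> (s::real)" "s < \<rho>"
  show "Phi x (leg p i s) + c = min (x (out p i) + c) (base (\<lambda>S. x S + c) p + of_int (D p) * s)"
    unfolding Phi_leg[OF p] base_add[OF p(1)] min_add_distrib_left by simp
qed (simp add: Phi_far)

lemma Phi_const: "Phi (\<lambda>S. c) = (\<lambda>q. c)"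
proof (rule Phi_eqI[symmetric])
  fix p i s assume p: "p \<in> P" "i < val p" "0 \<le> (s::real)" "s < \<rho>"
  have "base (\<lambda>S. c) p = c" using base_attained[OF p(1), of "\<lambda>S. c"] by auto
  then show "c = min c (base (\<lambda>S. c) p + of_int (D p) * s)"
    using p(3) pos[OF p(1)] by simp
qed simp

lemma Phi_cong:
  assumes "\<And>S. S \<in> E \<Longrightarrow> x S = y S"
  shows "Phi x = Phi y"
proof (rule Phi_eqI)
  show "Phi x q = y (cmp q)" if "q \<notin> P" "\<And>p. p \<in> P \<Longrightarrow> \<rho> \<le> dist p q" for q
    using Phi_far[OF that] assms[OF cmp_mem(2)[OF that(1)]] by simp
  fix p i s assume p: "p \<in> P" "i < val p" "0 \<le> (s::real)" "s < \<rho>"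
  have "base x p = base y p"
    unfolding base_def using assms out_in_E[OF p(1)] by (intro arg_cong[where f = Min] image_cong) auto
  then show "Phi x (leg p i s) = min (y (out p i)) (base y p + of_int (D p) * s)"
    using Phi_leg[OF p] assms[OF out_in_E[OF p(1,2)]] by simp
qed

text \<open>Read off from \<open>Phi_min\<close> and \<open>Phi_const\<close>: capping the values at
  \<open>c\<close> changes nothing, and capping them at \<open>a\<close> produces the constant
  \<open>a\<close>. Values outside \<open>E\<close> are first replaced by \<open>a\<close>, which
  \<open>Phi_cong\<close> allows.\<close>

lemma Phi_bounds:
  assumes "\<And>S. S \<in> E \<Longrightarrow> a \<le> x S" "\<And>S. S \<in> E \<Longrightarrow> x S \<le> c"
  shows "a \<le> Phi x q" "Phi x q \<le> c"
proof -
  define y where "y S = (if S \<in> E then x S else a)" for S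
  have "Phi x = Phi y" by (rule Phi_cong) (simp add: y_def)
  moreover have "Phi (\<lambda>S. max a (y S)) = Phi y"
    using assms by (intro Phi_cong) (auto simp: y_def)
  moreover have "(\<lambda>q. min (Phi y q) c) = Phi y"
    using Phi_min[of y "\<lambda>S. c"] Phi_const[of c] Phi_cong[of "\<lambda>S. min (y S) c" y] assms(2) by (simp add: y_def)
  moreover have "(\<lambda>q. min (Phi y q) a) = (\<lambda>q. a)"
    using Phi_min[of y "\<lambda>S. a"] Phi_const[of a] Phi_cong[of "\<lambda>S. min (y S) a" "\<lambda>S. a"] assms(1)
    by (simp add: y_def)
  ultimately show "a \<le> Phi x q" "Phi x q \<le> c" by (metis min.cobounded1 min.cobounded2)+
qed

end

section \<open>Flats of a nondegenerate series\<close>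

lemma diag_class_eq_iff: "diag_class A u = diag_class A v \<longleftrightarrow> (\<exists>c. \<forall>S\<in>A. u S = v S + c)"
proof
  assume eq: "diag_class A u = diag_class A v"
  have "restrict u A \<in> diag_class A u" by (auto simp: diag_class_def intro!: exI[of _ 0])
  then have "restrict u A \<in> diag_class A v" using eq by simp
  then show "\<exists>c. \<forall>S\<in>A. u S = v S + c" by (auto simp: diag_class_def)
next
  assume "\<exists>c. \<forall>S\<in>A. u S = v S + c"
  then obtain c where c: "\<And>S. S \<in> A \<Longrightarrow> u S = v S + c" by blast
  have "(\<exists>k. \<forall>S\<in>A. w S = u S + k) \<longleftrightarrow> (\<exists>k. \<forall>S\<in>A. w S = v S + k)" for w
  proof
    assume "\<exists>k. \<forall>S\<in>A. w S = u S + k"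
    then obtain k where "\<forall>S\<in>A. w S = u S + k" ..
    then have "\<forall>S\<in>A. w S = v S + (c + k)" using c by simp
    then show "\<exists>k. \<forall>S\<in>A. w S = v S + k" ..
  next
    assume "\<exists>k. \<forall>S\<in>A. w S = v S + k"
    then obtain k where "\<forall>S\<in>A. w S = v S + k" ..
    then have "\<forall>S\<in>A. w S = u S + (k - c)" using c by simp
    then show "\<exists>k. \<forall>S\<in>A. w S = u S + k" ..
  qed
  then show "diag_class A u = diag_class A v" by (simp add: diag_class_def)
qed

text \<open>Pigeonhole: the values of \<open>x\<close> on \<open>A\<close> cannot meet all of the
  \<open>card A + 1\<close> intervals of length \<open>\<delta>\<close> that start at multiples of
  \<open>\<delta>\<close> from 0 to \<open>card A\<close>.\<close>

lemma ex_gap: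
  fixes x :: "'s \<Rightarrow> real"
  assumes "finite A" "0 < \<delta>"
  obtains j :: nat where "j \<le> card A" "\<And>S. S \<in> A \<Longrightarrow> x S < real (j + 1) * \<delta> \<Longrightarrow> x S < real j * \<delta>"
proof -
  have "card ((\<lambda>S. \<lfloor>x S / \<delta>\<rfloor>) ` A) \<le> card A" using assms(1) by (rule card_image_le)
  also have "\<dots> < card (int ` {0..card A})" by (simp add: card_image)
  finally have "\<not> int ` {0..card A} \<subseteq> (\<lambda>S. \<lfloor>x S / \<delta>\<rfloor>) ` A"
    using card_mono[of "(\<lambda>S. \<lfloor>x S / \<delta>\<rfloor>) ` A" "int ` {0..card A}"] assms(1) by auto
  then obtain n where "n \<in> int ` {0..card A}" "n \<notin> (\<lambda>S. \<lfloor>x S / \<delta>\<rfloor>) ` A" by blast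
  then obtain j where j: "j \<le> card A" "int j \<notin> (\<lambda>S. \<lfloor>x S / \<delta>\<rfloor>) ` A" by auto
  have "x S < real j * \<delta>" if S: "S \<in> A" "x S < real (j + 1) * \<delta>" for S
  proof (rule ccontr)
    assume "\<not> x S < real j * \<delta>"
    then have "real j \<le> x S / \<delta>" "x S / \<delta> < real j + 1"
      using S(2) assms(2) by (auto simp: pos_le_divide_eq pos_divide_less_eq add.commute)
    then have "\<lfloor>x S / \<delta>\<rfloor> = int j" by (intro floor_unique) auto
    then show False using j(2) S(1) by force
  qed
  then show ?thesis using that j(1) by blast
qed

locale nondegenerate_series = chip_stars +
  fixes \<Sigma> :: "('a \<Rightarrow> real) set" and r :: nat
  assumes tls: "tropical_linear_series D \<Sigma> r" and nd: "nondegenerate D \<Sigma> D"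
begin

abbreviation d :: nat where "d \<equiv> nat (divisor_degree D)"

lemma Sigma_PL: "\<phi> \<in> \<Sigma> \<Longrightarrow> \<phi> \<in> PL"
  and Sigma_eff: "\<phi> \<in> \<Sigma> \<Longrightarrow> 0 \<le> add_div D \<phi> q"
  and Sigma_min: "\<phi> \<in> \<Sigma> \<Longrightarrow> \<psi> \<in> \<Sigma> \<Longrightarrow> (\<lambda>p. min (\<phi> p) (\<psi> p)) \<in> \<Sigma>"
  and Sigma_add: "\<phi> \<in> \<Sigma> \<Longrightarrow> (\<lambda>p. \<phi> p + c) \<in> \<Sigma>"
  using tls unfolding tropical_linear_series_def tropical_submodule_def rational_sections_def effective_def by auto

lemma Sigma_cont: "\<phi> \<in> \<Sigma> \<Longrightarrow> continuous_on UNIV \<phi>"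
  using Sigma_PL by (simp add: PL_def)

lemma divisor_determines:
  assumes "\<phi> \<in> PL" "\<phi>' \<in> PL" "add_div D \<phi> = add_div D \<phi>'"
  obtains c where "\<And>p. \<phi> p = \<phi>' p + c"
proof -
  have "principal_divisor \<phi> = principal_divisor \<phi>'"
    using assms(3) by (simp add: add_div_def fun_eq_iff)
  then show ?thesis using principal_divisor_inj[OF cpt con stars assms(1,2)] that by blast
qed

lemma add_div_const: "add_div D (\<lambda>_. c) = D"
proof
  fix q :: 'a
  obtain n \<sigma> \<psi> where "star q n \<sigma> \<psi>" using stars by blast
  then have "principal_divisor (\<lambda>_. c) q = 0" by (rule principal_divisor_locally_const[of _ _ _ _ 1]) auto
  then show "add_div D (\<lambda>_. c) q = D q" by (simp add: add_div_def)
qed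

text \<open>As \<open>D\<close> belongs to the linear system, some function in
  \<open>\<Sigma>\<close> has divisor 0, and such a function is constant. Constants are what
  truncation needs.\<close>

lemma Sigma_const: "(\<lambda>_. c) \<in> \<Sigma>"
proof -
  obtain \<phi> where p: "\<phi> \<in> \<Sigma>" "D = add_div D \<phi>"
    using nd by (auto simp: nondegenerate_def linear_system_def Let_def)
  then obtain k where k: "\<And>q. \<phi> q = c + k"
    using divisor_determines[OF Sigma_PL[OF p(1)] const_PL, of c] add_div_const by metis
  then have "(\<lambda>q. \<phi> q + - k) = (\<lambda>_. c)" by simp
  then show ?thesis using Sigma_add[OF p(1), of "- k"] by simp
qed

lemma minimum:
  assumes "\<phi> \<in> \<Sigma>"
  obtains z where "z \<in> argmin_set \<phi>"
  using continuous_attains_inf[OF cpt _ Sigma_cont[OF assms]] by (auto simp: argmin_set_def)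

text \<open>Outgoing slopes at a minimum are nonnegative, and effectiveness bounds their sum by the
  number of chips of \<open>D\<close> at the point. Off the support of \<open>D\<close> they must
  therefore vanish.\<close>

lemma argmin_slopes:
  assumes g: "g \<in> \<Sigma>" and q: "q \<in> argmin_set g" and st: "star q n \<tau> \<psi>"
  obtains \<sigma> and m :: "nat \<Rightarrow> nat" where "0 < \<sigma>" "\<sigma> \<le> \<tau>"
    "\<And>i t. i < n \<Longrightarrow> 0 \<le> t \<Longrightarrow> t \<le> \<sigma> \<Longrightarrow> g (\<psi> i t) = g q + real (m i) * t"
    "int (\<Sum>i<n. m i) \<le> D q"
proof -
  obtain \<sigma> and k :: "nat \<Rightarrow> int" where s: "0 < \<sigma>" "\<sigma> \<le> \<tau>"
    "\<And>i t. i < n \<Longrightarrow> t \<in> {0..\<sigma>} \<Longrightarrow> g (\<psi> i t) = g q + of_int (k i) * t"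
    using PL_star[OF Sigma_PL[OF g] st] by blast
  have mn: "\<And>z. g q \<le> g z" using q by (simp add: argmin_set_def)
  have nn: "k i \<ge> 0" if "i < n" for i
    by (rule slope_nonneg_at_min[OF s(1) s(3)[OF that] mn])
  have "principal_divisor g q = - (\<Sum>i<n. k i)"
    using s by (intro principal_divisor_star[OF st]) blast
  then have "(\<Sum>i<n. k i) \<le> D q" using Sigma_eff[OF g, of q] by (simp add: add_div_def)
  moreover have "(\<Sum>i<n. k i) = int (\<Sum>i<n. nat (k i))" using nn by simp
  ultimately have "int (\<Sum>i<n. nat (k i)) \<le> D q" by simp
  moreover have "g (\<psi> i t) = g q + real (nat (k i)) * t" if "i < n" "0 \<le> t" "t \<le> \<sigma>" for i t
    using s(3)[of i t] nn[of i] that by simp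
  ultimately show ?thesis using that[of \<sigma> "\<lambda>i. nat (k i)"] s(1,2) by blast
qed

lemma argmin_open:
  assumes g: "g \<in> \<Sigma>" and q: "q \<in> argmin_set g" "q \<notin> P"
  obtains \<eta> where "\<eta> > 0" "ball q \<eta> \<subseteq> argmin_set g"
proof -
  obtain n \<tau> \<psi> where st: "star q n \<tau> \<psi>" using stars by blast
  obtain \<sigma> and m :: "nat \<Rightarrow> nat" where s: "0 < \<sigma>" "\<sigma> \<le> \<tau>"
    "\<And>i t. i < n \<Longrightarrow> 0 \<le> t \<Longrightarrow> t \<le> \<sigma> \<Longrightarrow> g (\<psi> i t) = g q + real (m i) * t"
    "int (\<Sum>i<n. m i) \<le> D q"
    using argmin_slopes[OF g q(1) st] by blast
  have "D q = 0" using q(2) by (simp add: supp_def)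
  then have "(\<Sum>i<n. m i) = 0" using s(4) by (metis of_nat_le_0_iff le_zero_eq)
  then have m0: "m i = 0" if "i < n" for i using that by simp
  have "ball q \<sigma> \<subseteq> argmin_set g"
  proof
    fix z assume "z \<in> ball q \<sigma>"
    then have d: "dist q z < \<sigma>" by simp
    then obtain i where "i < n" "z = \<psi> i (dist q z)"
      using star_cover[OF st, of z] s(2) by auto
    then have "g z = g q" using s(3)[of i "dist q z"] m0 d by simp
    then show "z \<in> argmin_set g" using q(1) by (simp add: argmin_set_def)
  qed
  then show ?thesis using that s(1) by blast
qed

lemma argmin_open_diff:
  assumes g: "g \<in> \<Sigma>"
  shows "open (argmin_set g - P)"
  unfolding open_contains_ball
proof
  fix q assume q: "q \<in> argmin_set g - P"
  then obtain \<eta> where h: "\<eta> > 0" "ball q \<eta> \<subseteq> argmin_set g" using argmin_open[OF g] by blast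
  have "open (- P)" using fin by (simp add: finite_imp_closed open_Compl)
  then obtain e where e: "e > 0" "ball q e \<subseteq> - P"
    using q open_contains_ball by (metis ComplI DiffD2)
  have "ball q (min \<eta> e) \<subseteq> argmin_set g - P" using h(2) e(2) by (auto simp: subset_iff)
  then show "\<exists>e>0. ball q e \<subseteq> argmin_set g - P" using h(1) e(1) by (intro exI[of _ "min \<eta> e"]) auto
qed

lemma argmin_closed: "g \<in> \<Sigma> \<Longrightarrow> closed (argmin_set g)"
proof -
  assume g: "g \<in> \<Sigma>"
  obtain z where z: "z \<in> argmin_set g" using minimum[OF g] by blast
  then have "argmin_set g = {q. g q \<le> g z}" by (auto simp: argmin_set_def intro: order_trans)
  moreover have "closed {q. g q \<le> g z}"
    using Sigma_cont[OF g] by (intro closed_Collect_le) (auto intro: continuous_intros)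
  ultimately show ?thesis by simp
qed

text \<open>Off the support of \<open>D\<close> the minimum set is both open and closed, and
  components are connected. Thus a component outside the minimum set misses it altogether.\<close>

lemma argmin_dichotomy:
  assumes g: "g \<in> \<Sigma>" and S: "S \<in> E"
  shows "S \<subseteq> argmin_set g \<or> S \<inter> argmin_set g = {}"
proof -
  let ?Z = "argmin_set g"
  have "open (?Z - P)" by (rule argmin_open_diff[OF g])
  moreover have "open (- ?Z)" using argmin_closed[OF g] by (simp add: open_Compl)
  moreover have "S \<inter> P = {}" using in_components_subset[OF S] by auto
  ultimately have "(?Z - P) \<inter> S = {} \<or> - ?Z \<inter> S = {}"
    using in_components_connected[OF S] by (intro connectedD) auto
  then show ?thesis using \<open>S \<inter> P = {}\<close> by auto
qed

lemma flat_of_iff: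
  assumes "g \<in> \<Sigma>" "S \<in> E"
  shows "S \<in> flat_of E g \<longleftrightarrow> S \<inter> argmin_set g = {}"
  using argmin_dichotomy[OF assms] in_components_nonempty[OF assms(2)] assms(2)
  unfolding flat_of_def by auto

section \<open>Truncation just above the minimum\<close>

definition low :: "('a \<Rightarrow> real) \<Rightarrow> real" where "low g = (INF q. g q)"

lemma low_eq: "q \<in> argmin_set g \<Longrightarrow> low g = g q"
  unfolding low_def argmin_set_def by (intro cInf_eq_minimum) auto

lemma low_le: "g \<in> \<Sigma> \<Longrightarrow> low g \<le> g q"
  using minimum[of g] low_eq by (metis argmin_set_def mem_Collect_eq)

lemma in_argmin_iff:
  assumes "g \<in> \<Sigma>"
  shows "q \<in> argmin_set g \<longleftrightarrow> g q = low g"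
  using low_eq[of q g] low_le[OF assms] by (auto simp: argmin_set_def)

lemma low_less: "g \<in> \<Sigma> \<Longrightarrow> q \<notin> argmin_set g \<Longrightarrow> low g < g q"
  using in_argmin_iff low_le by (metis order_le_less)

definition trunc :: "('a \<Rightarrow> real) \<Rightarrow> real \<Rightarrow> 'a \<Rightarrow> real" where
  "trunc g t q = min (g q - low g) t"

lemma trunc_in: "g \<in> \<Sigma> \<Longrightarrow> trunc g t \<in> \<Sigma>"
  using Sigma_min[OF Sigma_add[of g "- low g"] Sigma_const[of t]] unfolding trunc_def[abs_def] by simp

text \<open>One slope function \<open>m\<close> serves every level \<open>t\<close> up to
  \<open>t0\<close>, since lowering the level only ends the climb earlier. This leaves the
  nondegeneracy argument free to take \<open>t\<close> as small as it needs.\<close>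

definition trunc_data :: "('a \<Rightarrow> real) \<Rightarrow> real \<Rightarrow> ('a \<Rightarrow> nat \<Rightarrow> nat) \<Rightarrow> bool" where
  "trunc_data g t0 m \<longleftrightarrow> 0 < t0 \<and> t0 < \<rho> \<and> (\<forall>p\<in>P. int (\<Sum>i<val p. m p i) \<le> D p) \<and>
     (\<forall>p\<in>P. \<forall>i<val p. if p \<in> argmin_set g then m p i > 0 \<longleftrightarrow> out p i \<in> flat_of E g
        else m p i = 0 \<and> out p i \<in> flat_of E g) \<and>
     (\<forall>t. 0 < t \<longrightarrow> t \<le> t0 \<longrightarrow>
       std (trunc g t) (\<lambda>S. if S \<in> flat_of E g then t else 0) (\<lambda>p. if p \<in> argmin_set g then 0 else t) m)"

lemma trunc_dataD:
  assumes "trunc_data g t0 m"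
  shows "0 < t0" "t0 < \<rho>"
    "\<And>p. p \<in> P \<Longrightarrow> int (\<Sum>i<val p. m p i) \<le> D p"
    "\<And>p i. p \<in> P \<Longrightarrow> p \<in> argmin_set g \<Longrightarrow> i < val p \<Longrightarrow> m p i > 0 \<longleftrightarrow> out p i \<in> flat_of E g"
    "\<And>p i. p \<in> P \<Longrightarrow> p \<notin> argmin_set g \<Longrightarrow> i < val p \<Longrightarrow> m p i = 0 \<and> out p i \<in> flat_of E g"
    "\<And>t. 0 < t \<Longrightarrow> t \<le> t0 \<Longrightarrow>
       std (trunc g t) (\<lambda>S. if S \<in> flat_of E g then t else 0) (\<lambda>p. if p \<in> argmin_set g then 0 else t) m"
  using assms unfolding trunc_data_def by metis+

text \<open>On short legs at chips of the minimum set, \<open>g\<close> is linear with nonnegative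
  integer slopes; away from these legs and from the minimum set, compactness keeps \<open>g\<close>
  above its minimum by a fixed amount. At a level below both this amount and the length of the
  linear pieces, only the linear climbs and constants survive.\<close>

lemma trunc_std:
  assumes g: "g \<in> \<Sigma>"
  shows "\<exists>t0 m. trunc_data g t0 m"
proof -
  let ?Z = "argmin_set g" and ?F = "flat_of E g"
  have "\<exists>\<sigma> m. 0 < \<sigma> \<and> \<sigma> \<le> 2 * \<rho> \<and> (\<forall>i<val p. \<forall>t. 0 \<le> t \<longrightarrow> t \<le> \<sigma> \<longrightarrow> g (leg p i t) = g p + real (m i) * t) \<and>
      int (\<Sum>i<val p. m i) \<le> D p" if "p \<in> P \<inter> ?Z" for p
    using argmin_slopes[OF g, of p "val p" "2 * \<rho>" "leg p"] leg that by (metis IntD1 IntD2)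
  then obtain \<sigma> k where k: "\<And>p. p \<in> P \<inter> ?Z \<Longrightarrow> 0 < \<sigma> p" "\<And>p. p \<in> P \<inter> ?Z \<Longrightarrow> \<sigma> p \<le> 2 * \<rho>"
    "\<And>p i t. p \<in> P \<inter> ?Z \<Longrightarrow> i < val p \<Longrightarrow> 0 \<le> t \<Longrightarrow> t \<le> \<sigma> p \<Longrightarrow> g (leg p i t) = g p + real (k p i) * t"
    "\<And>p. p \<in> P \<inter> ?Z \<Longrightarrow> int (\<Sum>i<val p. k p i) \<le> D p"
    by metis
  define m where "m p i = (if p \<in> ?Z then k p i else 0)" for p i
  define s where "s = Min (insert (\<rho> / 2) (\<sigma> ` (P \<inter> ?Z)))"
  have s: "0 < s" "s \<le> \<rho> / 2" "\<And>p. p \<in> P \<inter> ?Z \<Longrightarrow> s \<le> \<sigma> p"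
  proof -
    show "0 < s" using fin k(1) rho by (auto simp: s_def)
    show "s \<le> \<rho> / 2" unfolding s_def using fin by (intro Min_le) auto
    show "s \<le> \<sigma> p" if "p \<in> P \<inter> ?Z" for p unfolding s_def using fin that by (intro Min_le) auto
  qed
  have near: "g (leg p i t) = low g + real (m p i) * t" if "p \<in> P" "p \<in> ?Z" "i < val p" "0 \<le> t" "t \<le> s" for p i t
    using k(3)[of p i t] s(3)[of p] that low_eq[of p g] by (simp add: m_def)
  have flat: "m p i > 0 \<longleftrightarrow> out p i \<in> ?F" if p: "p \<in> P" "p \<in> ?Z" "i < val p" for p i
  proof -
    have q: "leg p i s \<in> out p i" using leg_in_out[OF p(1,3), of s] s rho by auto
    have "g (leg p i s) = low g + real (m p i) * s" using near[OF p, of s] s by simp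
    then have "leg p i s \<in> ?Z \<longleftrightarrow> m p i = 0"
      using s(1) by (simp add: in_argmin_iff[OF g])
    then show ?thesis
      using argmin_dichotomy[OF g out_in_E[OF p(1,3)]] flat_of_iff[OF g out_in_E[OF p(1,3)]] q by auto
  qed
  have flat': "out p i \<in> ?F" if p: "p \<in> P" "p \<notin> ?Z" "i < val p" for p i
  proof -
    have "open (- ?Z)" using argmin_closed[OF g] by (simp add: open_Compl)
    then obtain e where e: "e > 0" "ball p e \<subseteq> - ?Z" using p(2) open_contains_ball by (metis ComplI)
    let ?t = "min (e / 2) \<rho>"
    have t: "0 < ?t" "?t \<le> 2 * \<rho>" "?t < e" using e rho by auto
    then have "leg p i ?t \<in> ball p e" using dist_leg[OF p(1,3), of ?t] by simp
    then have "leg p i ?t \<notin> ?Z" using e by blast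
    then show ?thesis
      using argmin_dichotomy[OF g out_in_E[OF p(1,3)]] flat_of_iff[OF g out_in_E[OF p(1,3)]]
        leg_in_out[OF p(1,3) t(1,2)] by auto
  qed
  \<comment> \<open>The complement of an open set, hence compact. The chips in the minimum set are
    covered by the balls removed, so \<open>g\<close> exceeds its minimum on all of
    \<open>?K\<close>.\<close>
  let ?K = "UNIV - (?Z - P) - (\<Union>p\<in>P \<inter> ?Z. ball p s)"
  have "\<exists>t>0. \<forall>q\<in>?K. t \<le> g q - low g"
  proof (cases "?K = {}")
    case True
    then show ?thesis by (metis empty_iff zero_less_one)
  next
    case False
    have "open (?Z - P)" by (rule argmin_open_diff[OF g])
    then have "closed ?K" by (intro closed_Diff closed_UNIV open_UN) auto
    then have "compact ?K" using cpt by (metis Int_UNIV_left closed_Int_compact inf_commute)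
    then obtain z where z: "z \<in> ?K" "\<And>q. q \<in> ?K \<Longrightarrow> g z \<le> g q"
      using continuous_attains_inf[of ?K g] False continuous_on_subset[OF Sigma_cont[OF g]] by (metis subset_UNIV)
    have "z \<notin> ?Z"
    proof
      assume "z \<in> ?Z"
      then have "z \<in> P \<inter> ?Z" using z(1) by blast
      then have "z \<in> (\<Union>p\<in>P \<inter> ?Z. ball p s)" using s(1) by (intro UN_I[of z]) auto
      then show False using z(1) by blast
    qed
    then have "low g < g z" by (rule low_less[OF g])
    then show ?thesis using z(2) by (intro exI[of _ "g z - low g"]) auto
  qed
  then obtain t1 where t1: "t1 > 0" "\<And>q. q \<in> ?K \<Longrightarrow> t1 \<le> g q - low g" by blast
  define t0 where "t0 = min t1 s"
  have t0: "0 < t0" "t0 < \<rho>" "t0 \<le> t1" "t0 \<le> s" using t1 s rho by (auto simp: t0_def)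
  have "std (trunc g t) (\<lambda>S. if S \<in> ?F then t else 0) (\<lambda>p. if p \<in> ?Z then 0 else t) m"
    if t: "0 < t" "t \<le> t0" for t
  proof -
    have inZ: "trunc g t q = 0" if "q \<in> ?Z" for q
      using low_eq[OF that] t by (simp add: trunc_def)
    have inK: "trunc g t q = t" if "q \<in> ?K" for q
      using t1(2)[OF that] t t0 by (simp add: trunc_def)
    have far: "trunc g t q = (if S \<in> ?F then t else 0)"
      if q: "q \<in> S" "S \<in> E" "\<And>p. p \<in> P \<Longrightarrow> p \<in> ?Z \<Longrightarrow> s \<le> dist p q" for q S
    proof (cases "S \<in> ?F")
      case True
      then have "q \<in> ?K" using flat_of_iff[OF g q(2)] q by (auto simp: not_less)
      then show ?thesis using inK True by simp
    next
      case False
      then show ?thesis using inZ[of q] q by (auto simp: flat_of_def)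
    qed
    have legs: "trunc g t (leg p i u) = min (if out p i \<in> ?F then t else 0) ((if p \<in> ?Z then 0 else t) + real (m p i) * u)"
      if p: "p \<in> P" "i < val p" "0 \<le> u" "u < \<rho>" for p i u
    proof (cases "p \<in> ?Z \<and> u \<le> s")
      case True
      then show ?thesis
        using near[OF p(1) _ p(2,3)] flat[OF p(1) _ p(2)] t by (auto simp: trunc_def)
    next
      case F: False
      show ?thesis
      proof (cases "u = 0")
        case True
        then have Z: "p \<notin> ?Z" using F s(1) by simp
        then have "p \<in> ?K" using p(1) sep s rho by (force simp: not_less)
        then show ?thesis using inK True leg_0[OF p(1,2)] flat'[OF p(1) Z p(2)] Z by simp
      next
        case False
        have u: "0 < u" "u \<le> 2 * \<rho>" using False p rho by auto
        have "s \<le> dist p' (leg p i u)" if "p' \<in> P" "p' \<in> ?Z" for p'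
          using leg_far[OF p(1-3) u(2) that(1)] dist_leg[OF p(1-3) u(2)] F that(2) s rho by (cases "p' = p") auto
        then have tr: "trunc g t (leg p i u) = (if out p i \<in> ?F then t else 0)"
          using far[OF leg_in_out[OF p(1,2) u] out_in_E[OF p(1,2)]] by blast
        show ?thesis
        proof (cases "p \<in> ?Z")
          case True
          then have "s < u" using F by simp
          show ?thesis
          proof (cases "out p i \<in> ?F")
            case Fl: True
            \<comment> \<open>A positive integer slope over a length of at least \<open>s\<close>
              climbs by at least \<open>s\<close>, and \<open>s\<close> is no smaller than the
              level.\<close>
            then have "1 \<le> real (m p i)" using flat[OF p(1) True p(2)] by simp
            then have "1 * s \<le> real (m p i) * u" using \<open>s < u\<close> s(1) by (intro mult_mono) auto
            then show ?thesis using tr Fl t t0 True by simp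
          qed (use tr u True in auto)
        next
          case False
          then show ?thesis using tr flat'[OF p(1) False p(2)] u by simp
        qed
      qed
    qed
    show ?thesis
      unfolding std_def
    proof (intro conjI allI impI ballI)
      fix q assume q: "q \<notin> P" "\<forall>p\<in>P. \<rho> \<le> dist p q"
      then show "trunc g t q = (if cmp q \<in> ?F then t else 0)"
        using far[OF cmp_mem[OF q(1)]] s(2) rho by force
    next
      fix p i assume p: "p \<in> P" "i < val p" "0 < m p i"
      then have Z: "p \<in> ?Z" by (auto simp: m_def split: if_splits)
      have "t < \<rho>" using t t0 by simp
      also have "\<rho> \<le> real (m p i) * \<rho>" using p(3) rho by simp
      finally show "(if out p i \<in> ?F then t else 0) < (if p \<in> ?Z then 0 else t) + real (m p i) * \<rho>"
        using Z t by simp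
      show "(if p \<in> ?Z then 0 else t) < (if out p i \<in> ?F then t else 0)"
        using Z flat[OF p(1) Z p(2)] p(3) t by simp
    next
      fix p i assume p: "p \<in> P" "i < val p"
      show "(if p \<in> ?Z then 0 else t) \<le> (if out p i \<in> ?F then t else 0)"
        using flat'[OF p(1) _ p(2)] t by auto
      show "(if out p i \<in> ?F then t else 0) = (if p \<in> ?Z then 0 else t)" if "m p i = 0"
        using flat'[OF p(1) _ p(2)] flat[OF p(1) _ p(2)] that by auto
    qed (use legs in auto)
  qed
  moreover have "int (\<Sum>i<val p. m p i) \<le> D p" if "p \<in> P" for p
    using k(4)[of p] pos[OF that] that by (cases "p \<in> ?Z") (simp_all add: m_def)
  moreover have "m p i = 0 \<and> out p i \<in> ?F" if "p \<in> P" "p \<notin> ?Z" "i < val p" for p i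
    using flat' that by (simp add: m_def)
  ultimately have "trunc_data g t0 m"
    unfolding trunc_data_def using t0(1,2) flat by presburger
  then show ?thesis by blast
qed

lemma degree_D: "divisor_degree D = int d"
proof -
  have "0 \<le> divisor_degree D"
    unfolding divisor_degree_def using pos by (intro sum_nonneg) (simp add: less_imp_le)
  then show ?thesis by simp
qed

lemma tuple_D:
  obtains c where "D = tuple_divisor d c"
proof -
  have "0 \<le> D p" for p using pos[of p] by (cases "p \<in> P") (auto simp: supp_def)
  then have "effective D" by (simp add: effective_def)
  then show ?thesis
    using effective_imp_tuple_divisor[of D d] degree_D fin that by (auto simp: is_divisor_def)
qed

text \<open>The local extremality of the support size and of the valence 1 degree enters only here.\<close>

lemma trunc_slopes:
  assumes g: "g \<in> \<Sigma>"
    and td: "trunc_data g t0 m"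
    and p: "p \<in> P" "i < val p" "m p i > 0"
  shows "int (m p i) = D p" "\<And>j. j < val p \<Longrightarrow> j \<noteq> i \<Longrightarrow> m p j = 0" "val p \<ge> 2"
proof -
  note m = trunc_dataD[OF td]
  obtain c where c: "D = tuple_divisor d c" by (rule tuple_D)
  let ?X = "subtopology (sym_topology d) (linear_system D \<Sigma>)"
  obtain U where U: "openin ?X U" "D \<in> U" "\<forall>y\<in>U. card (supp y) \<le> card P"
    using nd by (auto simp: nondegenerate_def Let_def local_max_at_def)
  obtain V where V: "openin ?X V" "D \<in> V" "\<forall>y\<in>V. valence1_degree D \<le> valence1_degree y"
    using nd by (auto simp: nondegenerate_def Let_def local_min_at_def)
  have "tuple_divisor d c \<in> U \<inter> V" using U V c by auto
  from sym_topology_nearby[OF openin_Int[OF U(1) V(1)] this]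
  obtain \<delta> where \<delta>: "\<delta> > 0" "\<And>y. (\<And>k. k < d \<Longrightarrow> dist (c k) (y k) < \<delta>) \<Longrightarrow>
      tuple_divisor d y \<in> linear_system D \<Sigma> \<Longrightarrow> tuple_divisor d y \<in> U \<inter> V"
    by blast
  \<comment> \<open>A climb to level \<open>t\<close> with slope at least 1 ends within distance
    \<open>t\<close>, so no chip moves by \<open>\<delta>\<close> or more.\<close>
  define t where "t = min t0 (\<delta> / 2)"
  have t: "0 < t" "t \<le> t0" "t < \<delta>" using m(1) \<delta>(1) by (auto simp: t_def)
  let ?h = "trunc g t"
  let ?x = "\<lambda>S. if S \<in> flat_of E g then t else 0" and ?b = "\<lambda>p. if p \<in> argmin_set g then 0 else t"
  have h: "std ?h ?x ?b m" using m(6) t by blast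
  have hg: "height ?x ?b m p i < \<delta>" if p: "p \<in> P" "i < val p" "m p i > 0" for p i
  proof -
    have "height ?x ?b m p i \<le> t / real (m p i)"
      unfolding height_def using t by (intro divide_right_mono) auto
    also have "\<dots> \<le> t" using p(3) t(1) by (simp add: divide_le_eq)
    finally show ?thesis using t by simp
  qed
  obtain y where y: "add_div D ?h = tuple_divisor d y" "\<And>k. k < d \<Longrightarrow> dist (c k) (y k) < \<delta>"
    using std_tuple[OF h m(3) c \<delta>(1) hg] by blast
  have "tuple_divisor d y \<in> linear_system D \<Sigma>"
    unfolding linear_system_def y(1)[symmetric] using trunc_in[OF g] by blast
  then have "add_div D ?h \<in> U \<inter> V" using \<delta>(2) y by metis
  then have *: "card (supp (add_div D ?h)) \<le> card P" "valence1_degree D \<le> valence1_degree (add_div D ?h)"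
    using U(3) V(3) by auto
  have fs: "finite (supp (add_div D ?h))" using y(1) by (simp add: supp_tuple_divisor)
  show "int (m p i) = D p" "\<And>j. j < val p \<Longrightarrow> j \<noteq> i \<Longrightarrow> m p j = 0"
    using std_single_leg[OF h m(3) *(1) fs p] by auto
  show "val p \<ge> 2" by (rule std_val_ge2[OF h *(2) p])
qed

text \<open>Since leg \<open>k\<close> stays outside the flat, \<open>p\<close> lies in the minimum
  set. The legs that enter the flat are then those of positive slope, and chips leave
  \<open>p\<close> along one leg only.\<close>

lemma flat_single_leg:
  assumes g: "g \<in> \<Sigma>" and p: "p \<in> P" "i < val p" "j < val p" "k < val p" "j \<noteq> i"
    and F: "out p k \<notin> flat_of E g" "out p i \<in> flat_of E g"
  shows "out p j \<notin> flat_of E g"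
proof -
  obtain t0 m where td: "trunc_data g t0 m" using trunc_std[OF g] by blast
  note m = trunc_dataD[OF td]
  have Z: "p \<in> argmin_set g" using m(5)[OF p(1) _ p(4)] F by blast
  then have "m p i > 0" using m(4) p F by blast
  then have "m p j = 0" using trunc_slopes(2)[OF g td p(1,2)] p(3,5) by blast
  then show ?thesis using m(4)[OF p(1) Z p(3)] by simp
qed

text \<open>The data \<open>b\<close> and \<open>m\<close> of the standard form become functions of
  the values on the components: positive slopes equal \<open>D p\<close>, and where the slope is 0
  any slope gives the same function, because the leg already has the base value.\<close>

lemma trunc_Phi:
  assumes g: "g \<in> \<Sigma>"
  obtains t0 where "0 < t0" "\<And>t. 0 \<le> t \<Longrightarrow> t \<le> t0 \<Longrightarrow> trunc g t = Phi (\<lambda>S. if S \<in> flat_of E g then t else 0)"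
proof -
  obtain t0 m where td: "trunc_data g t0 m" using trunc_std[OF g] by blast
  note m = trunc_dataD[OF td]
  note slopes = trunc_slopes[OF g td]
  have pos_t: "trunc g t = Phi (\<lambda>S. if S \<in> flat_of E g then t else 0)" if t: "0 < t" "t \<le> t0" for t
  proof (rule Phi_eqI)
    let ?x = "\<lambda>S. if S \<in> flat_of E g then t else 0"
    note h = m(6)[OF t]
    show "trunc g t q = ?x (cmp q)" if "q \<notin> P" "\<And>p. p \<in> P \<Longrightarrow> \<rho> \<le> dist p q" for q
      using std_far[OF h that] .
    fix p i s assume p: "p \<in> P" "i < val p" "0 \<le> (s::real)" "s < \<rho>"
    have base: "base ?x p = (if p \<in> argmin_set g then 0 else t)"
    proof (cases "p \<in> argmin_set g")
      case False
      then show ?thesis using m(5)[OF p(1) False] t p(2) by (intro base_eqI[OF p(1), of _ _ i]) auto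
    next
      case True
      \<comment> \<open>Some leg remains at the minimum, so the base value is 0: there are at least
        two legs, and only one can climb.\<close>
      have "\<exists>j<val p. out p j \<notin> flat_of E g"
      proof (rule ccontr)
        assume neg: "\<not> ?thesis"
        then have pos: "m p j > 0" if "j < val p" for j using m(4)[OF p(1) True that] that by blast
        have "val p \<ge> 2" by (rule slopes(3)[OF p(1,2) pos[OF p(2)]])
        then show False
          using slopes(2)[OF p(1), of 0 1] pos[of 0] pos[of 1] by auto
      qed
      then obtain j where "j < val p" "out p j \<notin> flat_of E g" by blast
      then show ?thesis using True t by (intro base_eqI[OF p(1), of _ _ j]) auto
    qed
    have eq: "trunc g t (leg p i s) = min (?x (out p i)) (base ?x p + real (m p i) * s)"
      unfolding base using std_leg[OF h p(1,2,3)] p(4) rho by simp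
    show "trunc g t (leg p i s) = min (?x (out p i)) (base ?x p + of_int (D p) * s)"
    proof (cases "m p i > 0")
      case True
      then have "real (m p i) = of_int (D p)" using slopes(1)[OF p(1,2)] by (metis of_int_of_nat_eq)
      then show ?thesis using eq by simp
    next
      case False
      then have "?x (out p i) = base ?x p" unfolding base using std_zero[OF h p(1,2)] by simp
      then show ?thesis using eq p(3) pos[OF p(1)] by simp
    qed
  qed
  have zero: "trunc g 0 = Phi (\<lambda>S. if S \<in> flat_of E g then 0 else 0)"
    using low_le[OF g] by (simp add: Phi_const trunc_def fun_eq_iff)
  have "trunc g t = Phi (\<lambda>S. if S \<in> flat_of E g then t else 0)" if "0 \<le> t" "t \<le> t0" for t
  proof (cases "t = 0")
    case True
    show ?thesis unfolding True by (rule zero)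
  next
    case False
    then show ?thesis using that by (intro pos_t) auto
  qed
  then show ?thesis by (rule that[OF m(1)])
qed

section \<open>Flats and admissible vectors\<close>

definition flats :: "'a set set set" where "flats = flat_of E ` \<Sigma>"

lemma flats_sub: "F \<in> flats \<Longrightarrow> F \<subseteq> E"
  by (auto simp: flats_def flat_of_def)

text \<open>A minimum set that misses all components consists of chips of \<open>D\<close>. At such
  a chip every leg would climb, against the fact that only one of at least two legs can.\<close>

lemma flats_proper: "E \<notin> flats"
proof
  assume "E \<in> flats"
  then obtain g where g: "g \<in> \<Sigma>" "flat_of E g = E" by (auto simp: flats_def)
  obtain t0 m where td: "trunc_data g t0 m" using trunc_std[OF g(1)] by blast
  note m = trunc_dataD[OF td]
  obtain z where z: "z \<in> argmin_set g" using minimum[OF g(1)] by blast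
  have "z \<in> P"
    using cmp_mem[of z] flat_of_iff[OF g(1), of "cmp z"] g(2) z by blast
  then have "m z j > 0" if "j < val z" for j
    using m(4)[OF _ z that] out_in_E that g(2) by blast
  then show False
    using trunc_slopes(2,3)[OF g(1) td \<open>z \<in> P\<close> val_pos[OF \<open>z \<in> P\<close>]] val_pos[OF \<open>z \<in> P\<close>]
    by (metis One_nat_def Suc_1 Suc_le_lessD less_irrefl zero_neq_one)
qed

lemma flats_empty: "{} \<in> flats"
proof -
  have "flat_of E (\<lambda>_. 0 :: real) = {}" by (auto simp: flat_of_def argmin_set_def)
  then show ?thesis using Sigma_const[of 0] unfolding flats_def by (metis imageI)
qed

text \<open>After both minima are shifted to 0, the minimum set of the pointwise minimum is the
  union of the two minimum sets, and complements turn this into an intersection.\<close>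

lemma flats_Int:
  assumes "F \<in> flats" "G \<in> flats"
  shows "F \<inter> G \<in> flats"
proof -
  obtain f g where fg: "f \<in> \<Sigma>" "g \<in> \<Sigma>" "F = flat_of E f" "G = flat_of E g" using assms by (auto simp: flats_def)
  let ?h = "\<lambda>q. min (f q + - low f) (g q + - low g)"
  have h: "?h \<in> \<Sigma>" by (intro Sigma_min Sigma_add fg)
  obtain z where "z \<in> argmin_set f" using minimum[OF fg(1)] by blast
  then have z: "?h z = 0" using in_argmin_iff[OF fg(1)] low_le[OF fg(2)] by simp
  have "argmin_set ?h = {q. ?h q = 0}"
  proof -
    have nn: "0 \<le> ?h q" for q using low_le[OF fg(1), of q] low_le[OF fg(2), of q] by simp
    have "p \<in> argmin_set ?h \<longleftrightarrow> ?h p = 0" for p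
    proof
      assume "p \<in> argmin_set ?h"
      then have "?h p \<le> ?h z" by (simp only: argmin_set_def mem_Collect_eq)
      then show "?h p = 0" using z nn[of p] by linarith
    next
      assume "?h p = 0"
      then show "p \<in> argmin_set ?h" using nn by (simp only: argmin_set_def mem_Collect_eq) blast
    qed
    then show ?thesis by blast
  qed
  also have "\<dots> = argmin_set f \<union> argmin_set g"
  proof -
    have "?h q = 0 \<longleftrightarrow> f q = low f \<or> g q = low g" for q
      using low_le[OF fg(1), of q] low_le[OF fg(2), of q] by (auto simp: min_def)
    then show ?thesis by (intro set_eqI) (simp only: in_argmin_iff[OF fg(1)] in_argmin_iff[OF fg(2)] Un_iff mem_Collect_eq)
  qed
  finally have "S \<in> flat_of E ?h \<longleftrightarrow> S \<in> F \<and> S \<in> G" if "S \<in> E" for S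
    unfolding fg using flat_of_iff[OF h that] flat_of_iff[OF fg(1) that] flat_of_iff[OF fg(2) that] by auto
  then have eq: "flat_of E ?h = F \<inter> G"
    using fg by (auto simp: flat_of_def)
  show ?thesis unfolding flats_def eq[symmetric] by (rule imageI[OF h])
qed

text \<open>Membership in the Bergman fan, in the form of \<open>bergman_iff\<close>, available
  before there is a matroid. The full set \<open>E\<close> is allowed because low levels
  \<open>c\<close> lie below all values.\<close>

definition adm :: "('a set \<Rightarrow> real) \<Rightarrow> bool" where
  "adm x \<longleftrightarrow> (\<forall>c. {S\<in>E. c < x S} \<in> insert E flats)"

lemma insert_flats_Int:
  assumes "F \<in> insert E flats" "G \<in> insert E flats"
  shows "F \<inter> G \<in> insert E flats"
proof (cases "F = E \<or> G = E")
  case True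
  have "F \<subseteq> E" "G \<subseteq> E" using assms flats_sub by auto
  then have "F \<inter> G = G \<or> F \<inter> G = F" using True by blast
  then show ?thesis using assms by (elim disjE) simp_all
next
  case False
  then show ?thesis using assms flats_Int by simp
qed

lemma adm_min: "adm x \<Longrightarrow> adm y \<Longrightarrow> adm (\<lambda>S. min (x S) (y S))"
proof -
  assume xy: "adm x" "adm y"
  have "{S\<in>E. c < min (x S) (y S)} = {S\<in>E. c < x S} \<inter> {S\<in>E. c < y S}" for c by auto
  then show ?thesis using xy insert_flats_Int unfolding adm_def by simp
qed

lemma adm_scale:
  assumes "adm x" "0 \<le> t"
  shows "adm (\<lambda>S. t * x S)"
proof (cases "t = 0")
  case True
  have "{S\<in>E. c < t * x S} \<in> insert E flats" for c
    using flats_empty True by (cases "c < 0") simp_all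
  then show ?thesis unfolding adm_def by blast
next
  case False
  then have "{S\<in>E. c < t * x S} = {S\<in>E. c / t < x S}" for c
    using assms(2) by (auto simp: pos_divide_less_eq mult.commute)
  then show ?thesis using assms(1) unfolding adm_def by simp
qed

lemma adm_step:
  assumes "F \<in> flats" "0 \<le> b"
  shows "adm (\<lambda>S. (if S \<in> F then b else 0) + a)"
  unfolding adm_def
proof
  fix c
  consider "c < a" | "a \<le> c" "c < a + b" | "a + b \<le> c" by linarith
  then show "{S\<in>E. c < (if S \<in> F then b else 0) + a} \<in> insert E flats"
  proof cases
    case 1
    then have eq: "{S\<in>E. c < (if S \<in> F then b else 0) + a} = E" using assms(2) by auto
    show ?thesis unfolding eq by simp
  next
    case 2
    then have eq: "{S\<in>E. c < (if S \<in> F then b else 0) + a} = F" using flats_sub[OF assms(1)] by auto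
    show ?thesis unfolding eq using assms(1) by simp
  next
    case 3
    then have eq: "{S\<in>E. c < (if S \<in> F then b else 0) + a} = {}" using assms(2) by auto
    show ?thesis unfolding eq using flats_empty by simp
  qed
qed

lemma Phi_Min:
  assumes "finite T" "T \<noteq> {}"
    and "\<And>g. g \<in> T \<Longrightarrow> h g = Phi (x g)"
  shows "(\<lambda>p. Min ((\<lambda>g. h g p) ` T)) = Phi (\<lambda>S. Min ((\<lambda>g. x g S) ` T))"
  using assms
proof (induction T rule: finite_ne_induct)
  case (insert g T)
  have "(\<lambda>p. Min ((\<lambda>g. h g p) ` insert g T)) = (\<lambda>p. min (Phi (x g) p) (Min ((\<lambda>g. h g p) ` T)))"
    using insert by (intro ext) (simp add: Min_insert)
  also have "\<dots> = (\<lambda>p. min (Phi (x g) p) (Phi (\<lambda>S. Min ((\<lambda>g. x g S) ` T)) p))"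
    using insert by (metis (no_types, lifting) insertCI)
  also have "\<dots> = Phi (\<lambda>S. min (x g S) (Min ((\<lambda>g. x g S) ` T)))"
    by (rule Phi_min[symmetric])
  also have "\<dots> = Phi (\<lambda>S. Min ((\<lambda>g. x g S) ` insert g T))"
    using insert by (intro Phi_cong) (simp add: Min_insert)
  finally show ?case .
qed simp

lemma adm_Min:
  assumes "finite T" "T \<noteq> {}" "\<And>g. g \<in> T \<Longrightarrow> adm (x g)"
  shows "adm (\<lambda>S. Min ((\<lambda>g. x g S) ` T))"
  using assms
proof (induction T rule: finite_ne_induct)
  case (insert g T)
  then have "adm (\<lambda>S. min (x g S) (Min ((\<lambda>g. x g S) ` T)))" by (intro adm_min) auto
  then show ?case using insert by (simp add: Min_insert)
qed simp

lemma Sigma_Min: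
  assumes "finite T" "T \<noteq> {}" "\<And>g. g \<in> T \<Longrightarrow> h g \<in> \<Sigma>"
  shows "(\<lambda>p. Min ((\<lambda>g. h g p) ` T)) \<in> \<Sigma>"
  using assms
proof (induction T rule: finite_ne_induct)
  case (singleton g)
  then have "h g \<in> \<Sigma>" by simp
  moreover have "(\<lambda>p. Min ((\<lambda>g. h g p) ` {g})) = h g" by auto
  ultimately show ?case by simp
next
  case (insert g T)
  then have "(\<lambda>p. min (h g p) (Min ((\<lambda>g. h g p) ` T))) \<in> \<Sigma>" by (intro Sigma_min) auto
  moreover have "(\<lambda>p. Min ((\<lambda>g. h g p) ` insert g T)) = (\<lambda>p. min (h g p) (Min ((\<lambda>g. h g p) ` T)))"
    using insert by (intro ext) (simp add: Min_insert)
  ultimately show ?case by simp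
qed

text \<open>The superlevel set at level \<open>base x p\<close> omits the leg on which the base
  value is attained. It is therefore a proper flat, and \<open>flat_single_leg\<close> applies to
  it.\<close>

lemma adm_single_leg:
  assumes x: "adm x" and p: "p \<in> P" "i < val p" "j < val p" "i \<noteq> j" "base x p < x (out p i)"
  shows "x (out p j) = base x p"
proof (rule ccontr)
  assume "x (out p j) \<noteq> base x p"
  then have j: "base x p < x (out p j)" using base_le[OF p(1,3), of x] by simp
  obtain k where k: "k < val p" "base x p = x (out p k)" using base_attained[OF p(1)] by blast
  let ?F = "{S\<in>E. base x p < x S}"
  have nk: "out p k \<notin> ?F" using k by simp
  then have "?F \<noteq> E" using out_in_E[OF p(1) k(1)] by blast
  then have "?F \<in> flats" using x unfolding adm_def by blast
  then obtain g where g: "g \<in> \<Sigma>" "?F = flat_of E g" by (auto simp: flats_def)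
  have "out p i \<in> ?F" "out p j \<in> ?F" using p j out_in_E by auto
  then show False
    using flat_single_leg[OF g(1) p(1,2,3) k(1)] nk p(4) unfolding g(2) by blast
qed

lemma span:
  obtains G where "finite G" "G \<subseteq> \<Sigma>" "\<Sigma> = tropical_span G"
  using tls unfolding tropical_linear_series_def finitely_generated_def by blast

lemma tropical_spanD:
  assumes "\<phi> \<in> tropical_span G"
  obtains T a where "T \<subseteq> G" "finite T" "T \<noteq> {}" "\<And>p. \<phi> p = Min ((\<lambda>g. g p + a g) ` T)"
  using assms unfolding tropical_span_def by auto

text \<open>Functions of range at most \<open>t0\<close> correspond to admissible vectors of range
  at most \<open>t0\<close>. Both directions reduce to truncations, whose charts are step vectors,
  and to compatibility of \<open>Phi\<close> with minima. The bound \<open>t0\<close> is a minimum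
  over finitely many functions: the generators, from which every function is built, and one
  representative of each flat, from which every admissible vector is built.\<close>

lemma local_charts:
  obtains t0 where "0 < t0" "t0 < \<rho>"
    "\<And>\<phi>. \<phi> \<in> \<Sigma> \<Longrightarrow> (\<And>q. \<phi> q \<le> low \<phi> + t0) \<Longrightarrow>
       \<exists>x. adm x \<and> (\<forall>S\<in>E. low \<phi> \<le> x S \<and> x S \<le> low \<phi> + t0) \<and> \<phi> = Phi x"
    "\<And>x l. adm x \<Longrightarrow> (\<And>S. S \<in> E \<Longrightarrow> l \<le> x S) \<Longrightarrow> (\<And>S. S \<in> E \<Longrightarrow> x S \<le> l + t0) \<Longrightarrow> Phi x \<in> \<Sigma>"
proof -
  obtain G where G: "finite G" "G \<subseteq> \<Sigma>" "\<Sigma> = tropical_span G" by (rule span)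
  have "\<forall>F\<in>flats. \<exists>g. g \<in> \<Sigma> \<and> flat_of E g = F" by (auto simp: flats_def)
  then obtain rep where rep: "\<And>F. F \<in> flats \<Longrightarrow> rep F \<in> \<Sigma>" "\<And>F. F \<in> flats \<Longrightarrow> flat_of E (rep F) = F" by metis
  have "\<forall>g\<in>\<Sigma>. \<exists>t0>0. \<forall>t. 0 \<le> t \<longrightarrow> t \<le> t0 \<longrightarrow> trunc g t = Phi (\<lambda>S. if S \<in> flat_of E g then t else 0)"
  proof
    fix g assume "g \<in> \<Sigma>"
    then obtain t0 where "0 < t0" "\<And>t. 0 \<le> t \<Longrightarrow> t \<le> t0 \<Longrightarrow> trunc g t = Phi (\<lambda>S. if S \<in> flat_of E g then t else 0)"
      using trunc_Phi by blast
    then show "\<exists>t0>0. \<forall>t. 0 \<le> t \<longrightarrow> t \<le> t0 \<longrightarrow> trunc g t = Phi (\<lambda>S. if S \<in> flat_of E g then t else 0)"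
      by blast
  qed
  then obtain \<tau> where \<tau>: "\<And>g. g \<in> \<Sigma> \<Longrightarrow> 0 < \<tau> g"
    "\<And>g t. g \<in> \<Sigma> \<Longrightarrow> 0 \<le> t \<Longrightarrow> t \<le> \<tau> g \<Longrightarrow> trunc g t = Phi (\<lambda>S. if S \<in> flat_of E g then t else 0)"
    by metis
  have "finite flats" using flats_sub finite_E by (meson Pow_iff finite_Pow_iff finite_subset subsetI)
  then have finH: "finite (G \<union> rep ` flats)" using G(1) by simp
  have H: "G \<union> rep ` flats \<subseteq> \<Sigma>" using G(2) rep(1) by auto
  define t0 where "t0 = Min (insert (\<rho> / 2) (\<tau> ` (G \<union> rep ` flats)))"
  have t0: "0 < t0" "t0 < \<rho>" and t0H: "\<And>g. g \<in> G \<union> rep ` flats \<Longrightarrow> t0 \<le> \<tau> g"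
  proof -
    have "0 < \<tau> g" if "g \<in> G \<union> rep ` flats" for g by (rule \<tau>(1)[OF subsetD[OF H that]])
    then have "\<forall>s\<in>insert (\<rho> / 2) (\<tau> ` (G \<union> rep ` flats)). 0 < s" using rho by simp
    then show "0 < t0" unfolding t0_def using finH by (subst Min_gr_iff) auto
    have "t0 \<le> \<rho> / 2" unfolding t0_def using finH by (intro Min_le) auto
    then show "t0 < \<rho>" using rho by simp
    show "t0 \<le> \<tau> g" if "g \<in> G \<union> rep ` flats" for g
      unfolding t0_def using finH that by (intro Min_le) auto
  qed
  have step: "(\<lambda>q. trunc g t q + c) = Phi (\<lambda>S. (if S \<in> flat_of E g then t else 0) + c)"
    if "g \<in> G \<union> rep ` flats" "0 \<le> t" "t \<le> t0" for g t c
    unfolding Phi_add using \<tau>(2)[of g t] t0H[of g] H that by auto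
  show ?thesis
  proof (rule that[OF t0])
    fix \<phi> assume \<phi>: "\<phi> \<in> \<Sigma>" "\<And>q. \<phi> q \<le> low \<phi> + t0"
    let ?C = "low \<phi> + t0"
    obtain T a where T: "T \<subseteq> G" "finite T" "T \<noteq> {}" and eq: "\<And>p. \<phi> p = Min ((\<lambda>g. g p + a g) ` T)"
      using \<phi>(1) G(3) tropical_spanD by metis
    have le: "\<phi> p \<le> g p + a g" if "g \<in> T" for g p
      unfolding eq using T(2) that by (intro Min_le) auto
    \<comment> \<open>\<open>A g\<close> is the minimal value of the shifted generator. It is at
      least \<open>low \<phi>\<close>, as this generator lies above \<open>\<phi>\<close>.\<close>
    define A where "A g = a g + low g" for g
    define x where "x g S = (if ?C \<le> A g then ?C else (if S \<in> flat_of E g then ?C - A g else 0) + A g)" for g S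
    have A: "low \<phi> \<le> A g" if g: "g \<in> T" for g
    proof -
      have gS: "g \<in> \<Sigma>" using g T(1) G(2) by blast
      obtain z where "z \<in> argmin_set g" using minimum[OF gS] by blast
      then have "\<phi> z \<le> A g" using le[OF g, of z] low_eq[of z g] by (simp add: A_def)
      then show ?thesis using low_le[OF \<phi>(1), of z] by simp
    qed
    have Px: "(\<lambda>p. min (g p + a g) ?C) = Phi (x g)" if g: "g \<in> T" for g
    proof (cases "?C \<le> A g")
      case True
      have gS: "g \<in> \<Sigma>" using g T(1) G(2) by blast
      have "min (g p + a g) ?C = ?C" for p using low_le[OF gS, of p] True by (simp add: A_def)
      then show ?thesis using True Phi_const[of ?C] by (simp add: x_def[abs_def])
    next
      case False
      have "(\<lambda>p. min (g p + a g) ?C) = (\<lambda>p. trunc g (?C - A g) p + A g)"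
        by (intro ext) (simp add: trunc_def A_def min_def)
      also have "\<dots> = Phi (\<lambda>S. (if S \<in> flat_of E g then ?C - A g else 0) + A g)"
        using False A[OF g] g T(1) by (intro step) auto
      finally show ?thesis using False by (simp add: x_def[abs_def])
    qed
    have ax: "adm (x g)" if g: "g \<in> T" for g
    proof (cases "?C \<le> A g")
      case True
      then show ?thesis using adm_step[OF flats_empty, of 0 ?C] by (simp add: x_def[abs_def])
    next
      case False
      have "flat_of E g \<in> flats" using g T(1) G(2) by (auto simp: flats_def)
      then show ?thesis using adm_step[of "flat_of E g" "?C - A g" "A g"] False by (simp add: x_def[abs_def])
    qed
    let ?x = "\<lambda>S. Min ((\<lambda>g. x g S) ` T)"
    \<comment> \<open>Capping at \<open>?C\<close> does not change \<open>\<phi>\<close>, whose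
      values are at most \<open>?C\<close>, but it turns every shifted generator into a constant or
      a shifted truncation.\<close>
    have "\<phi> = (\<lambda>p. Min ((\<lambda>g. min (g p + a g) ?C) ` T))"
    proof
      fix p
      have "\<phi> p \<in> (\<lambda>g. g p + a g) ` T" unfolding eq using T by (intro Min_in) auto
      then obtain g where g: "g \<in> T" "\<phi> p = g p + a g" by blast
      have "Min ((\<lambda>g. min (g p + a g) ?C) ` T) = \<phi> p"
      proof (rule Min_eqI)
        show "\<phi> p \<in> (\<lambda>g. min (g p + a g) ?C) ` T"
          using g \<phi>(2)[of p] by (intro image_eqI[of _ _ g]) auto
        show "\<And>y. y \<in> (\<lambda>g. min (g p + a g) ?C) ` T \<Longrightarrow> \<phi> p \<le> y"
          using le \<phi>(2)[of p] by auto
      qed (use T in auto)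
      then show "\<phi> p = Min ((\<lambda>g. min (g p + a g) ?C) ` T)" by simp
    qed
    also have "\<dots> = Phi ?x"
      using Phi_Min[OF T(2,3), of "\<lambda>g p. min (g p + a g) ?C" x] Px by blast
    finally have 1: "\<phi> = Phi ?x" .
    have 2: "adm ?x" by (rule adm_Min[OF T(2,3) ax])
    have 3: "low \<phi> \<le> ?x S \<and> ?x S \<le> ?C" for S
    proof -
      have "?x S \<in> (\<lambda>g. x g S) ` T" using T by (intro Min_in) auto
      then obtain g where "g \<in> T" "?x S = x g S" by blast
      then show ?thesis using A[of g] t0 by (auto simp: x_def)
    qed
    show "\<exists>x. adm x \<and> (\<forall>S\<in>E. low \<phi> \<le> x S \<and> x S \<le> ?C) \<and> \<phi> = Phi x"
      using 3 by (intro exI[of _ ?x] conjI 1 2) blast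
  next
    fix x :: "'a set \<Rightarrow> real" and l :: real
    assume x: "adm x" "\<And>S. S \<in> E \<Longrightarrow> l \<le> x S" "\<And>S. S \<in> E \<Longrightarrow> x S \<le> l + t0"
    let ?C = "l + t0"
    let ?F = "\<lambda>c. {S\<in>E. c < x S}"
    \<comment> \<open>The step vector with value \<open>c\<close> where \<open>x\<close> is at most
      \<open>c\<close> and the top value \<open>?C\<close> elsewhere. At \<open>S\<close> the
      minimum over all values \<open>c\<close> of \<open>x\<close> is attained for
      \<open>c = x S\<close>.\<close>
    define y where "y c S = (if S \<in> ?F c then ?C - c else 0) + c" for c S
    have c: "l \<le> c" "c \<le> ?C" if "c \<in> x ` E" for c using that x(2,3) by auto
    have Fc: "?F c \<in> flats" if "c \<in> x ` E" for c
    proof -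
      have "?F c \<noteq> E" using that by blast
      then show ?thesis using x(1) unfolding adm_def by blast
    qed
    have y: "Phi (y c) \<in> \<Sigma>" "(\<lambda>p. trunc (rep (?F c)) (?C - c) p + c) = Phi (y c)" if "c \<in> x ` E" for c
    proof -
      show *: "(\<lambda>p. trunc (rep (?F c)) (?C - c) p + c) = Phi (y c)"
        using step[of "rep (?F c)" "?C - c" c] Fc[OF that] c[OF that] rep(2)[OF Fc[OF that]]
        by (simp add: y_def[abs_def])
      show "Phi (y c) \<in> \<Sigma>"
        unfolding *[symmetric] by (intro Sigma_add trunc_in rep(1) Fc that)
    qed
    obtain S0 where "S0 \<in> E" by (rule E_nonempty)
    then have fE: "finite (x ` E)" "x ` E \<noteq> {}" using finite_E by auto
    have "(\<lambda>p. Min ((\<lambda>c. Phi (y c) p) ` x ` E)) \<in> \<Sigma>" by (rule Sigma_Min[OF fE y(1)])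
    also have "(\<lambda>p. Min ((\<lambda>c. Phi (y c) p) ` x ` E)) = Phi (\<lambda>S. Min ((\<lambda>c. y c S) ` x ` E))"
      by (rule Phi_Min[OF fE]) simp
    also have "\<dots> = Phi x"
    proof (rule Phi_cong, rule Min_eqI)
      fix S assume S: "S \<in> E"
      show "finite ((\<lambda>c. y c S) ` x ` E)" using fE by simp
      show "x S \<in> (\<lambda>c. y c S) ` x ` E"
        using S by (intro image_eqI[of _ _ "x S"]) (auto simp: y_def)
      show "x S \<le> v" if "v \<in> (\<lambda>c. y c S) ` x ` E" for v
        using that S x(3) by (auto simp: y_def)
    qed
    finally show "Phi x \<in> \<Sigma>" .
  qed
qed

text \<open>Needed because \<open>GREATEST\<close> in \<open>r_BN\<close> is only meaningful for a predicate that is bounded above.\<close>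

lemma slope_bound:
  obtains K where "\<And>\<phi>. \<phi> \<in> \<Sigma> \<Longrightarrow> principal_divisor \<phi> p \<le> K"
proof -
  obtain n \<tau> \<psi> where st: "star p n \<tau> \<psi>" using stars by blast
  obtain G where G: "finite G" "G \<subseteq> \<Sigma>" "\<Sigma> = tropical_span G" by (rule span)
  have "\<exists>\<sigma> k. 0 < \<sigma> \<and> (\<forall>i<n. \<forall>t. 0 \<le> t \<longrightarrow> t \<le> \<sigma> \<longrightarrow> g (\<psi> i t) = g p + real_of_int (k i) * t)" if "g \<in> G" for g
    using PL_star[OF Sigma_PL st, of g] that G(2) by (metis atLeastAtMost_iff subsetD)
  then obtain \<sigma> k where k: "\<And>g. g \<in> G \<Longrightarrow> 0 < \<sigma> g"
    "\<And>g i t. g \<in> G \<Longrightarrow> i < n \<Longrightarrow> 0 \<le> t \<Longrightarrow> t \<le> \<sigma> g \<Longrightarrow> g (\<psi> i t) = g p + real_of_int (k g i) * t"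
    by metis
  define M where "M = (\<Sum>g\<in>G. \<Sum>i<n. \<bar>k g i\<bar>)"
  have M: "- M \<le> k g i" if "g \<in> G" "i < n" for g i
  proof -
    have "\<bar>k g i\<bar> \<le> (\<Sum>i<n. \<bar>k g i\<bar>)" using that by (intro member_le_sum) auto
    also have "\<dots> \<le> M" unfolding M_def using that G(1) by (intro member_le_sum[of g]) (auto intro: sum_nonneg)
    finally show ?thesis by simp
  qed
  have "principal_divisor \<phi> p \<le> int n * M" if \<phi>: "\<phi> \<in> \<Sigma>" for \<phi>
  proof -
    obtain \<sigma>' and m :: "nat \<Rightarrow> int" where m: "0 < \<sigma>'" "\<sigma>' \<le> \<tau>"
      "\<And>i t. i < n \<Longrightarrow> t \<in> {0..\<sigma>'} \<Longrightarrow> \<phi> (\<psi> i t) = \<phi> p + real_of_int (m i) * t"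
      using PL_star[OF Sigma_PL[OF \<phi>] st] by blast
    obtain T a where T: "T \<subseteq> G" "finite T" "T \<noteq> {}" and eq: "\<And>p. \<phi> p = Min ((\<lambda>g. g p + a g) ` T)"
      using \<phi> G(3) tropical_spanD by metis
    have "- M \<le> m i" if i: "i < n" for i
    proof -
      \<comment> \<open>A distance at which all functions involved are still linear along leg
        \<open>i\<close>. The generator that realizes \<open>\<phi>\<close> there lies above
        \<open>\<phi>\<close> at \<open>p\<close>, so its slope is at most that of
        \<open>\<phi>\<close>.\<close>
      define t where "t = Min (insert \<sigma>' (\<sigma> ` T))"
      have t: "0 < t" "t \<le> \<sigma>'" "\<And>g. g \<in> T \<Longrightarrow> t \<le> \<sigma> g"
      proof -
        have "0 < \<sigma> g" if "g \<in> T" for g by (rule k(1)[OF subsetD[OF T(1) that]])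
        then have "\<forall>s\<in>insert \<sigma>' (\<sigma> ` T). 0 < s" using m(1) by simp
        then show "0 < t" unfolding t_def using T(2) by (subst Min_gr_iff) auto
      qed (use T(2) in \<open>auto simp: t_def\<close>)
      have "\<phi> (\<psi> i t) \<in> (\<lambda>g. g (\<psi> i t) + a g) ` T" unfolding eq using T by (intro Min_in) auto
      then obtain g where g: "g \<in> T" "\<phi> (\<psi> i t) = g (\<psi> i t) + a g" by blast
      have gG: "g \<in> G" using g T by blast
      have "\<phi> p \<le> g p + a g" unfolding eq using T(2) g(1) by (intro Min_le) auto
      moreover have "g (\<psi> i t) = g p + real_of_int (k g i) * t" using k(2)[OF gG i] t g(1) by simp
      moreover have "\<phi> (\<psi> i t) = \<phi> p + real_of_int (m i) * t" using m(3)[OF i, of t] t by simp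
      ultimately have "real_of_int (k g i) * t \<le> real_of_int (m i) * t" using g(2) by linarith
      then have "k g i \<le> m i" using t(1) by simp
      then show ?thesis using M[OF gG i] by simp
    qed
    then have "(\<Sum>i<n. - m i) \<le> (\<Sum>i<n. M)" by (intro sum_mono) (simp add: minus_le_iff)
    moreover have "principal_divisor \<phi> p = - (\<Sum>i<n. m i)"
      using m by (intro principal_divisor_star[OF st]) blast
    ultimately show ?thesis by (simp add: sum_negf)
  qed
  then show ?thesis by (rule that)
qed

text \<open>The property defining \<open>r_BN\<close> holds for \<open>- 1\<close> and fails for
  large \<open>n\<close>: \<open>n\<close> chips at a single point exceed what
  \<open>slope_bound\<close> allows. So the greatest integer with this property exists, and it has
  the property.\<close>

lemma r_BN_D:
  assumes "is_divisor D'" "effective D'" "divisor_degree D' = int r"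
  shows "\<exists>\<phi>\<in>\<Sigma>. effective (add_div (\<lambda>p. D p - D' p) \<phi>)"
proof -
  define Q where "Q n \<longleftrightarrow> (\<forall>D'. is_divisor D' \<and> effective D' \<and> divisor_degree D' = n \<longrightarrow>
        (\<exists>\<phi>\<in>\<Sigma>. effective (add_div (\<lambda>p. D p - D' p) \<phi>)))" for n :: int
  fix p :: 'a
  obtain K where K: "\<And>\<phi>. \<phi> \<in> \<Sigma> \<Longrightarrow> principal_divisor \<phi> p \<le> K" using slope_bound by blast
  have bound: "n \<le> \<bar>D p + K\<bar>" if Qn: "Q n" for n
  proof (rule ccontr)
    assume n: "\<not> n \<le> \<bar>D p + K\<bar>"
    let ?D = "\<lambda>q. if q = p then n else 0"
    have s: "supp ?D = {p}" using n by (auto simp: supp_def)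
    then have "is_divisor ?D" "effective ?D" "divisor_degree ?D = n"
      using n by (auto simp: is_divisor_def effective_def divisor_degree_def)
    then obtain \<phi> where \<phi>: "\<phi> \<in> \<Sigma>" "effective (add_div (\<lambda>q. D q - ?D q) \<phi>)"
      using Qn unfolding Q_def by blast
    then have "0 \<le> D p - n + principal_divisor \<phi> p" by (auto simp: effective_def add_div_def dest: spec[of _ p])
    then show False using K[OF \<phi>(1)] n by linarith
  qed
  \<comment> \<open>Vacuous, as effective divisors have nonnegative degree; it provides a member for
    the finite set \<open>?B\<close>.\<close>
  have Qneg: "Q (- 1)"
    unfolding Q_def
  proof (intro allI impI)
    fix D' :: "'a divisor" assume D': "is_divisor D' \<and> effective D' \<and> divisor_degree D' = - 1"
    then have "0 \<le> divisor_degree D'" unfolding divisor_degree_def effective_def by (intro sum_nonneg) auto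
    then show "\<exists>\<phi>\<in>\<Sigma>. effective (add_div (\<lambda>p. D p - D' p) \<phi>)" using D' by simp
  qed
  let ?B = "{n. - 1 \<le> n \<and> n \<le> \<bar>D p + K\<bar> \<and> Q n}"
  have fB: "finite ?B" by (rule finite_subset[of _ "{- 1..\<bar>D p + K\<bar>}"]) auto
  have neB: "- 1 \<in> ?B" using Qneg by simp
  have "Max ?B \<in> ?B" using Max_in[OF fB] neB by blast
  then have QM: "Q (Max ?B)" "- 1 \<le> Max ?B" by auto
  have "r_BN D \<Sigma> = Max ?B"
    unfolding r_BN_def Q_def[symmetric]
  proof (rule Greatest_equality)
    show "Q (Max ?B)" by (rule QM(1))
    fix n assume n: "Q n"
    show "n \<le> Max ?B"
    proof (cases "- 1 \<le> n")
      case True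
      then have "n \<in> ?B" using n bound by blast
      then show ?thesis using fB by (rule Max_ge[rotated])
    qed (use QM(2) in simp)
  qed
  then have "Q (int r)" using QM(1) tls by (simp add: tropical_linear_series_def)
  then show ?thesis using assms unfolding Q_def by blast
qed

text \<open>Chips are prescribed inside the components of \<open>A\<close>. As \<open>D\<close> has
  none there, \<open>\<phi>\<close> cannot be constant near these points, so the components are not
  in its minimum set.\<close>

lemma flats_small:
  assumes A: "A \<subseteq> E" "card A \<le> r"
  shows "\<exists>F\<in>flats. A \<subseteq> F"
proof (cases "A = {}")
  case True
  then show ?thesis using flats_empty by blast
next
  case False
  have finA: "finite A" using A(1) finite_E finite_subset by blast
  obtain h where h: "bij_betw h {0..<card A} A" using ex_bij_betw_nat_finite[OF finA] by blast
  obtain S0 where S0: "S0 \<in> A" using False by blast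
  \<comment> \<open>One point in each member of \<open>A\<close>. If \<open>A\<close> has fewer than
    \<open>r\<close> members, the remaining chips go to \<open>S0\<close>, where they do no
    harm.\<close>
  define y where "y i = (SOME q. q \<in> (if i < card A then h i else S0))" for i
  have y: "y i \<in> (if i < card A then h i else S0)" for i
  proof -
    have "(if i < card A then h i else S0) \<in> E" using h S0 A(1) by (auto simp: bij_betw_def)
    then have "(if i < card A then h i else S0) \<noteq> {}" using in_components_nonempty by blast
    then show ?thesis unfolding y_def by (simp add: some_in_eq)
  qed
  obtain \<phi> where \<phi>: "\<phi> \<in> \<Sigma>" "effective (add_div (\<lambda>p. D p - tuple_divisor r y p) \<phi>)"
    using r_BN_D[OF is_divisor_tuple_divisor effective_tuple_divisor divisor_degree_tuple_divisor] by blast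
  have "A \<subseteq> flat_of E \<phi>"
  proof
    fix S assume S: "S \<in> A"
    then have "S \<in> h ` {0..<card A}" using h by (simp add: bij_betw_def)
    then obtain i where i: "i < card A" "h i = S" by auto
    have q: "y i \<in> S" "S \<in> E" using y[of i] i S A(1) by auto
    have nP: "y i \<notin> P" using cmp_eq(1)[OF q(2,1)] .
    show "S \<in> flat_of E \<phi>"
    proof (rule ccontr)
      assume "S \<notin> flat_of E \<phi>"
      then have "S \<subseteq> argmin_set \<phi>" using q(2) by (auto simp: flat_of_def)
      then have z: "y i \<in> argmin_set \<phi>" using q by blast
      obtain \<eta> where e: "\<eta> > 0" "ball (y i) \<eta> \<subseteq> argmin_set \<phi>" using argmin_open[OF \<phi>(1) z nP] by blast
      obtain n \<sigma> \<psi> where st: "star (y i) n \<sigma> \<psi>" using stars by blast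
      have "principal_divisor \<phi> (y i) = 0"
      proof (rule principal_divisor_locally_const[OF st e(1)])
        fix q assume "dist (y i) q < \<eta>"
        then have "q \<in> argmin_set \<phi>" using e(2) by auto
        then show "\<phi> q = \<phi> (y i)" using z in_argmin_iff[OF \<phi>(1)] by simp
      qed
      moreover have "tuple_divisor r y (y i) \<noteq> 0"
        using i(1) A(2) supp_tuple_divisor[of r y] by (auto simp: supp_def)
      moreover have "0 \<le> tuple_divisor r y (y i)" by (simp add: tuple_divisor_def)
      moreover have "D (y i) = 0" using nP by (simp add: supp_def)
      moreover have "0 \<le> D (y i) - tuple_divisor r y (y i) + principal_divisor \<phi> (y i)"
        using \<phi>(2) by (simp add: effective_def add_div_def)
      ultimately show False by linarith
    qed
  qed
  then show ?thesis using \<phi>(1) by (auto simp: flats_def)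
qed

text \<open>Functions with these flats are independent. For given shifts, let \<open>F\<close> be
  the smallest flat among those whose functions have the least shifted minimum \<open>w\<close>, and
  \<open>S\<close> a component outside \<open>F\<close> but inside all larger flats of the chain. On
  \<open>S\<close> the function of \<open>F\<close> attains \<open>w F\<close>; those of larger
  flats are above their minimum there, and those of smaller flats have a larger shifted minimum. So
  the minimum is attained only once on \<open>S\<close>.\<close>

lemma flats_chain:
  assumes C: "C \<subseteq> flats" "\<And>F G. F \<in> C \<Longrightarrow> G \<in> C \<Longrightarrow> F \<subseteq> G \<or> G \<subseteq> F"
  shows "card C \<le> Suc r"
proof (cases "C = {}")
  case False
  have finC: "finite C" using C(1) flats_sub finite_E by (meson Pow_iff finite_Pow_iff finite_subset subsetI subset_trans)
  have "\<forall>F\<in>C. \<exists>g. g \<in> \<Sigma> \<and> flat_of E g = F" using C(1) by (auto simp: flats_def)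
  then obtain f where f: "\<And>F. F \<in> C \<Longrightarrow> f F \<in> \<Sigma>" "\<And>F. F \<in> C \<Longrightarrow> flat_of E (f F) = F" by metis
  have inj: "inj_on f C" by (rule inj_on_inverseI[of _ "flat_of E"]) (rule f(2))
  have "\<not> tropically_dependent (f ` C)"
  proof
    assume "tropically_dependent (f ` C)"
    then obtain a where a: "\<And>p. \<exists>g\<in>f ` C. \<exists>h\<in>f ` C. g \<noteq> h \<and> g p + a g = h p + a h \<and> (\<forall>k\<in>f ` C. g p + a g \<le> k p + a k)"
      unfolding tropically_dependent_def by blast
    define w where "w F = low (f F) + a (f F)" for F
    let ?M = "{F\<in>C. w F = Min (w ` C)}"
    have "Min (w ` C) \<in> w ` C" using finC False by (intro Min_in) auto
    then have "?M \<noteq> {}" by force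
    moreover have "finite ?M" using finC by simp
    ultimately obtain F where F: "F \<in> ?M" "\<forall>G\<in>?M. G \<subseteq> F \<longrightarrow> F = G"
      using finite_has_minimal[of ?M] by blast
    then have FC: "F \<in> C" "w F = Min (w ` C)" by auto
    have wle: "w F \<le> w G" if "G \<in> C" for G unfolding FC(2) using finC that by (intro Min_le) auto
    \<comment> \<open>In a chain it suffices to avoid \<open>F\<close> inside the next larger flat,
      or inside \<open>E\<close> if \<open>F\<close> is the largest.\<close>
    have "\<exists>S\<in>E. S \<notin> F \<and> (\<forall>G\<in>C. F \<subset> G \<longrightarrow> S \<in> G)"
    proof (cases "{G\<in>C. F \<subset> G} = {}")
      case True
      have "F \<noteq> E" "F \<subseteq> E" using FC(1) C(1) flats_proper flats_sub by auto
      then show ?thesis using True by blast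
    next
      case ne: False
      have "finite {G\<in>C. F \<subset> G}" using finC by simp
      from finite_has_minimal[OF this ne] obtain G where G: "G \<in> C" "F \<subset> G" "\<And>H. H \<in> C \<Longrightarrow> F \<subset> H \<Longrightarrow> H \<subseteq> G \<Longrightarrow> G = H"
        by blast
      then obtain S where S: "S \<in> G" "S \<notin> F" by blast
      have "S \<in> H" if "H \<in> C" "F \<subset> H" for H
        using C(2)[OF G(1) that(1)] G(3)[OF that] S(1) by blast
      moreover have "S \<in> E" using S(1) G(1) C(1) flats_sub by blast
      ultimately show ?thesis using S(2) by blast
    qed
    then obtain S where S: "S \<in> E" "S \<notin> F" "\<And>G. G \<in> C \<Longrightarrow> F \<subset> G \<Longrightarrow> S \<in> G" by blast
    obtain q where q: "q \<in> S" using in_components_nonempty[OF S(1)] by blast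
    have "S \<subseteq> argmin_set (f F)" using S(1,2) f(2)[OF FC(1)] by (auto simp: flat_of_def)
    then have vF: "f F q + a (f F) = w F" using q in_argmin_iff[OF f(1)[OF FC(1)]] by (auto simp: w_def)
    have less: "w F < f G q + a (f G)" if G: "G \<in> C" "G \<noteq> F" for G
    proof (cases "F \<subset> G")
      case True
      then have "S \<in> flat_of E (f G)" using S(3)[OF G(1)] f(2)[OF G(1)] by simp
      then have "q \<notin> argmin_set (f G)" using flat_of_iff[OF f(1)[OF G(1)] S(1)] q by blast
      then have "low (f G) < f G q" by (rule low_less[OF f(1)[OF G(1)]])
      then show ?thesis using wle[OF G(1)] by (simp add: w_def)
    next
      case False
      then have "G \<subseteq> F" using C(2)[OF FC(1) G(1)] G(2) by blast
      then have "w G \<noteq> w F" using F(2) FC G by auto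
      then have "w F < w G" using wle[OF G(1)] by simp
      then show ?thesis using low_le[OF f(1)[OF G(1)], of q] by (simp add: w_def)
    qed
    obtain g h where gh: "g \<in> f ` C" "h \<in> f ` C" "g \<noteq> h" "g q + a g = h q + a h" "\<forall>k\<in>f ` C. g q + a g \<le> k q + a k"
      using a[of q] by blast
    have "g q + a g \<le> w F" using gh(5) FC(1) vF by force
    then have "g = f F" "h = f F" using gh(1,2,4) less by (metis imageE not_less)+
    then show False using gh(3) by simp
  qed
  moreover have "f ` C \<subseteq> \<Sigma>" "finite (f ` C)" using f(1) finC by auto
  ultimately have "enat (card (f ` C)) \<le> r_ind \<Sigma>"
    unfolding r_ind_def by (intro SUP_upper) auto
  then have "card (f ` C) \<le> Suc r" using tls by (simp add: tropical_linear_series_def)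
  then show ?thesis using card_image[OF inj] by simp
qed simp

section \<open>The matroid of the series\<close>

sublocale flat_lattice E "insert E flats" r
proof
  show "finite E" by (rule finite_E)
  show "F \<subseteq> E" if "F \<in> insert E flats" for F using that flats_sub by auto
  show "E \<in> insert E flats" by simp
  show "F \<inter> G \<in> insert E flats" if "F \<in> insert E flats" "G \<in> insert E flats" for F G
    using insert_flats_Int that by blast
  show "\<exists>F\<in>insert E flats. A \<subseteq> F \<and> F \<noteq> E" if "A \<subseteq> E" "card A \<le> r" for A
    using flats_small[OF that] flats_proper by blast
  show "card C \<le> Suc r" if "C \<subseteq> insert E flats - {E}" "\<And>F G. F \<in> C \<Longrightarrow> G \<in> C \<Longrightarrow> F \<subseteq> G \<or> G \<subseteq> F" for C
    using that by (intro flats_chain) auto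
qed

section \<open>The star of a nondegenerate series\<close>

lemma base_scale:
  assumes "p \<in> P" "0 \<le> t"
  shows "base (\<lambda>S. t * x S) p = t * base x p"
proof -
  obtain i where "i < val p" "base x p = x (out p i)" by (rule base_attained[OF assms(1)])
  then show ?thesis
    using base_le[OF assms(1), of _ x] assms(2) by (intro base_eqI[OF assms(1), of _ _ i]) (auto intro: mult_left_mono)
qed

text \<open>\<open>j p\<close> is the leg along which the chips at \<open>p\<close> move; it is arbitrary if they stay at \<open>p\<close>.\<close>

definition leading :: "('a set \<Rightarrow> real) \<Rightarrow> ('a \<Rightarrow> nat) \<Rightarrow> bool" where
  "leading x j \<longleftrightarrow> (\<forall>p\<in>P. j p < val p \<and> (\<forall>i<val p. i \<noteq> j p \<longrightarrow> x (out p i) = base x p))"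

text \<open>The distance over which slope \<open>D p\<close> climbs from the base value to the
  leading one, hence the distance that the chips of \<open>p\<close> travel.\<close>

definition rise :: "('a set \<Rightarrow> real) \<Rightarrow> ('a \<Rightarrow> nat) \<Rightarrow> 'a \<Rightarrow> real" where
  "rise x j p = (x (out p (j p)) - base x p) / of_int (D p)"

lemma leading_exists:
  assumes "adm x"
  obtains j where "leading x j"
proof -
  have "\<exists>j. j < val p \<and> (\<forall>i<val p. i \<noteq> j \<longrightarrow> x (out p i) = base x p)" if p: "p \<in> P" for p
  proof (cases "\<exists>j<val p. base x p < x (out p j)")
    case True
    then obtain j where j: "j < val p" "base x p < x (out p j)" by blast
    then have "x (out p i) = base x p" if "i < val p" "i \<noteq> j" for i
      using adm_single_leg[OF assms p j(1) that(1) _ j(2)] that(2) by blast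
    then show ?thesis using j(1) by blast
  next
    case False
    then have "x (out p i) = base x p" if "i < val p" for i
      using base_le[OF p that, of x] that by force
    then show ?thesis using val_pos[OF p] by blast
  qed
  then obtain j where "\<And>p. p \<in> P \<Longrightarrow> j p < val p \<and> (\<forall>i<val p. i \<noteq> j p \<longrightarrow> x (out p i) = base x p)"
    by metis
  then show ?thesis using that[of j] by (simp add: leading_def)
qed

lemma leadingD:
  assumes "leading x j" "p \<in> P"
  shows "j p < val p" "i < val p \<Longrightarrow> i \<noteq> j p \<Longrightarrow> x (out p i) = base x p"
  using assms unfolding leading_def by blast+

lemma leading_scale: "leading x j \<Longrightarrow> 0 \<le> t \<Longrightarrow> leading (\<lambda>S. t * x S) j"
  unfolding leading_def by (simp add: base_scale)

lemma rise_scale: "p \<in> P \<Longrightarrow> 0 \<le> t \<Longrightarrow> rise (\<lambda>S. t * x S) j p = t * rise x j p"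
  by (simp add: rise_def base_scale diff_divide_distrib right_diff_distrib)

lemma rise_bounds:
  assumes "leading x j" "\<And>S. S \<in> E \<Longrightarrow> l \<le> x S" "\<And>S. S \<in> E \<Longrightarrow> x S \<le> l + b" "p \<in> P"
  shows "0 \<le> rise x j p" "rise x j p \<le> b"
proof -
  have j: "j p < val p" using leadingD assms by blast
  obtain i where i: "i < val p" "base x p = x (out p i)" by (rule base_attained[OF assms(4)])
  have d: "0 \<le> x (out p (j p)) - base x p" "x (out p (j p)) - base x p \<le> b"
    using base_le[OF assms(4) j, of x] assms(2)[OF out_in_E[OF assms(4) i(1)]]
      assms(3)[OF out_in_E[OF assms(4) j]] i(2) by auto
  have D1: "1 \<le> real_of_int (D p)" using pos[OF assms(4)] by simp
  show "0 \<le> rise x j p" using d D1 by (simp add: rise_def)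
  have "rise x j p \<le> x (out p (j p)) - base x p"
    unfolding rise_def using d D1 by (simp add: divide_le_eq mult_le_cancel_left1)
  then show "rise x j p \<le> b" using d by simp
qed

text \<open>\<open>Phi x\<close> is in standard form with slope \<open>D p\<close> on legs whose
  component lies above the base value and 0 on the others; \<open>b < \<rho>\<close> lets each climb
  end within distance \<open>\<rho>\<close>. With one leading leg per chip, all \<open>D p\<close>
  chips of \<open>p\<close> move together.\<close>

lemma Phi_divisor:
  assumes x: "\<And>S. S \<in> E \<Longrightarrow> l \<le> x S" "\<And>S. S \<in> E \<Longrightarrow> x S \<le> l + b" "b < \<rho>"
    and j: "leading x j" and c: "D = tuple_divisor d c"
  shows "add_div D (Phi x) = tuple_divisor d (\<lambda>k. leg (c k) (j (c k)) (rise x j (c k)))"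
proof
  fix q
  define m where "m p i = (if base x p < x (out p i) then nat (D p) else 0)" for p i
  have D1: "1 \<le> real_of_int (D p)" "real (nat (D p)) = real_of_int (D p)" if "p \<in> P" for p
    using pos[OF that] by auto
  have range: "x (out p i) < base x p + \<rho>" if p: "p \<in> P" "i < val p" for p i
  proof -
    obtain k where k: "k < val p" "base x p = x (out p k)" by (rule base_attained[OF p(1)])
    show ?thesis
      using x(1)[OF out_in_E[OF p(1) k(1)]] x(2)[OF out_in_E[OF p]] x(3) k(2) by simp
  qed
  have h: "std (Phi x) x (base x) m"
    unfolding std_def
  proof (intro conjI allI impI ballI)
    fix q assume "q \<notin> P" "\<forall>p\<in>P. \<rho> \<le> dist p q"
    then show "Phi x q = x (cmp q)" by (intro Phi_far) auto
  next
    fix p i s assume p: "p \<in> P" "i < val p" "0 \<le> s" "s < \<rho>"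
    show "Phi x (leg p i s) = min (x (out p i)) (base x p + real (m p i) * s)"
    proof (cases "base x p < x (out p i)")
      case True
      then show ?thesis using Phi_leg[OF p] D1(2)[OF p(1)] by (simp add: m_def)
    next
      case False
      then have "x (out p i) = base x p" using base_le[OF p(1,2), of x] by simp
      then show ?thesis using Phi_leg[OF p, of x] D1(1)[OF p(1)] p(3) by (simp add: m_def)
    qed
  next
    fix p i assume p: "p \<in> P" "i < val p"
    show "base x p \<le> x (out p i)" by (rule base_le[OF p])
    show "x (out p i) = base x p" if "m p i = 0"
      using that base_le[OF p, of x] pos[OF p(1)] by (auto simp: m_def split: if_splits)
    show "base x p < x (out p i)" if "0 < m p i"
      using that by (auto simp: m_def split: if_splits)
    show "x (out p i) < base x p + real (m p i) * \<rho>" if "0 < m p i"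
    proof -
      have "real (m p i) = real_of_int (D p)" using that D1(2)[OF p(1)] by (auto simp: m_def split: if_splits)
      moreover have "1 * \<rho> \<le> real_of_int (D p) * \<rho>" using D1(1)[OF p(1)] rho by (intro mult_right_mono) auto
      ultimately show ?thesis using range[OF p] by simp
    qed
  qed
  have summand: "(\<Sum>i<val p. int (m p i) * (of_bool (leg p i (height x (base x) m p i) = q) - of_bool (p = q))) =
      D p * of_bool (leg p (j p) (rise x j p) = q) - D p * of_bool (p = q)" if p: "p \<in> P" for p
  proof -
    note J = leadingD[OF j p]
    have "(\<Sum>i<val p. int (m p i) * (of_bool (leg p i (height x (base x) m p i) = q) - of_bool (p = q))) =
      (\<Sum>i<val p. if i = j p then int (m p i) * (of_bool (leg p i (height x (base x) m p i) = q) - of_bool (p = q)) else 0)"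
      using J by (intro sum.cong refl) (auto simp: m_def)
    also have "\<dots> = int (m p (j p)) * (of_bool (leg p (j p) (height x (base x) m p (j p)) = q) - of_bool (p = q))"
      using J(1) by simp
    also have "\<dots> = D p * (of_bool (leg p (j p) (rise x j p) = q) - of_bool (p = q))"
    proof (cases "base x p < x (out p (j p))")
      case True
      then have "int (m p (j p)) = D p" "height x (base x) m p (j p) = rise x j p"
        using pos[OF p] by (auto simp: m_def height_def rise_def)
      then show ?thesis by simp
    next
      case False
      then have "rise x j p = 0" using base_le[OF p J(1), of x] by (simp add: rise_def)
      then show ?thesis using False leg_0[OF p J(1)] by (simp add: m_def)
    qed
    finally show ?thesis by (simp add: right_diff_distrib)
  qed
  \<comment> \<open>Regroups a sum over tuple entries by their chips; the fibre over
    \<open>p\<close> has \<open>D p\<close> entries.\<close>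
  have fib: "(\<Sum>k<d. f (c k)) = (\<Sum>p\<in>P. D p * f p)" for f :: "'a \<Rightarrow> int"
  proof -
    have "(\<Sum>k<d. f (c k)) = (\<Sum>p\<in>P. \<Sum>k\<in>{k. k < d \<and> c k = p}. f (c k))"
    proof -
      have "{..<d} = (\<Union>p\<in>P. {k. k < d \<and> c k = p})" using supp_tuple_divisor[of d c] c by auto
      then show ?thesis using sum.UNION_disjoint[OF fin, of "\<lambda>p. {k. k < d \<and> c k = p}" "\<lambda>k. f (c k)"] by auto
    qed
    also have "\<dots> = (\<Sum>p\<in>P. D p * f p)"
    proof (rule sum.cong[OF refl])
      fix p
      have "D p = int (card {k. k < d \<and> c k = p})"
        using fun_cong[OF c, of p] unfolding tuple_divisor_def .
      then show "(\<Sum>k\<in>{k. k < d \<and> c k = p}. f (c k)) = D p * f p" by simp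
    qed
    finally show ?thesis .
  qed
  have "D q = (\<Sum>k<d. of_bool (c k = q))" using fun_cong[OF c, of q] unfolding tuple_divisor_sum .
  then have Dq: "D q = (\<Sum>p\<in>P. D p * of_bool (p = q))" using fib[of "\<lambda>p. of_bool (p = q)"] by simp
  have "add_div D (Phi x) q = D q + ((\<Sum>p\<in>P. D p * of_bool (leg p (j p) (rise x j p) = q)) - (\<Sum>p\<in>P. D p * of_bool (p = q)))"
    unfolding add_div_def principal_divisor_std[OF h] sum_subtractf[symmetric]
    using summand by (intro arg_cong2[where f = "(+)"] sum.cong refl) simp
  also have "\<dots> = (\<Sum>k<d. of_bool (leg (c k) (j (c k)) (rise x j (c k)) = q))"
    using fib[of "\<lambda>p. of_bool (leg p (j p) (rise x j p) = q)"] Dq by simp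
  finally show "add_div D (Phi x) q = tuple_divisor d (\<lambda>k. leg (c k) (j (c k)) (rise x j (c k))) q"
    by (simp add: tuple_divisor_sum)
qed

lemma add_div_add_const:
  assumes "\<phi> \<in> PL" "\<And>q. \<psi> q = \<phi> q + k"
  shows "add_div D \<psi> = add_div D \<phi>"
proof
  fix q :: 'a
  obtain n \<sigma> \<psi>' where "star q n \<sigma> \<psi>'" using stars by blast
  then have "principal_divisor \<psi> q = principal_divisor \<phi> q"
    by (rule principal_divisor_cong[OF _ assms(1) zero_less_one]) (rule assms(2))
  then show "add_div D \<psi> q = add_div D \<phi> q" by (simp add: add_div_def)
qed

section \<open>Curves in the linear system\<close>

lemma bounded_on_E:
  fixes u :: "'a set \<Rightarrow> real"
  shows "\<exists>l b. 0 < b \<and> (\<forall>S\<in>E. l \<le> u S \<and> u S \<le> l + b)"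
proof -
  let ?s = "\<Sum>S\<in>E. \<bar>u S\<bar>"
  have "- ?s \<le> u S \<and> u S \<le> - ?s + (1 + 2 * ?s)" if "S \<in> E" for S
  proof -
    have "\<bar>u S\<bar> \<le> ?s" using that finite_E by (intro member_le_sum) auto
    then show ?thesis by linarith
  qed
  moreover have "0 \<le> ?s" by (rule sum_nonneg) simp
  then have "0 < 1 + 2 * ?s" by linarith
  ultimately have "0 < 1 + 2 * ?s \<and> (\<forall>S\<in>E. - ?s \<le> u S \<and> u S \<le> - ?s + (1 + 2 * ?s))" by blast
  then show ?thesis by blast
qed

text \<open>Scaling a vector by \<open>t\<close> keeps the leading legs and multiplies every rise by
  \<open>t\<close>, so the chips move along fixed legs at constant speed
  \<open>rise u j\<close>.\<close>

lemma adm_curve: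
  assumes u: "adm u"
  obtains \<epsilon> where "0 < \<epsilon>" "sym_linear d \<epsilon> (\<lambda>t. add_div D (Phi (\<lambda>S. t * u S)))"
    "\<And>t. t \<in> {0..\<epsilon>} \<Longrightarrow> Phi (\<lambda>S. t * u S) \<in> \<Sigma>"
proof -
  obtain t0 where t0: "0 < t0" "t0 < \<rho>"
    "\<And>x l. adm x \<Longrightarrow> (\<And>S. S \<in> E \<Longrightarrow> l \<le> x S) \<Longrightarrow> (\<And>S. S \<in> E \<Longrightarrow> x S \<le> l + t0) \<Longrightarrow> Phi x \<in> \<Sigma>"
    using local_charts by metis
  obtain l b where b: "0 < b" "\<And>S. S \<in> E \<Longrightarrow> l \<le> u S" "\<And>S. S \<in> E \<Longrightarrow> u S \<le> l + b" using bounded_on_E[of u] by blast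
  obtain c where c: "D = tuple_divisor d c" by (rule tuple_D)
  obtain j where j: "leading u j" by (rule leading_exists[OF u])
  \<comment> \<open>The range of the scaled vector is at most \<open>t * b\<close>, so up to this
    time it stays within the chart.\<close>
  define \<epsilon> where "\<epsilon> = t0 / b"
  have e: "0 < \<epsilon>" "\<epsilon> * b = t0" using b(1) t0(1) by (auto simp: \<epsilon>_def)
  have bd: "t * l \<le> t * u S" "t * u S \<le> t * l + t0" if "t \<in> {0..\<epsilon>}" "S \<in> E" for t S
  proof -
    show "t * l \<le> t * u S" using b(2) that by (intro mult_left_mono) auto
    have "t * u S \<le> t * (l + b)" using b(3) that by (intro mult_left_mono) auto
    also have "t * b \<le> \<epsilon> * b" using that b(1) by (intro mult_right_mono) auto
    then have "t * (l + b) \<le> t * l + t0" using e(2) by (simp add: distrib_left)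
    finally show "t * u S \<le> t * l + t0" .
  qed
  have cP: "c k \<in> P" if "k < d" for k using that c supp_tuple_divisor by (metis imageI lessThan_iff)
  show ?thesis
  proof (rule that[OF e(1)])
    show "Phi (\<lambda>S. t * u S) \<in> \<Sigma>" if t: "t \<in> {0..\<epsilon>}" for t
      using t by (intro t0(3)[OF adm_scale[OF u], where l = "t * l"] bd[OF t]) auto
    show "sym_linear d \<epsilon> (\<lambda>t. add_div D (Phi (\<lambda>S. t * u S)))"
      unfolding sym_linear_def
    proof (intro exI conjI allI impI ballI)
      fix t assume t: "t \<in> {0..\<epsilon>}"
      then have "add_div D (Phi (\<lambda>S. t * u S)) = tuple_divisor d (\<lambda>k. leg (c k) (j (c k)) (rise (\<lambda>S. t * u S) j (c k)))"
        by (intro Phi_divisor[OF bd[OF t] t0(2) leading_scale[OF j] c]) auto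
      also have "\<dots> = tuple_divisor d (\<lambda>k. leg (c k) (j (c k)) (t * rise u j (c k)))"
        using t cP by (intro tuple_divisor_cong) (simp add: rise_scale)
      finally show "add_div D (Phi (\<lambda>S. t * u S)) = tuple_divisor d (\<lambda>k. leg (c k) (j (c k)) (t * rise u j (c k)))" .
    next
      fix k s t assume k: "k < d" and st: "s \<in> {0..\<epsilon>}" "t \<in> {0..\<epsilon>}"
      have R: "0 \<le> w * rise u j (c k) \<and> w * rise u j (c k) \<le> 2 * \<rho>" if "w \<in> {0..\<epsilon>}" for w
      proof -
        have "0 \<le> rise u j (c k)" "rise u j (c k) \<le> b" using rise_bounds[OF j b(2,3) cP[OF k]] by auto
        then have "w * rise u j (c k) \<le> \<epsilon> * b" using that e(1) by (intro mult_mono) auto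
        then show ?thesis using \<open>0 \<le> rise u j (c k)\<close> that e(2) t0(2) rho by simp
      qed
      have "dist (leg (c k) (j (c k)) (s * rise u j (c k))) (leg (c k) (j (c k)) (t * rise u j (c k))) =
          \<bar>s * rise u j (c k) - t * rise u j (c k)\<bar>"
        using starD(4)[OF leg[OF cP[OF k]] leadingD(1)[OF j cP[OF k]]] R[OF st(1)] R[OF st(2)] by blast
      also have "\<dots> = rise u j (c k) * \<bar>s - t\<bar>"
        using rise_bounds(1)[OF j b(2,3) cP[OF k]] by (simp add: abs_mult mult.commute flip: left_diff_distrib)
      finally show "dist (leg (c k) (j (c k)) (s * rise u j (c k))) (leg (c k) (j (c k)) (t * rise u j (c k))) =
          rise u j (c k) * \<bar>s - t\<bar>" .
    qed
  qed
qed

text \<open>The point \<open>pt S\<close> may lie close to a chip, where the function is possibly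
  still climbing. For small \<open>t\<close> the climb ends before it reaches \<open>pt S\<close>:
  the difference of values is at most \<open>t * b\<close>, and the slope is at least 1.\<close>

lemma Phi_eval:
  assumes pt: "\<And>S. S \<in> E \<Longrightarrow> pt S \<in> S"
  obtains \<epsilon> where "0 < \<epsilon>" "\<And>t S. t \<in> {0..\<epsilon>} \<Longrightarrow> S \<in> E \<Longrightarrow> Phi (\<lambda>S. t * u S) (pt S) = t * u S"
proof -
  obtain l b where b: "0 < b" "\<And>S. S \<in> E \<Longrightarrow> l \<le> u S" "\<And>S. S \<in> E \<Longrightarrow> u S \<le> l + b" using bounded_on_E[of u] by blast
  have "\<exists>e>0. \<forall>t\<in>{0..e}. Phi (\<lambda>S. t * u S) (pt S) = t * u S" if S: "S \<in> E" for S
  proof (cases "\<exists>p\<in>P. dist p (pt S) < \<rho>")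
    case True
    note q = cmp_eq[OF S pt[OF S]]
    obtain p where p: "p \<in> P" "dist p (pt S) < \<rho>" using True by blast
    let ?s = "dist p (pt S)"
    obtain i where i: "i < val p" "pt S = leg p i ?s" using star_cover[OF leg[OF p(1)], of "pt S"] p(2) rho by auto
    have s: "0 < ?s" using p(1) q(1) by auto
    have "out p i = S" using cmp_leg[OF p(1) i(1) s] p(2) rho q(2) i(2) by simp
    have "Phi (\<lambda>S. t * u S) (pt S) = t * u S" if t: "t \<in> {0..?s / b}" for t
    proof -
      obtain k where k: "k < val p" "base u p = u (out p k)" by (rule base_attained[OF p(1)])
      have "u S - base u p \<le> b" using b(2)[OF out_in_E[OF p(1) k(1)]] b(3)[OF S] k(2) by simp
      then have "t * (u S - base u p) \<le> t * b" using t by (intro mult_left_mono) auto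
      also have "t * b \<le> ?s" using t b(1) by (simp add: pos_le_divide_eq)
      also have "?s \<le> of_int (D p) * ?s" using pos[OF p(1)] s by simp
      finally have "t * u S \<le> t * base u p + of_int (D p) * ?s" by (simp add: right_diff_distrib)
      moreover have "Phi (\<lambda>S. t * u S) (pt S) = min (t * u S) (t * base u p + of_int (D p) * ?s)"
        using Phi_leg[OF p(1) i(1) less_imp_le[OF s] p(2), of "\<lambda>S. t * u S"] base_scale[OF p(1), of t u] t i(2) \<open>out p i = S\<close>
        by simp
      ultimately show ?thesis by simp
    qed
    then show ?thesis using s b(1) by (intro exI[of _ "?s / b"]) simp
  next
    case False
    then have "Phi (\<lambda>S. t * u S) (pt S) = t * u S" for t
      using Phi_far[OF cmp_eq(1)[OF S pt[OF S]], of "\<lambda>S. t * u S"] cmp_eq(2)[OF S pt[OF S]] by (simp add: not_less)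
    then show ?thesis by (intro exI[of _ 1]) simp
  qed
  then obtain e where e: "\<And>S. S \<in> E \<Longrightarrow> 0 < e S" "\<And>S t. S \<in> E \<Longrightarrow> t \<in> {0..e S} \<Longrightarrow> Phi (\<lambda>S. t * u S) (pt S) = t * u S"
    by metis
  define \<epsilon> where "\<epsilon> = Min (insert 1 (e ` E))"
  have "0 < \<epsilon>" "\<And>S. S \<in> E \<Longrightarrow> \<epsilon> \<le> e S"
    unfolding \<epsilon>_def using finite_E e(1) by auto
  then show ?thesis using e(2) by (intro that[of \<epsilon>]) force+
qed

text \<open>Uniqueness for the definite description: functions of \<open>\<Sigma>\<close> with equal
  divisors differ by a constant, so one small time \<open>t > 0\<close> determines the class of
  \<open>t * u\<close>, and division by \<open>t\<close> gives the class of
  \<open>u\<close>.\<close>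

lemma star_eval_eq:
  assumes pt: "\<And>S. S \<in> E \<Longrightarrow> pt S \<in> S"
    and c: "\<epsilon> > 0" "\<And>t. t \<in> {0..\<epsilon>} \<Longrightarrow> c t = add_div D (Phi (\<lambda>S. t * u S)) \<and> Phi (\<lambda>S. t * u S) \<in> \<Sigma>"
  shows "star_eval D \<Sigma> E pt (germ_rel `` {c}) = diag_class E u"
  unfolding star_eval_def
proof (rule the_equality)
  obtain \<epsilon>' where e': "0 < \<epsilon>'" "\<And>t S. t \<in> {0..\<epsilon>'} \<Longrightarrow> S \<in> E \<Longrightarrow> Phi (\<lambda>S. t * u S) (pt S) = t * u S"
    using Phi_eval[of pt u] pt by metis
  have diag: "diag_class E (\<lambda>S. Phi (\<lambda>S. t * u S) (pt S)) = diag_class E (\<lambda>S. t * u S)" if "t \<in> {0..\<epsilon>'}" for t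
    unfolding diag_class_eq_iff using e'(2)[OF that] by (intro exI[of _ 0]) simp
  show "\<exists>c\<in>germ_rel `` {c}. \<exists>v. diag_class E u = diag_class E v \<and>
        (\<exists>\<epsilon>>0. \<forall>t\<in>{0..\<epsilon>}. \<exists>\<phi>\<in>\<Sigma>. c t = add_div D \<phi> \<and>
           diag_class E (\<lambda>S. \<phi> (pt S)) = diag_class E (\<lambda>S. t * v S))"
  proof (intro bexI[of _ c] exI[of _ u] conjI refl exI[of _ "min \<epsilon> \<epsilon>'"] ballI)
    show "c \<in> germ_rel `` {c}" using equiv_class_self[OF germ_rel_equiv] by blast
    show "0 < min \<epsilon> \<epsilon>'" using c(1) e'(1) by simp
    fix t assume "t \<in> {0..min \<epsilon> \<epsilon>'}"
    then have t: "t \<in> {0..\<epsilon>}" "t \<in> {0..\<epsilon>'}" by auto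
    show "\<exists>\<phi>\<in>\<Sigma>. c t = add_div D \<phi> \<and> diag_class E (\<lambda>S. \<phi> (pt S)) = diag_class E (\<lambda>S. t * u S)"
      using c(2)[OF t(1)] diag[OF t(2)] by blast
  qed
  fix w assume "\<exists>c\<in>germ_rel `` {c}. \<exists>v. w = diag_class E v \<and>
        (\<exists>\<epsilon>>0. \<forall>t\<in>{0..\<epsilon>}. \<exists>\<phi>\<in>\<Sigma>. c t = add_div D \<phi> \<and>
           diag_class E (\<lambda>S. \<phi> (pt S)) = diag_class E (\<lambda>S. t * v S))"
  then obtain c' v \<epsilon>2 where c': "(c, c') \<in> germ_rel" "w = diag_class E v" "\<epsilon>2 > 0"
    "\<forall>t\<in>{0..\<epsilon>2}. \<exists>\<phi>\<in>\<Sigma>. c' t = add_div D \<phi> \<and> diag_class E (\<lambda>S. \<phi> (pt S)) = diag_class E (\<lambda>S. t * v S)"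
    by blast
  then obtain \<epsilon>3 where e3: "\<epsilon>3 > 0" "\<forall>t\<in>{0..\<epsilon>3}. c t = c' t" by (auto simp: germ_rel_def)
  define t where "t = min (min \<epsilon> \<epsilon>') (min \<epsilon>2 \<epsilon>3)"
  have t: "0 < t" "t \<in> {0..\<epsilon>}" "t \<in> {0..\<epsilon>'}" "t \<in> {0..\<epsilon>2}" "t \<in> {0..\<epsilon>3}"
    using c(1) e'(1) c'(3) e3(1) by (auto simp: t_def)
  obtain \<phi> where \<phi>: "\<phi> \<in> \<Sigma>" "c' t = add_div D \<phi>" "diag_class E (\<lambda>S. \<phi> (pt S)) = diag_class E (\<lambda>S. t * v S)"
    using c'(4) t(4) by blast
  have "add_div D \<phi> = add_div D (Phi (\<lambda>S. t * u S))" "Phi (\<lambda>S. t * u S) \<in> \<Sigma>"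
    using e3(2) t(5) c(2)[OF t(2)] \<phi>(2) by auto
  then obtain k where "\<And>q. \<phi> q = Phi (\<lambda>S. t * u S) q + k"
    using divisor_determines[OF Sigma_PL[OF \<phi>(1)] Sigma_PL] by blast
  then have "diag_class E (\<lambda>S. \<phi> (pt S)) = diag_class E (\<lambda>S. Phi (\<lambda>S. t * u S) (pt S))"
    unfolding diag_class_eq_iff by blast
  then have "diag_class E (\<lambda>S. t * v S) = diag_class E (\<lambda>S. t * u S)" using diag[OF t(3)] \<phi>(3) by simp
  then obtain k where "\<forall>S\<in>E. t * v S = t * u S + k" unfolding diag_class_eq_iff by blast
  then have "\<forall>S\<in>E. v S = u S + k / t" using t(1) by (simp add: field_simps)
  then show "w = diag_class E u" unfolding c'(2) diag_class_eq_iff by blast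
qed

text \<open>If \<open>\<phi>\<close> were large somewhere, some leg at a vertex \<open>p\<close> would leave a region where \<open>\<phi>\<close> is small
  towards one where it is large; the chips of \<open>p\<close> then sit on that leg at distance at least
  \<open>\<delta> / D p\<close> from \<open>p\<close>, although the divisor of \<open>\<phi>\<close> has chips closer to \<open>p\<close>.\<close>

lemma small_range_if_chips_near:
  assumes t0: "0 < t0" "t0 < \<rho>"
    and chart: "\<And>\<phi>. \<phi> \<in> \<Sigma> \<Longrightarrow> (\<And>q. \<phi> q \<le> low \<phi> + t0) \<Longrightarrow>
       \<exists>x. adm x \<and> (\<forall>S\<in>E. low \<phi> \<le> x S \<and> x S \<le> low \<phi> + t0) \<and> \<phi> = Phi x"
    and \<phi>: "\<phi> \<in> \<Sigma>"
    and \<delta>: "\<delta> = t0 / (real (card E) + 1)"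
    and near: "\<And>p. p \<in> P \<Longrightarrow> \<exists>z. add_div D \<phi> z \<noteq> 0 \<and> dist p z < \<rho> \<and> of_int (D p) * dist p z < \<delta>"
  shows "\<phi> q \<le> low \<phi> + t0"
proof (rule ccontr)
  assume big: "\<not> \<phi> q \<le> low \<phi> + t0"
  \<comment> \<open>The truncation has range at most \<open>t0\<close>, so the chart applies to it
    although \<open>\<phi>\<close> itself is out of its reach.\<close>
  let ?\<psi> = "trunc \<phi> t0"
  have \<psi>: "?\<psi> \<in> \<Sigma>" by (rule trunc_in[OF \<phi>])
  obtain z0 where "z0 \<in> argmin_set \<phi>" using minimum[OF \<phi>] by blast
  then have z0: "?\<psi> z0 = 0" using in_argmin_iff[OF \<phi>] t0(1) by (simp add: trunc_def)
  have nn: "0 \<le> ?\<psi> z" for z using low_le[OF \<phi>, of z] t0(1) by (simp add: trunc_def)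
  have low0: "low ?\<psi> = 0"
  proof -
    have "z0 \<in> argmin_set ?\<psi>" using nn by (simp add: argmin_set_def z0)
    then show ?thesis using low_eq[of z0 ?\<psi>] z0 by simp
  qed
  have "?\<psi> z \<le> low ?\<psi> + t0" for z by (simp add: low0 trunc_def)
  then obtain x where x: "adm x" "\<forall>S\<in>E. low ?\<psi> \<le> x S \<and> x S \<le> low ?\<psi> + t0" "?\<psi> = Phi x"
    using chart[OF \<psi>] by blast
  have xb: "0 \<le> x S" "x S \<le> 0 + t0" if "S \<in> E" for S using x(2) that by (auto simp: low0)
  have d: "0 < \<delta>" "(real (card E) + 1) * \<delta> = t0" using t0(1) by (auto simp: \<delta>)
  \<comment> \<open>An interval of length \<open>\<delta>\<close> without values of
    \<open>x\<close>. Its upper end \<open>\<tau>\<close> splits the components into those with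
    value at least \<open>\<tau>\<close> and those below \<open>\<tau> - \<delta>\<close>.\<close>
  obtain k where k: "k \<le> card E" "\<And>S. S \<in> E \<Longrightarrow> x S < real (k + 1) * \<delta> \<Longrightarrow> x S < real k * \<delta>"
    using ex_gap[OF finite_E d(1), of x] by blast
  define \<tau> where "\<tau> = real (k + 1) * \<delta>"
  have \<tau>: "0 < \<tau>" "\<tau> \<le> t0" "real k * \<delta> = \<tau> - \<delta>"
  proof -
    show "0 < \<tau>" using d(1) by (simp add: \<tau>_def)
    have "\<tau> \<le> (real (card E) + 1) * \<delta>" unfolding \<tau>_def using k(1) d(1) by (intro mult_right_mono) auto
    then show "\<tau> \<le> t0" using d(2) by simp
    show "real k * \<delta> = \<tau> - \<delta>" by (simp add: \<tau>_def algebra_simps)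
  qed
  let ?A = "{S\<in>E. \<tau> \<le> x S}"
  have "?A \<noteq> E"
  proof
    assume "?A = E"
    then have "\<tau> \<le> Phi x z0" using xb by (intro Phi_bounds(1)[of \<tau> x t0]) auto
    then show False using x(3) z0 \<tau>(1) by simp
  qed
  moreover have "?A \<noteq> {}"
  proof
    assume "?A = {}"
    then have "x S \<le> \<tau> - \<delta>" if "S \<in> E" for S using k(2)[OF that] that \<tau>(3) by (auto simp: \<tau>_def not_le)
    then have "Phi x q \<le> \<tau> - \<delta>" using xb by (intro Phi_bounds(2)[of 0]) auto
    moreover have "?\<psi> q = t0" using big by (simp add: trunc_def)
    ultimately show False using x(3) \<tau>(2) d(1) by simp
  qed
  ultimately obtain p i i' where p: "p \<in> P" "i < val p" "i' < val p" "out p i \<in> ?A" "out p i' \<notin> ?A"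
    using mixed_vertex[of ?A] by blast
  have "x (out p i') < \<tau>" using p(5) out_in_E[OF p(1,3)] by auto
  then have "x (out p i') < \<tau> - \<delta>" using k(2)[OF out_in_E[OF p(1,3)]] \<tau>(3) by (simp add: \<tau>_def)
  then have base: "base x p < \<tau> - \<delta>" using base_le[OF p(1,3), of x] by simp
  obtain z where z: "add_div D \<phi> z \<noteq> 0" "dist p z < \<rho>" "of_int (D p) * dist p z < \<delta>"
    using near[OF p(1)] by blast
  obtain a where a: "a < val p" "z = leg p a (dist p z)" using star_cover[OF leg[OF p(1)], of z] z(2) rho by auto
  have "Phi x z \<le> base x p + of_int (D p) * dist p z"
    using Phi_leg[OF p(1) a(1) zero_le_dist z(2), of x] a(2) by simp
  then have "Phi x z < t0" using base z(3) \<tau>(2) by linarith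
  then have z_low: "\<phi> z - low \<phi> < t0" using x(3) by (metis trunc_def min.absorb3 min.commute not_less order_less_irrefl min.absorb1)
  \<comment> \<open>Around \<open>z\<close> the truncation is not active, so both functions have the
    same divisor there, and the chips of the truncation are known from its chart.\<close>
  have "open {y. \<phi> y - low \<phi> < t0}"
    using Sigma_cont[OF \<phi>] by (intro open_Collect_less continuous_intros)
  then obtain \<eta> where \<eta>: "\<eta> > 0" "ball z \<eta> \<subseteq> {y. \<phi> y - low \<phi> < t0}"
    using z_low open_contains_ball by (metis mem_Collect_eq)
  obtain n \<sigma> \<chi>' where st: "star z n \<sigma> \<chi>'" using stars by blast
  have "principal_divisor \<phi> z = principal_divisor ?\<psi> z"
  proof (rule principal_divisor_cong[OF st Sigma_PL[OF \<psi>] \<eta>(1)])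
    fix y assume "dist z y < \<eta>"
    then have "\<phi> y - low \<phi> < t0" using \<eta>(2) by auto
    then show "\<phi> y = ?\<psi> y + low \<phi>" by (simp add: trunc_def)
  qed
  then have nz: "add_div D (Phi x) z \<noteq> 0" using z(1) x(3) by (simp add: add_div_def)
  obtain c where c: "D = tuple_divisor d c" by (rule tuple_D)
  obtain j where j: "leading x j" by (rule leading_exists[OF x(1)])
  have "z \<in> supp (tuple_divisor d (\<lambda>k. leg (c k) (j (c k)) (rise x j (c k))))"
    using nz Phi_divisor[OF xb t0(2) j c] by (simp add: supp_def)
  then obtain l where l: "l < d" "z = leg (c l) (j (c l)) (rise x j (c l))"
    by (auto simp: supp_tuple_divisor)
  have cl: "c l \<in> P" using l(1) supp_tuple_divisor[of d c] c by (metis imageI lessThan_iff)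
  have rb: "0 \<le> rise x j (c l)" "rise x j (c l) \<le> t0" using rise_bounds[OF j xb cl] by auto
  then have dz: "dist (c l) z = rise x j (c l)"
    using dist_leg[OF cl leadingD(1)[OF j cl]] l(2) t0(2) rho by simp
  have "c l = p"
  proof (rule ccontr)
    assume "c l \<noteq> p"
    then have "dist (c l) p > 4 * \<rho>" using sep cl p(1) by blast
    then show False using dist_triangle2[of "c l" p z] dz rb(2) t0(2) z(2) rho by linarith
  qed
  have "j p = i"
  proof (rule ccontr)
    assume "j p \<noteq> i"
    then have "x (out p i) = base x p" using leadingD(2)[OF j p(1,2)] by blast
    then show False using p(4) base d(1) by simp
  qed
  then have "of_int (D p) * dist p z = x (out p i) - base x p"
    using dz \<open>c l = p\<close> pos[OF p(1)] by (simp add: rise_def)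
  then show False using p(4) base z(3) by simp
qed

text \<open>The converse of \<open>adm_curve\<close>. At one small time \<open>t1\<close> the chips
  are so close to \<open>D\<close> that the function has small range and a chart vector
  \<open>x\<close>. Each chip moves along a geodesic, so its position at \<open>t1\<close> fixes its
  whole path up to \<open>t1\<close>, and this path is the one given by the multiples
  \<open>(t / t1) * x\<close>.\<close>

lemma star_curve:
  assumes c0: "c 0 = D" and lin: "sym_linear d \<epsilon> c" and e: "\<epsilon> > 0"
    and mem: "\<And>t. t \<in> {0..\<epsilon>} \<Longrightarrow> c t \<in> linear_system D \<Sigma>"
  obtains u \<epsilon>' where "adm u" "0 < \<epsilon>'"
    "\<And>t. t \<in> {0..\<epsilon>'} \<Longrightarrow> c t = add_div D (Phi (\<lambda>S. t * u S)) \<and> Phi (\<lambda>S. t * u S) \<in> \<Sigma>"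
proof -
  obtain t0 where t0: "0 < t0" "t0 < \<rho>"
    and chart: "\<And>\<phi>. \<phi> \<in> \<Sigma> \<Longrightarrow> (\<And>q. \<phi> q \<le> low \<phi> + t0) \<Longrightarrow>
       \<exists>x. adm x \<and> (\<forall>S\<in>E. low \<phi> \<le> x S \<and> x S \<le> low \<phi> + t0) \<and> \<phi> = Phi x"
    and chart': "\<And>x l. adm x \<Longrightarrow> (\<And>S. S \<in> E \<Longrightarrow> l \<le> x S) \<Longrightarrow> (\<And>S. S \<in> E \<Longrightarrow> x S \<le> l + t0) \<Longrightarrow> Phi x \<in> \<Sigma>"
    by (rule local_charts) blast
  obtain \<gamma> v where \<gamma>: "\<And>k s t. k < d \<Longrightarrow> s \<in> {0..\<epsilon>} \<Longrightarrow> t \<in> {0..\<epsilon>} \<Longrightarrow> dist (\<gamma> k s) (\<gamma> k t) = v k * \<bar>s - t\<bar>"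
    "\<And>t. t \<in> {0..\<epsilon>} \<Longrightarrow> c t = tuple_divisor d (\<lambda>k. \<gamma> k t)"
    using lin unfolding sym_linear_def by blast
  let ?c = "\<lambda>k. \<gamma> k 0"
  have D: "D = tuple_divisor d ?c" using \<gamma>(2)[of 0] c0 e by simp
  have cP: "?c k \<in> P" if "k < d" for k using that D supp_tuple_divisor[of d ?c] by (metis imageI lessThan_iff)
  have v0: "0 \<le> v k" if "k < d" for k
  proof -
    have "0 \<le> v k * \<epsilon>" using \<gamma>(1)[OF that, of 0 \<epsilon>] e zero_le_dist[of "\<gamma> k 0" "\<gamma> k \<epsilon>"] by simp
    then show ?thesis using e by (simp add: zero_le_mult_iff)
  qed
  \<comment> \<open>A common bound for the speeds, as \<open>M\<close> below is for the
    multiplicities; the summand 1 allows division by them.\<close>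
  define V where "V = 1 + (\<Sum>k<d. v k)"
  have V: "v k \<le> V" if "k < d" for k
    using member_le_sum[of k "{..<d}" v] v0 that by (auto simp: V_def)
  have V1: "1 \<le> V" using v0 by (auto simp: V_def intro: sum_nonneg)
  define M where "M = 1 + (\<Sum>p\<in>P. real_of_int (D p))"
  have D0: "0 < real_of_int (D p)" if "p \<in> P" for p using pos[OF that] by simp
  have M: "real_of_int (D p) \<le> M" if "p \<in> P" for p
    using member_le_sum[of p P "\<lambda>p. real_of_int (D p)"] D0 that fin by (force simp: M_def)
  have "0 \<le> (\<Sum>p\<in>P. real_of_int (D p))" using D0 by (intro sum_nonneg less_imp_le)
  then have M1: "1 \<le> M" by (simp add: M_def)
  define \<delta> where "\<delta> = t0 / (real (card E) + 1)"
  have \<delta>: "0 < \<delta>" using t0(1) by (simp add: \<delta>_def)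
  \<comment> \<open>By this time no chip has travelled as far as \<open>\<rho>\<close>, nor as far
    as \<open>\<delta>\<close> even after multiplication by its multiplicity. The factors 2 make
    this strict.\<close>
  define t1 where "t1 = min \<epsilon> (min (\<rho> / (2 * V)) (\<delta> / (2 * V * M)))"
  have t1: "0 < t1" "t1 \<in> {0..\<epsilon>}" using e rho \<delta> V1 M1 by (auto simp: t1_def)
  have Vt1: "V * t1 < \<rho>" "M * (V * t1) < \<delta>"
  proof -
    have "V * t1 \<le> V * (\<rho> / (2 * V))" using V1 by (intro mult_left_mono) (auto simp: t1_def)
    then show "V * t1 < \<rho>" using V1 rho by simp
    have "M * (V * t1) \<le> M * (V * (\<delta> / (2 * V * M)))" using V1 M1 by (intro mult_left_mono) (auto simp: t1_def)
    then show "M * (V * t1) < \<delta>" using V1 M1 \<delta> by simp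
  qed
  have dk: "dist (?c k) (\<gamma> k t) = v k * t" if "k < d" "t \<in> {0..\<epsilon>}" for k t
    using \<gamma>(1)[OF that(1), of 0 t] that e by simp
  have dk1: "dist (?c k) (\<gamma> k t1) \<le> V * t1" if "k < d" for k
    unfolding dk[OF that t1(2)] using V[OF that] t1(1) by (intro mult_right_mono) auto
  obtain \<phi> where \<phi>: "\<phi> \<in> \<Sigma>" "c t1 = add_div D \<phi>" using mem[OF t1(2)] by (auto simp: linear_system_def)
  have "\<phi> q \<le> low \<phi> + t0" for q
  proof (rule small_range_if_chips_near[OF t0 chart \<phi>(1) \<delta>_def])
    fix p assume p: "p \<in> P"
    have "p \<in> supp (tuple_divisor d ?c)" using p D by metis
    then obtain k where k: "k < d" "p = ?c k" by (auto simp: supp_tuple_divisor)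
    have "\<gamma> k t1 \<in> supp (c t1)" using k(1) by (simp add: \<gamma>(2)[OF t1(2)] supp_tuple_divisor)
    then have "add_div D \<phi> (\<gamma> k t1) \<noteq> 0" unfolding \<phi>(2)[symmetric] by (simp add: supp_def)
    moreover have "of_int (D p) * dist p (\<gamma> k t1) \<le> M * (V * t1)"
      using M[OF p] dk1[OF k(1)] k(2) M1 by (intro mult_mono) auto
    ultimately show "\<exists>z. add_div D \<phi> z \<noteq> 0 \<and> dist p z < \<rho> \<and> of_int (D p) * dist p z < \<delta>"
      using dk1[OF k(1)] k(2) Vt1 by (intro exI[of _ "\<gamma> k t1"]) auto
  qed
  then obtain x where x: "adm x" "\<forall>S\<in>E. low \<phi> \<le> x S \<and> x S \<le> low \<phi> + t0" "\<phi> = Phi x"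
    using chart[OF \<phi>(1)] by blast
  have xb: "low \<phi> \<le> x S" "x S \<le> low \<phi> + t0" if "S \<in> E" for S using x(2) that by auto
  obtain j where j: "leading x j" by (rule leading_exists[OF x(1)])
  have ct1: "c t1 = tuple_divisor d (\<lambda>k. leg (?c k) (j (?c k)) (rise x j (?c k)))"
    unfolding \<phi>(2) x(3) by (rule Phi_divisor[OF xb t0(2) j D])
  have rb: "0 \<le> rise x j p" "rise x j p \<le> t0" if "p \<in> P" for p using rise_bounds[OF j xb that] by auto
  \<comment> \<open>Equality of divisors matches positions only up to a permutation of the entries.
    Both positions are near their starting chips, which are far apart from each other, so entry
    \<open>k\<close> is matched with an entry that starts at the same chip.\<close>
  have at1: "\<gamma> k t1 = leg (?c k) (j (?c k)) (rise x j (?c k))" if k: "k < d" for k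
  proof -
    have "\<gamma> k t1 \<in> supp (c t1)" using k by (simp add: \<gamma>(2)[OF t1(2)] supp_tuple_divisor)
    then obtain l where l: "l < d" "\<gamma> k t1 = leg (?c l) (j (?c l)) (rise x j (?c l))"
      unfolding ct1 by (auto simp: supp_tuple_divisor)
    have dl: "dist (?c l) (\<gamma> k t1) \<le> t0"
      using dist_leg[OF cP[OF l(1)] leadingD(1)[OF j cP[OF l(1)]], of "rise x j (?c l)"] rb[OF cP[OF l(1)]] l(2) t0(2) rho
      by simp
    have "?c l = ?c k"
    proof (rule ccontr)
      assume "?c l \<noteq> ?c k"
      then have "dist (?c l) (?c k) > 4 * \<rho>" using sep cP[OF k] cP[OF l(1)] by blast
      then show False
        using dist_triangle2[of "?c l" "?c k" "\<gamma> k t1"] dl dk1[OF k] Vt1(1) t0(2) rho by linarith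
    qed
    then show ?thesis using l(2) by simp
  qed
  have rise_v: "rise x j (?c k) = v k * t1" if k: "k < d" for k
    using dk[OF k t1(2)] at1[OF k] dist_leg[OF cP[OF k] leadingD(1)[OF j cP[OF k]], of "rise x j (?c k)"]
      rb[OF cP[OF k]] t0(2) rho by simp
  \<comment> \<open>A chip with positive speed stays on one leg, and its position at
    \<open>t1\<close>, away from the centre, identifies this leg as the leading one.\<close>
  have \<gamma>t: "\<gamma> k t = leg (?c k) (j (?c k)) (v k * t)" if k: "k < d" and t: "t \<in> {0..t1}" for k t
  proof (cases "v k = 0")
    case True
    then have "\<gamma> k t = ?c k" using dk[OF k, of t] t t1(2) by simp
    then show ?thesis using True leg_0[OF cP[OF k] leadingD(1)[OF j cP[OF k]]] by simp
  next
    case False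
    then have vk: "0 < v k" using v0[OF k] by simp
    have le: "v k * t1 \<le> 2 * \<rho>" using rise_v[OF k] rb(2)[OF cP[OF k]] t0(2) rho by simp
    have geo: "dist (\<gamma> k s) (\<gamma> k t) = v k * \<bar>s - t\<bar>" if "s \<in> {0..t1}" "t \<in> {0..t1}" for s t
      using that t1(2) by (intro \<gamma>(1)[OF k]) auto
    obtain i where i: "i < val (?c k)" "\<And>t. t \<in> {0..t1} \<Longrightarrow> \<gamma> k t = leg (?c k) i (v k * t)"
      using geodesic_in_star[where \<alpha> = "\<gamma> k", OF leg[OF cP[OF k]] vk t1(1) le refl geo] by blast
    have "leg (?c k) i (v k * t1) = leg (?c k) (j (?c k)) (v k * t1)"
      using i(2)[of t1] at1[OF k] rise_v[OF k] t1(1) by simp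
    then have "i = j (?c k)"
      using leg_inj(2)[OF cP[OF k] i(1) _ le cP[OF k] leadingD(1)[OF j cP[OF k]] _ le] vk t1(1) by simp
    then show ?thesis using i(2)[OF t] by simp
  qed
  define u where "u S = (1 / t1) * x S" for S
  have u: "adm u" unfolding u_def[abs_def] using t1(1) by (intro adm_scale[OF x(1)]) simp
  have tu: "(\<lambda>S. t * u S) = (\<lambda>S. (t / t1) * x S)" for t by (simp add: u_def)
  show ?thesis
  proof (rule that[OF u t1(1)])
    fix t assume t: "t \<in> {0..t1}"
    define s where "s = t / t1"
    have s: "0 \<le> s" "s \<le> 1" "s * t1 = t" using t t1(1) by (auto simp: s_def)
    have bd: "s * low \<phi> \<le> s * x S" "s * x S \<le> s * low \<phi> + t0" if "S \<in> E" for S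
    proof -
      show "s * low \<phi> \<le> s * x S" using xb(1)[OF that] s by (intro mult_left_mono)
      have "s * x S \<le> s * (low \<phi> + t0)" using xb(2)[OF that] s by (intro mult_left_mono)
      also have "\<dots> \<le> s * low \<phi> + 1 * t0" unfolding distrib_left using s t0(1) by (intro add_left_mono mult_right_mono) auto
      finally show "s * x S \<le> s * low \<phi> + t0" by simp
    qed
    have "add_div D (Phi (\<lambda>S. s * x S)) = tuple_divisor d (\<lambda>k. leg (?c k) (j (?c k)) (rise (\<lambda>S. s * x S) j (?c k)))"
      by (rule Phi_divisor[OF bd t0(2) leading_scale[OF j s(1)] D])
    also have "\<dots> = tuple_divisor d (\<lambda>k. \<gamma> k t)"
    proof (rule tuple_divisor_cong)
      fix k assume k: "k < d"
      have "rise (\<lambda>S. s * x S) j (?c k) = v k * t"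
        using rise_scale[OF cP[OF k] s(1)] rise_v[OF k] s(3) by (simp add: ac_simps)
      then show "leg (?c k) (j (?c k)) (rise (\<lambda>S. s * x S) j (?c k)) = \<gamma> k t" using \<gamma>t[OF k t] by simp
    qed
    also have "\<dots> = c t" using \<gamma>(2)[of t] t t1(2) by simp
    finally have "c t = add_div D (Phi (\<lambda>S. s * x S))" by simp
    moreover have "Phi (\<lambda>S. s * x S) \<in> \<Sigma>"
      by (rule chart'[OF adm_scale[OF x(1) s(1)] bd])
    ultimately show "c t = add_div D (Phi (\<lambda>S. t * u S)) \<and> Phi (\<lambda>S. t * u S) \<in> \<Sigma>"
      unfolding tu s_def by blast
  qed
qed

lemma Star_curve:
  assumes "\<xi> \<in> Star d (linear_system D \<Sigma>) D"
  obtains c u \<epsilon> where "\<xi> = germ_rel `` {c}" "adm u" "0 < \<epsilon>"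
    "\<And>t. t \<in> {0..\<epsilon>} \<Longrightarrow> c t = add_div D (Phi (\<lambda>S. t * u S)) \<and> Phi (\<lambda>S. t * u S) \<in> \<Sigma>"
proof -
  obtain c \<epsilon> where c: "\<xi> = germ_rel `` {c}" "c 0 = D" "\<epsilon> > 0" "sym_linear d \<epsilon> c" "\<forall>t\<in>{0..\<epsilon>}. c t \<in> linear_system D \<Sigma>"
    using assms by (auto simp: Star_def elim!: quotientE)
  obtain u \<epsilon>' where "adm u" "0 < \<epsilon>'"
    "\<And>t. t \<in> {0..\<epsilon>'} \<Longrightarrow> c t = add_div D (Phi (\<lambda>S. t * u S)) \<and> Phi (\<lambda>S. t * u S) \<in> \<Sigma>"
    using star_curve[OF c(2,4,3)] c(5) by blast
  then show ?thesis using that c(1) by blast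
qed

text \<open>Vectors of the same class differ by a constant \<open>k\<close>, so at time
  \<open>t\<close> their functions differ by \<open>t * k\<close> and have equal divisors.\<close>

lemma star_eval_inj:
  assumes pt: "\<And>S. S \<in> E \<Longrightarrow> pt S \<in> S"
  shows "inj_on (star_eval D \<Sigma> E pt) (Star d (linear_system D \<Sigma>) D)"
proof (rule inj_onI)
  fix \<xi> \<xi>' assume "\<xi> \<in> Star d (linear_system D \<Sigma>) D" "\<xi>' \<in> Star d (linear_system D \<Sigma>) D"
    and eq: "star_eval D \<Sigma> E pt \<xi> = star_eval D \<Sigma> E pt \<xi>'"
  then obtain c u \<epsilon> c' u' \<epsilon>' where
    c: "\<xi> = germ_rel `` {c}" "0 < \<epsilon>"
    "\<And>t. t \<in> {0..\<epsilon>} \<Longrightarrow> c t = add_div D (Phi (\<lambda>S. t * u S)) \<and> Phi (\<lambda>S. t * u S) \<in> \<Sigma>" and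
    c': "\<xi>' = germ_rel `` {c'}" "0 < \<epsilon>'"
    "\<And>t. t \<in> {0..\<epsilon>'} \<Longrightarrow> c' t = add_div D (Phi (\<lambda>S. t * u' S)) \<and> Phi (\<lambda>S. t * u' S) \<in> \<Sigma>"
    using Star_curve by metis
  have "diag_class E u = diag_class E u'"
    using eq star_eval_eq[OF pt c(2,3)] star_eval_eq[OF pt c'(2,3)] c(1) c'(1) by simp
  then obtain k where k: "\<forall>S\<in>E. u S = u' S + k" unfolding diag_class_eq_iff by blast
  have "c t = c' t" if "t \<in> {0..min \<epsilon> \<epsilon>'}" for t
  proof -
    have t: "t \<in> {0..\<epsilon>}" "t \<in> {0..\<epsilon>'}" using that by auto
    have "Phi (\<lambda>S. t * u S) = Phi (\<lambda>S. t * u' S + t * k)"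
      using k by (intro Phi_cong) (simp add: distrib_left)
    then have "add_div D (Phi (\<lambda>S. t * u S)) = add_div D (Phi (\<lambda>S. t * u' S))"
      using c'(3)[OF t(2)] by (intro add_div_add_const[of _ _ "t * k"] Sigma_PL) (auto simp: Phi_add)
    then show ?thesis using c(3)[OF t(1)] c'(3)[OF t(2)] by simp
  qed
  then have "(c, c') \<in> germ_rel"
    unfolding germ_rel_def using c(2) c'(2) by (auto intro!: exI[of _ "min \<epsilon> \<epsilon>'"])
  then show "\<xi> = \<xi>'" unfolding c(1) c'(1) by (rule equiv_class_eq[OF germ_rel_equiv])
qed

text \<open>On both sides the classes are those of the admissible vectors: \<open>Star_curve\<close>
  and \<open>adm_curve\<close> show this for the star, \<open>bergman_iff\<close> for the
  fan.\<close>

lemma star_eval_image: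
  assumes pt: "\<And>S. S \<in> E \<Longrightarrow> pt S \<in> S"
  shows "star_eval D \<Sigma> E pt ` Star d (linear_system D \<Sigma>) D = bergman_support E ind"
proof (intro equalityI subsetI)
  fix w assume "w \<in> star_eval D \<Sigma> E pt ` Star d (linear_system D \<Sigma>) D"
  then obtain \<xi> where \<xi>: "\<xi> \<in> Star d (linear_system D \<Sigma>) D" "w = star_eval D \<Sigma> E pt \<xi>" by blast
  obtain c u \<epsilon> where c: "\<xi> = germ_rel `` {c}" "adm u" "0 < \<epsilon>"
    "\<And>t. t \<in> {0..\<epsilon>} \<Longrightarrow> c t = add_div D (Phi (\<lambda>S. t * u S)) \<and> Phi (\<lambda>S. t * u S) \<in> \<Sigma>"
    using Star_curve[OF \<xi>(1)] by blast
  have "w = diag_class E u" using star_eval_eq[OF pt c(3,4)] c(1) \<xi>(2) by simp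
  then show "w \<in> bergman_support E ind"
    using c(2) bergman_iff[of u] unfolding bergman_support_def adm_def by blast
next
  fix w assume "w \<in> bergman_support E ind"
  then obtain u where u: "w = diag_class E u" "adm u"
    using bergman_iff unfolding bergman_support_def adm_def by blast
  obtain \<epsilon> where e: "0 < \<epsilon>" "sym_linear d \<epsilon> (\<lambda>t. add_div D (Phi (\<lambda>S. t * u S)))"
    "\<And>t. t \<in> {0..\<epsilon>} \<Longrightarrow> Phi (\<lambda>S. t * u S) \<in> \<Sigma>"
    using adm_curve[OF u(2)] by blast
  let ?c = "\<lambda>t. add_div D (Phi (\<lambda>S. t * u S))"
  have "?c 0 = D" by (simp add: Phi_const add_div_const)
  then have "germ_rel `` {?c} \<in> Star d (linear_system D \<Sigma>) D"
    unfolding Star_def linear_system_def using e by (intro quotientI) blast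
  moreover have "star_eval D \<Sigma> E pt (germ_rel `` {?c}) = w"
    using star_eval_eq[OF pt e(1), of ?c u] e(3) u(1) by simp
  ultimately show "w \<in> star_eval D \<Sigma> E pt ` Star d (linear_system D \<Sigma>) D" by blast
qed

end

theorem theorem1p14:
  fixes D :: "('a::metric_space) divisor"
    and \<Sigma> :: "('a \<Rightarrow> real) set"
    and r :: nat
    and E :: "'a set set"
  assumes "metric_graph TYPE('a)"
    and "is_divisor D"
    and "tropical_linear_series D \<Sigma> r"
    and "nondegenerate D \<Sigma> D"
    and "E = components (- supp D)"
  shows "\<exists>indep. matroid E indep \<and> matroid_rank indep E = r + 1 \<and>
           matroid_flats E indep = {flat_of E \<phi> | \<phi>. \<phi> \<in> \<Sigma>} \<union> {E} \<and>
           (\<forall>pt. (\<forall>S\<in>E. pt S \<in> S) \<longrightarrow>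
              inj_on (star_eval D \<Sigma> E pt) (Star (nat (divisor_degree D)) (linear_system D \<Sigma>) D) \<and>
              star_eval D \<Sigma> E pt ` Star (nat (divisor_degree D)) (linear_system D \<Sigma>) D =
                bergman_support E indep)"
proof -
  have fin: "finite (supp D)" using assms(2) by (simp add: is_divisor_def)
  have stars: "\<exists>n \<sigma> \<psi>. star p n \<sigma> \<psi>" for p :: 'a
    using assms(1) star_of_star_nbhd unfolding metric_graph_def by metis
  have "\<exists>\<phi>\<in>\<Sigma>. D = add_div D \<phi>"
    using assms(4) by (auto simp: nondegenerate_def Let_def linear_system_def)
  then have "effective D"
    using assms(3) unfolding tropical_linear_series_def rational_sections_def by auto
  then have pos: "D p > 0" if "p \<in> supp D" for p
    using that by (simp add: effective_def supp_def order_less_le)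
  obtain val \<sigma> leg where leg: "\<And>p :: 'a. star p (val p) (\<sigma> p) (leg p)" using stars by metis
  \<comment> \<open>Halving the radii leaves legs of length \<open>2 * \<rho>\<close>, a fifth of
    the distances gives separation by strictly more than \<open>4 * \<rho>\<close>, and the entry 1
    covers an empty support.\<close>
  define \<rho> where "\<rho> = Min (insert 1 ((\<lambda>p. \<sigma> p / 2) ` supp D \<union>
    (\<lambda>(p, q). dist p q / 5) ` {(p, q) \<in> supp D \<times> supp D. p \<noteq> q}))" (is "_ = Min ?R")
  have finR: "finite ?R" using fin by (auto intro: finite_subset[of _ "supp D \<times> supp D"])
  have "\<forall>s\<in>?R. 0 < s" using starD(2)[OF leg] by auto
  then have rho: "0 < \<rho>" unfolding \<rho>_def using finR by (subst Min_gr_iff) auto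
  have rho_leg: "2 * \<rho> \<le> \<sigma> p" if "p \<in> supp D" for p
  proof -
    have "\<rho> \<le> \<sigma> p / 2" unfolding \<rho>_def using that by (intro Min_le finR) blast
    then show ?thesis by simp
  qed
  have rho_sep: "4 * \<rho> < dist p q" if "p \<in> supp D" "q \<in> supp D" "p \<noteq> q" for p q
  proof -
    have "\<rho> \<le> dist p q / 5" unfolding \<rho>_def using that by (intro Min_le finR) force
    then show ?thesis using rho by simp
  qed
  interpret nondegenerate_series D val leg \<rho> \<Sigma> r
    using assms(1,3,4) stars fin pos rho rho_sep star_mono[OF leg _ rho_leg]
    by unfold_locales (auto simp: metric_graph_def)
  have "insert E flats = {flat_of E \<phi> | \<phi>. \<phi> \<in> \<Sigma>} \<union> {E}"
    using assms(5) by (auto simp: flats_def)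
  then show ?thesis
    using matroid_ind rank_E flats_eq flats_empty star_eval_inj star_eval_image unfolding assms(5)
    by (intro exI[of _ ind]) auto
qed

end
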